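(* Let $C$ be the Cesàro operator on $L^2(0,1)$, $(Cf)(x)=\frac1x\int_0^x\frac{f(t)}{1-t}\,dt$ for $0<x<1$, and let $\mathcal{M}$ be a closed subspace of $L^2(0,1)$. Then $\mathcal{M}$ is invariant for $C$ (that is, $C\mathcal{M}\subseteq\mathcal{M}$) if and only if either $$\mathcal{M}=\Phi^{-1}\big(\mathscr{F}^{-1}(\chi_A L^2(-\infty,\infty))\big)$$ for some measurable set $A\subseteq(-\infty,\infty)$, or $$\mathcal{M}=\Phi^{-1}\big(\mathscr{F}^{-1}(q\,\mathcal{H}^2)\big)$$ for some measurable unimodular function $q$ on $(-\infty,\infty)$.
   Context: All $L^2$ spaces consist of complex-valued functions and are taken with respect to Lebesgue measure. $\Phi:L^2(0,1)\to L^2(-\infty,\infty)$ is the isometric isomorphism $$(\Phi f)(u)=\frac{e^{u/2}}{1+e^u}f\Big(\frac{1}{1+e^u}\Big),\qquad (\Phi^{-1}g)(x)=\frac1x\sqrt{\frac{x}{1-x}}\;g\Big(\log\frac{1-x}{x}\Big).$$ $\mathscr{F}$ is the unitary Fourier transform on $L^2(-\infty,\infty)$, $(\mathscr{F}g)(s)=\frac{1}{\sqrt{2\pi}}\int_{-\infty}^\infty g(x)e^{-ixs}\,dx$. $\mathcal{H}^2:=\mathscr{F}^{-1}(\chi_{(0,\infty)}L^2(-\infty,\infty))$ is the Hardy space of the real line. $\chi_A$ is the indicator function of $A$; unimodular means $|q|=1$ almost everywhere. *)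

theory Defs
  imports "HOL-Analysis.Analysis"
begin

definition square_integrable :: "'a measure \<Rightarrow> ('a \<Rightarrow> complex) \<Rightarrow> bool" where
  "square_integrable M f \<longleftrightarrow>
     f \<in> borel_measurable M \<and> integrable M (\<lambda>x. (cmod (f x))\<^sup>2)"

lemma square_integrable_inner:
  assumes "square_integrable M f" "square_integrable M g"
  shows "integrable M (\<lambda>x. f x \<bullet> g x)"
proof (rule Bochner_Integration.integrable_bound)
  show "integrable M (\<lambda>x. (cmod (f x))\<^sup>2 + (cmod (g x))\<^sup>2)"
    using assms by (simp add: square_integrable_def)
  show "(\<lambda>x. f x \<bullet> g x) \<in> borel_measurable M"
    using assms by (auto simp: square_integrable_def)
  have "\<bar>f x \<bullet> g x\<bar> \<le> (cmod (f x))\<^sup>2 + (cmod (g x))\<^sup>2" for x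
  proof -
    have "\<bar>f x \<bullet> g x\<bar> \<le> cmod (f x) * cmod (g x)"
      by (rule Cauchy_Schwarz_ineq2)
    moreover have "0 \<le> (cmod (f x) - cmod (g x))\<^sup>2" "0 \<le> cmod (f x) * cmod (g x)"
      by simp_all
    ultimately show ?thesis
      by (simp add: power2_diff)
  qed
  then show "AE x in M. norm (f x \<bullet> g x) \<le> norm ((cmod (f x))\<^sup>2 + (cmod (g x))\<^sup>2)"
    by simp
qed

lemma square_integrable_zero: "square_integrable M (\<lambda>x. 0)"
  by (simp add: square_integrable_def)

lemma square_integrable_add:
  assumes "square_integrable M f" "square_integrable M g"
  shows "square_integrable M (\<lambda>x. f x + g x)"
proof -
  have "integrable M (\<lambda>x. f x \<bullet> f x + 2 * (f x \<bullet> g x) + g x \<bullet> g x)"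
    using square_integrable_inner[OF assms(1) assms(1)] square_integrable_inner[OF assms]
      square_integrable_inner[OF assms(2) assms(2)]
    by simp
  also have "(\<lambda>x. f x \<bullet> f x + 2 * (f x \<bullet> g x) + g x \<bullet> g x) = (\<lambda>x. (cmod (f x + g x))\<^sup>2)"
    by (simp add: power2_norm_eq_inner inner_add_left inner_add_right inner_commute add_ac)
  finally have "integrable M (\<lambda>x. (cmod (f x + g x))\<^sup>2)" .
  moreover have "(\<lambda>x. f x + g x) \<in> borel_measurable M"
    using assms unfolding square_integrable_def by (intro borel_measurable_add) simp_all
  ultimately show ?thesis
    unfolding square_integrable_def by simp
qed

lemma square_integrable_mult_const:
  assumes "square_integrable M f"
  shows "square_integrable M (\<lambda>x. c * f x)"
proof -
  have "(\<lambda>x. c * f x) \<in> borel_measurable M"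
    using assms unfolding square_integrable_def by (intro borel_measurable_times) simp_all
  with assms show ?thesis
    unfolding square_integrable_def by (simp add: norm_mult power_mult_distrib)
qed

text \<open>
  \<open>L\<^sup>2\<close> spaces of complex functions on the line, with functions identified when they agree almost
  everywhere. The parameter \<open>'d\<close> of the type \<open>'d l2\<close> is a phantom that selects the measure.
\<close>

class l2_domain =
  fixes l2_measure :: "'a itself \<Rightarrow> real measure"

datatype real_line = Real_Line
datatype unit_interval = Unit_Interval

instantiation real_line :: l2_domain
begin
definition "l2_measure (_ :: real_line itself) = (lebesgue :: real measure)"
instance ..
end

instantiation unit_interval :: l2_domain
begin
definition "l2_measure (_ :: unit_interval itself) = lebesgue_on {0<..<1::real}"
instance ..
end

definition l2_rel :: "'d::l2_domain itself \<Rightarrow> (real \<Rightarrow> complex) \<Rightarrow> (real \<Rightarrow> complex) \<Rightarrow> bool" where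
  "l2_rel d f g \<longleftrightarrow> square_integrable (l2_measure d) f \<and> square_integrable (l2_measure d) g \<and>
     (AE x in l2_measure d. f x = g x)"

lemma part_equivp_l2_rel: "part_equivp (l2_rel d)"
proof (rule part_equivpI)
  show "\<exists>f. l2_rel d f f"
    by (rule exI[of _ "\<lambda>x. 0"]) (simp add: l2_rel_def square_integrable_zero)
  show "symp (l2_rel d)"
  proof (rule sympI)
    fix f g
    assume *: "l2_rel d f g"
    then have "AE x in l2_measure d. f x = g x"
      by (simp add: l2_rel_def)
    then have "AE x in l2_measure d. g x = f x"
      by eventually_elim simp
    with * show "l2_rel d g f"
      by (simp add: l2_rel_def)
  qed
  show "transp (l2_rel d)"
  proof (rule transpI)
    fix f g h
    assume *: "l2_rel d f g" "l2_rel d g h"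
    then have "AE x in l2_measure d. f x = g x" "AE x in l2_measure d. g x = h x"
      by (simp_all add: l2_rel_def)
    then have "AE x in l2_measure d. f x = h x"
      by eventually_elim simp
    with * show "l2_rel d f h"
      by (simp add: l2_rel_def)
  qed
qed

typedef (overloaded) 'd l2 =
  "{X. \<exists>f. l2_rel TYPE('d::l2_domain) f f \<and> X = Collect (l2_rel TYPE('d) f)}"
  morphisms class_of_l2 l2_of_class
proof -
  have "l2_rel TYPE('d) (\<lambda>x. 0) (\<lambda>x. 0)"
    by (simp add: l2_rel_def square_integrable_zero)
  then show ?thesis
    by blast
qed

definition abs_l2 :: "(real \<Rightarrow> complex) \<Rightarrow> 'd::l2_domain l2" where
  "abs_l2 f = l2_of_class (Collect (l2_rel TYPE('d) f))"

definition rep_l2 :: "'d::l2_domain l2 \<Rightarrow> real \<Rightarrow> complex" where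
  "rep_l2 F = (SOME f. f \<in> class_of_l2 F)"

definition cr_l2 :: "(real \<Rightarrow> complex) \<Rightarrow> 'd::l2_domain l2 \<Rightarrow> bool" where
  "cr_l2 = (\<lambda>f F. l2_rel TYPE('d) f f \<and> abs_l2 f = F)"

lemma Quotient_l2:
  "Quotient (l2_rel TYPE('d)) abs_l2 rep_l2 (cr_l2 :: _ \<Rightarrow> 'd::l2_domain l2 \<Rightarrow> bool)"
proof -
  interpret quot_type "l2_rel TYPE('d)" "l2_of_class :: _ \<Rightarrow> 'd l2" class_of_l2
  proof
    show "\<exists>f. l2_rel TYPE('d) f f \<and> class_of_l2 F = Collect (l2_rel TYPE('d) f)" for F :: "'d l2"
      using class_of_l2[of F] by simp
    show "l2_of_class (class_of_l2 F) = F" for F :: "'d l2"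
      by (rule class_of_l2_inverse)
    show "class_of_l2 (l2_of_class X :: 'd l2) = X"
      if "\<exists>f. l2_rel TYPE('d) f f \<and> X = Collect (l2_rel TYPE('d) f)" for X
      using that by (simp add: l2_of_class_inverse)
    show "(class_of_l2 F = class_of_l2 G) = (F = G)" for F G :: "'d l2"
      by (rule class_of_l2_inject)
  qed (rule part_equivp_l2_rel)
  have "abs = (abs_l2 :: _ \<Rightarrow> 'd l2)" "rep = (rep_l2 :: 'd l2 \<Rightarrow> _)"
    by (simp_all add: fun_eq_iff abs_def rep_def abs_l2_def rep_l2_def)
  with Quotient show ?thesis
    by (simp add: Quotient3_to_Quotient cr_l2_def)
qed

setup_lifting Quotient_l2

instantiation l2 :: (l2_domain) real_vector
begin

lift_definition zero_l2 :: "'a l2" is "\<lambda>x. 0"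
  by (simp add: l2_rel_def square_integrable_zero)

lift_definition plus_l2 :: "'a l2 \<Rightarrow> 'a l2 \<Rightarrow> 'a l2" is "\<lambda>f g x. f x + g x"
proof -
  fix f f' g g' :: "real \<Rightarrow> complex"
  assume *: "l2_rel TYPE('a) f f'" "l2_rel TYPE('a) g g'"
  then have "AE x in l2_measure TYPE('a). f x = f' x" "AE x in l2_measure TYPE('a). g x = g' x"
    by (simp_all add: l2_rel_def)
  then have "AE x in l2_measure TYPE('a). f x + g x = f' x + g' x"
    by eventually_elim simp
  with * show "l2_rel TYPE('a) (\<lambda>x. f x + g x) (\<lambda>x. f' x + g' x)"
    by (simp add: l2_rel_def square_integrable_add)
qed

lift_definition uminus_l2 :: "'a l2 \<Rightarrow> 'a l2" is "\<lambda>f x. - f x"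
  using square_integrable_mult_const[where c = "-1"] by (auto simp: l2_rel_def)

definition minus_l2 :: "'a l2 \<Rightarrow> 'a l2 \<Rightarrow> 'a l2" where
  "minus_l2 f g = f + - g"

lift_definition scaleR_l2 :: "real \<Rightarrow> 'a l2 \<Rightarrow> 'a l2" is "\<lambda>c f x. of_real c * f x"
  by (auto simp: l2_rel_def square_integrable_mult_const)

instance
proof
  fix f g h :: "'a l2" and a b :: real
  show "f + g + h = f + (g + h)"
    by transfer (simp add: l2_rel_def square_integrable_add ac_simps)
  show "f + g = g + f"
    by transfer (simp add: l2_rel_def square_integrable_add ac_simps)
  show "0 + f = f"
    by transfer (auto simp: l2_rel_def)
  show "- f + f = 0"
    by transfer (auto simp: l2_rel_def square_integrable_zero)
  show "f - g = f + - g"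
    by (rule minus_l2_def)
  show "a *\<^sub>R (f + g) = a *\<^sub>R f + a *\<^sub>R g"
    by transfer (simp add: l2_rel_def square_integrable_add square_integrable_mult_const
        distrib_left distrib_right mult.assoc)
  show "(a + b) *\<^sub>R f = a *\<^sub>R f + b *\<^sub>R f"
    by transfer (simp add: l2_rel_def square_integrable_add square_integrable_mult_const
        distrib_left distrib_right mult.assoc)
  show "a *\<^sub>R b *\<^sub>R f = (a * b) *\<^sub>R f"
    by transfer (simp add: l2_rel_def square_integrable_add square_integrable_mult_const
        distrib_left distrib_right mult.assoc)
  show "1 *\<^sub>R f = f"
    by transfer (auto simp: l2_rel_def)
qed

end

instantiation l2 :: (l2_domain) real_inner
begin

text \<open>\<open>f \<bullet> g\<close> is the real part of the complex inner product; its norm is the \<open>L\<^sup>2\<close> norm.\<close>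

lift_definition inner_l2 :: "'a l2 \<Rightarrow> 'a l2 \<Rightarrow> real" is
  "\<lambda>f g. integral\<^sup>L (l2_measure TYPE('a)) (\<lambda>x. f x \<bullet> g x)"
proof -
  fix f f' g g' :: "real \<Rightarrow> complex"
  assume *: "l2_rel TYPE('a) f f'" "l2_rel TYPE('a) g g'"
  show "integral\<^sup>L (l2_measure TYPE('a)) (\<lambda>x. f x \<bullet> g x) =
        integral\<^sup>L (l2_measure TYPE('a)) (\<lambda>x. f' x \<bullet> g' x)"
  proof (rule integral_cong_AE)
    from * have "AE x in l2_measure TYPE('a). f x = f' x" "AE x in l2_measure TYPE('a). g x = g' x"
      by (simp_all add: l2_rel_def)
    then show "AE x in l2_measure TYPE('a). f x \<bullet> g x = f' x \<bullet> g' x"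
      by eventually_elim simp
  qed (use * in \<open>auto simp: l2_rel_def square_integrable_def\<close>)
qed

definition norm_l2 :: "'a l2 \<Rightarrow> real" where "norm_l2 f = sqrt (f \<bullet> f)"
definition sgn_l2 :: "'a l2 \<Rightarrow> 'a l2" where "sgn_l2 f = f /\<^sub>R norm f"
definition dist_l2 :: "'a l2 \<Rightarrow> 'a l2 \<Rightarrow> real" where "dist_l2 f g = norm (f - g)"
definition uniformity_l2 :: "('a l2 \<times> 'a l2) filter" where
  "uniformity_l2 = (INF e\<in>{0<..}. principal {(f, g). dist f g < e})"
definition open_l2 :: "'a l2 set \<Rightarrow> bool" where
  "open_l2 U \<longleftrightarrow> (\<forall>f\<in>U. \<forall>\<^sub>F (f', g) in uniformity. f' = f \<longrightarrow> g \<in> U)"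

instance
proof
  fix f g h :: "'a l2" and a b :: real
  show "dist f g = norm (f - g)" by (rule dist_l2_def)
  show "sgn f = f /\<^sub>R norm f" by (rule sgn_l2_def)
  show "uniformity = (INF e\<in>{0<..}. principal {(f, g :: 'a l2). dist f g < e})"
    by (rule uniformity_l2_def)
  show "open U \<longleftrightarrow> (\<forall>f\<in>U. \<forall>\<^sub>F (f', g) in uniformity. f' = f \<longrightarrow> g \<in> U)" for U :: "'a l2 set"
    by (rule open_l2_def)
  show "f \<bullet> g = g \<bullet> f"
    by transfer (simp add: inner_commute)
  show "(f + g) \<bullet> h = f \<bullet> h + g \<bullet> h"
    by transfer (simp add: l2_rel_def inner_add_left square_integrable_inner)
  show "(a *\<^sub>R f) \<bullet> g = a * (f \<bullet> g)"
    by transfer (simp flip: scaleR_conv_of_real)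
  show "0 \<le> f \<bullet> f"
    by transfer simp
  show "f \<bullet> f = 0 \<longleftrightarrow> f = 0"
  proof transfer
    fix f :: "real \<Rightarrow> complex"
    assume f: "l2_rel TYPE('a) f f"
    have "integral\<^sup>L (l2_measure TYPE('a)) (\<lambda>x. f x \<bullet> f x) = 0 \<longleftrightarrow>
          (AE x in l2_measure TYPE('a). f x \<bullet> f x = 0)"
      by (rule integral_nonneg_eq_0_iff_AE)
         (use f in \<open>auto simp: l2_rel_def intro: square_integrable_inner\<close>)
    then show "integral\<^sup>L (l2_measure TYPE('a)) (\<lambda>x. f x \<bullet> f x) = 0 \<longleftrightarrow>
          l2_rel TYPE('a) f (\<lambda>x. 0)"
      using f by (auto simp: l2_rel_def square_integrable_zero)
  qed
  show "norm f = sqrt (f \<bullet> f)" by (rule norm_l2_def)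
qed

end

lift_definition scaleC :: "complex \<Rightarrow> 'd::l2_domain l2 \<Rightarrow> 'd l2" is "\<lambda>c f x. c * f x"
  by (auto simp: l2_rel_def square_integrable_mult_const)

global_interpretation l2: vector_space "scaleC :: complex \<Rightarrow> 'd::l2_domain l2 \<Rightarrow> 'd l2"
proof
  fix a b :: complex and f g :: "'d l2"
  show "scaleC a (f + g) = scaleC a f + scaleC a g"
    by transfer (simp add: l2_rel_def square_integrable_add square_integrable_mult_const
        distrib_left distrib_right mult.assoc)
  show "scaleC (a + b) f = scaleC a f + scaleC b f"
    by transfer (simp add: l2_rel_def square_integrable_add square_integrable_mult_const
        distrib_left distrib_right mult.assoc)
  show "scaleC a (scaleC b f) = scaleC (a * b) f"
    by transfer (simp add: l2_rel_def square_integrable_add square_integrable_mult_const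
        distrib_left distrib_right mult.assoc)
  show "scaleC 1 f = f"
    by transfer (auto simp: l2_rel_def)
qed

text \<open>
  In the definitions below \<open>rep_l2 f\<close> is a representative of the class \<open>f\<close>, and \<open>abs_l2\<close> sends a
  square integrable function to its class (its value at other functions is unspecified). None of the
  results depends on the representative.
\<close>

definition cesaro :: "unit_interval l2 \<Rightarrow> unit_interval l2" where
  "cesaro f = abs_l2 (\<lambda>x. 1 / of_real x * (LINT t:{0<..<x}|lebesgue. rep_l2 f t / of_real (1 - t)))"

text \<open>
  \<open>Phi\<close> is an isometric bijection; the substitution \<open>x = 1 / (1 + exp u)\<close>, that is
  \<open>u = ln ((1 - x) / x)\<close>, gives its inverse
  \<open>(inv Phi g)(x) = 1 / x * sqrt (x / (1 - x)) * g (ln ((1 - x) / x))\<close>.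
\<close>

definition Phi :: "unit_interval l2 \<Rightarrow> real_line l2" where
  "Phi f = abs_l2 (\<lambda>u. of_real (exp (u / 2) / (1 + exp u)) * rep_l2 f (1 / (1 + exp u)))"

text \<open>
  The integral defining the Fourier transform need not converge for a square integrable function,
  so the transform is the \<open>L\<^sup>2\<close> limit of the transforms of the truncations.
\<close>

definition fourier :: "real_line l2 \<Rightarrow> real_line l2" where
  "fourier g = lim (\<lambda>n. abs_l2 (\<lambda>s.
     1 / of_real (sqrt (2 * pi)) *
     (LINT x:{- real n..real n}|lebesgue. rep_l2 g x * exp (- (\<i> * of_real x * of_real s)))))"

text \<open>For unbounded \<open>\<phi>\<close> this is meaningful only where the product is square integrable.\<close>

definition mult_l2 :: "(real \<Rightarrow> complex) \<Rightarrow> 'd::l2_domain l2 \<Rightarrow> 'd l2" where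
  "mult_l2 \<phi> f = abs_l2 (\<lambda>x. \<phi> x * rep_l2 f x)"

definition hardy :: "real_line l2 set" where
  "hardy = inv fourier ` range (mult_l2 (indicator {0<..}))"

end

theory Submission
  imports Defs
begin

text \<open>
  Put \<open>T = fourier \<circ> Phi\<close>, an isometric bijection onto \<open>L\<^sup>2\<close> of the line. The idea is that \<open>T\<close>
  turns the Cesaro operator into a multiplication. Under the substitution \<open>x = 1 / (1 + exp u)\<close> the
  Cesaro operator becomes convolution with the kernel \<open>exp (w / 2)\<close> on the negative half line
  (\<open>Phi_cesaro_eq_convol\<close>), and the Fourier transform of this kernel is, up to the factor
  \<open>sqrt (2 * pi)\<close>, the function \<open>1 / (1 / 2 - \<i> s) = 1 + b(s)\<close>, where
  \<open>b(s) = (1 + 2 \<i> s) / (1 - 2 \<i> s)\<close> is a Cayley transform: it maps the line injectively into the unit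
  circle and misses only the point \<open>-1\<close>. So a closed subspace \<open>M\<close> is invariant for the Cesaro
  operator iff \<open>N = T ` M\<close> is invariant under multiplication by the unimodular function \<open>b\<close>
  (\<open>fourier_Phi_cesaro\<close>). Multiplication by \<open>b\<close> is a bilateral shift, and its invariant subspaces are
  those of Wiener and of Beurling and Helson.

  Both cases rest on one uniqueness theorem (\<open>cayley_null_imp_zero_AE\<close>): an integrable function \<open>h\<close>
  with \<open>\<integral> b\<^sup>n h = 0\<close> for every integer \<open>n\<close> vanishes almost everywhere. By the Stone-Weierstrass
  theorem on the circle, such an \<open>h\<close> annihilates every continuous function of \<open>b\<close>, hence every
  indicator of an interval.

  If \<open>N\<close> is also invariant under the conjugate of \<open>b\<close>, take any nowhere vanishing \<open>w\<close> in \<open>L\<^sup>2\<close> and its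
  projection \<open>y\<close> to \<open>N\<close>. As \<open>w - y\<close> is orthogonal to all \<open>b\<^sup>n y\<close>, uniqueness gives
  \<open>y * (w - y) = 0\<close> up to a conjugation, so \<open>y\<close> is \<open>w\<close> cut off to a set \<open>A\<close>, and \<open>N\<close> is the space
  of functions supported on \<open>A\<close> (\<open>reducing_subspace\<close>).

  Otherwise \<open>N\<close> contains a nonzero \<open>p\<close> orthogonal to \<open>b N\<close>. Then \<open>\<integral> b\<^sup>n |p|\<^sup>2 = 0\<close> for \<open>n \<noteq> 0\<close>, and the same
  holds for the function \<open>k = (1 + b) / sqrt (2 * pi)\<close> in the Hardy space, so by uniqueness \<open>|p|\<close> is a
  constant multiple of \<open>|k|\<close> and \<open>p = c q k\<close> with \<open>q\<close> unimodular. The functions \<open>b\<^sup>n k\<close> with \<open>n \<ge> 0\<close> lie in the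
  Hardy space and those with \<open>n < 0\<close> are orthogonal to it; together they are total. This pins down
  \<open>{g. q g \<in> N}\<close> as the Hardy space (\<open>eq_hardyI\<close>, \<open>simply_invariant_subspace\<close>).

  The analysis below supplies what the argument takes for granted: completeness of \<open>L\<^sup>2\<close> and
  orthogonal projections, Young's inequality, and the fact that the Fourier transform defined by truncation is
  a unitary operator which turns convolution into multiplication. Unitarity comes from Abel
  summation: damping the transform by \<open>exp (- e |s|)\<close> and transforming back is convolution with the Poisson
  kernel, a contraction, so the transform is a contraction; and on indicators of intervals the Poisson
  integrals converge back to the indicator, so reflecting the square of the transform gives the
  identity.
\<close>

section \<open>Classes of square integrable functions\<close>

lemma l2_rel_refl_iff: "l2_rel d f f \<longleftrightarrow> square_integrable (l2_measure d) f"
  by (auto simp: l2_rel_def)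

lemma square_integrable_rep_l2:
  "square_integrable (l2_measure TYPE('d)) (rep_l2 (F :: 'd::l2_domain l2))"
  using Quotient_rep_reflp[OF Quotient_l2, of F] by (simp add: l2_rel_refl_iff)

lemma abs_rep_l2: "abs_l2 (rep_l2 F) = F"
  by (rule Quotient_abs_rep[OF Quotient_l2])

lemma rep_abs_l2:
  "square_integrable (l2_measure TYPE('d)) f \<Longrightarrow>
     AE x in l2_measure TYPE('d). rep_l2 (abs_l2 f :: 'd::l2_domain l2) x = f x"
  using Quotient_rep_abs[OF Quotient_l2[where ?'d = 'd], of f] by (auto simp: l2_rel_def)

lemma abs_l2_eq_iff:
  assumes "square_integrable (l2_measure TYPE('d)) f" "square_integrable (l2_measure TYPE('d)) g"
  shows "(abs_l2 f :: 'd::l2_domain l2) = abs_l2 g \<longleftrightarrow> (AE x in l2_measure TYPE('d). f x = g x)"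
  using Quotient_rel[OF Quotient_l2[where ?'d = 'd], of f g] assms by (auto simp: l2_rel_def)

lemma square_integrable_AE_cong:
  assumes "square_integrable M f" "g \<in> borel_measurable M" "AE x in M. f x = g x"
  shows "square_integrable M g"
proof -
  have "integrable M (\<lambda>x. (cmod (f x))\<^sup>2) \<longleftrightarrow> integrable M (\<lambda>x. (cmod (g x))\<^sup>2)"
    using assms by (intro integrable_cong_AE) (auto simp: square_integrable_def)
  with assms show ?thesis by (simp add: square_integrable_def)
qed

lemma abs_l2_cong_AE:
  fixes f g :: "real \<Rightarrow> complex"
  assumes "square_integrable (l2_measure TYPE('d::l2_domain)) f"
    and "g \<in> borel_measurable (l2_measure TYPE('d))"
    and "AE x in l2_measure TYPE('d). f x = g x"
  shows "(abs_l2 f :: 'd l2) = abs_l2 g"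
  using assms square_integrable_AE_cong[OF assms] by (simp add: abs_l2_eq_iff)

lemma l2_cases:
  obtains f where "square_integrable (l2_measure TYPE('d)) f" "(F :: 'd::l2_domain l2) = abs_l2 f"
  using square_integrable_rep_l2 abs_rep_l2 by metis

lemma square_integrable_uminus: "square_integrable M f \<Longrightarrow> square_integrable M (\<lambda>x. - f x)"
  using square_integrable_mult_const[of M f "-1"] by simp

lemma square_integrable_diff:
  "square_integrable M f \<Longrightarrow> square_integrable M g \<Longrightarrow> square_integrable M (\<lambda>x. f x - g x)"
  using square_integrable_add[of M f "\<lambda>x. - g x"] square_integrable_uminus[of M g] by simp

lemma square_integrable_cnj: "square_integrable M f \<Longrightarrow> square_integrable M (\<lambda>x. cnj (f x))"
  unfolding square_integrable_def complex_mod_cnj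
  by (auto intro: measurable_compose[OF _ borel_measurable_continuous_onI[OF continuous_on_cnj[OF continuous_on_id]]])

lemma abs_l2_zero: "abs_l2 (\<lambda>x. 0) = 0"
  by (simp add: zero_l2_def)

lemma abs_l2_add:
  "square_integrable (l2_measure TYPE('d)) f \<Longrightarrow> square_integrable (l2_measure TYPE('d)) g \<Longrightarrow>
     abs_l2 f + abs_l2 g = (abs_l2 (\<lambda>x. f x + g x) :: 'd::l2_domain l2)"
  by (rule plus_l2.abs_eq) (simp_all add: l2_rel_refl_iff)

lemma abs_l2_diff:
  "square_integrable (l2_measure TYPE('d)) f \<Longrightarrow> square_integrable (l2_measure TYPE('d)) g \<Longrightarrow>
     abs_l2 f - abs_l2 g = (abs_l2 (\<lambda>x. f x - g x) :: 'd::l2_domain l2)"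
  by (simp add: minus_l2_def uminus_l2.abs_eq l2_rel_refl_iff abs_l2_add square_integrable_uminus)

lemma abs_l2_scaleC:
  "square_integrable (l2_measure TYPE('d)) f \<Longrightarrow>
     scaleC c (abs_l2 f) = (abs_l2 (\<lambda>x. c * f x) :: 'd::l2_domain l2)"
  by (rule scaleC.abs_eq) (simp_all add: l2_rel_refl_iff)

lemma scaleR_scaleC: "c *\<^sub>R (F :: 'd::l2_domain l2) = scaleC (of_real c) F"
  by transfer (simp add: l2_rel_def square_integrable_mult_const)

lemma abs_l2_inner:
  "square_integrable (l2_measure TYPE('d)) f \<Longrightarrow> square_integrable (l2_measure TYPE('d)) g \<Longrightarrow>
     abs_l2 f \<bullet> (abs_l2 g :: 'd::l2_domain l2) = (LINT x|l2_measure TYPE('d). f x \<bullet> g x)"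
  by (rule inner_l2.abs_eq) (simp_all add: l2_rel_refl_iff)

lemma norm_abs_l2:
  "square_integrable (l2_measure TYPE('d)) f \<Longrightarrow>
     norm (abs_l2 f :: 'd::l2_domain l2) = sqrt (LINT x|l2_measure TYPE('d). (cmod (f x))\<^sup>2)"
  by (simp add: norm_eq_sqrt_inner abs_l2_inner power2_norm_eq_inner)

lemma norm_abs_l2_power2:
  "square_integrable (l2_measure TYPE('d)) f \<Longrightarrow>
     (norm (abs_l2 f :: 'd::l2_domain l2))\<^sup>2 = (LINT x|l2_measure TYPE('d). (cmod (f x))\<^sup>2)"
  by (simp add: norm_abs_l2)

lemma norm_scaleC: "norm (scaleC c (F :: 'd::l2_domain l2)) = cmod c * norm F"
proof -
  obtain f where f: "square_integrable (l2_measure TYPE('d)) f" "F = abs_l2 f"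
    by (rule l2_cases)
  then show ?thesis
    by (simp add: abs_l2_scaleC norm_abs_l2 square_integrable_mult_const norm_mult
        power_mult_distrib real_sqrt_mult)
qed

lemma square_integrable_mult:
  assumes "square_integrable M f" "square_integrable M g"
  shows "integrable M (\<lambda>x. f x * g x)"
proof (rule Bochner_Integration.integrable_bound)
  show "integrable M (\<lambda>x. (cmod (f x))\<^sup>2 + (cmod (g x))\<^sup>2)"
    using assms by (simp add: square_integrable_def)
  show "(\<lambda>x. f x * g x) \<in> borel_measurable M"
    using assms by (auto simp: square_integrable_def)
  have "cmod (f x * g x) \<le> (cmod (f x))\<^sup>2 + (cmod (g x))\<^sup>2" for x
  proof -
    have "0 \<le> (cmod (f x) - cmod (g x))\<^sup>2" "0 \<le> cmod (f x) * cmod (g x)"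
      by simp_all
    then show ?thesis
      unfolding power2_diff norm_mult by linarith
  qed
  then show "AE x in M. norm (f x * g x) \<le> norm ((cmod (f x))\<^sup>2 + (cmod (g x))\<^sup>2)"
    by simp
qed

text \<open>
  The complex inner product is recovered from the real one: \<open>Im z = Re (- \<i> z)\<close>, and \<open>\<i>\<close> in the second
  argument comes out as its conjugate \<open>- \<i>\<close>.
\<close>

definition cinner :: "'d::l2_domain l2 \<Rightarrow> 'd l2 \<Rightarrow> complex" where
  "cinner F G = Complex (F \<bullet> G) (F \<bullet> scaleC \<i> G)"

lemma cinner_abs_l2:
  assumes "square_integrable (l2_measure TYPE('d)) f" "square_integrable (l2_measure TYPE('d)) g"
  shows "cinner (abs_l2 f) (abs_l2 g :: 'd::l2_domain l2) =
    (LINT x|l2_measure TYPE('d). f x * cnj (g x))"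
proof -
  have i: "integrable (l2_measure TYPE('d)) (\<lambda>x. f x * cnj (g x))"
    by (intro square_integrable_mult square_integrable_cnj assms)
  show ?thesis
    using assms integral_Re[OF i] integral_Im[OF i]
    by (auto simp: cinner_def complex_eq_iff abs_l2_scaleC abs_l2_inner
        square_integrable_mult_const inner_complex_def algebra_simps)
qed

lemma cinner_eq_0_iff: "cinner F G = 0 \<longleftrightarrow> F \<bullet> G = 0 \<and> F \<bullet> scaleC \<i> G = 0"
  by (simp add: cinner_def complex_eq_iff)

section \<open>Completeness\<close>

lemma square_integrable_Fatou:
  fixes f :: "nat \<Rightarrow> 'a \<Rightarrow> complex"
  assumes f: "\<And>n. square_integrable M (f n)" and g: "g \<in> borel_measurable M"
    and lim: "AE x in M. (\<lambda>n. f n x) \<longlonglongrightarrow> g x"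
    and bound: "\<And>n. (LINT x|M. (cmod (f n x))\<^sup>2) \<le> B"
  shows "square_integrable M g" "(LINT x|M. (cmod (g x))\<^sup>2) \<le> B"
proof -
  have [measurable]: "f n \<in> borel_measurable M" for n
    using f[of n] by (simp add: square_integrable_def)
  note g[measurable]
  have B: "0 \<le> B"
    using bound[of 0] by (rule order_trans[rotated]) simp
  have "(\<integral>\<^sup>+x. ennreal ((cmod (g x))\<^sup>2) \<partial>M) = (\<integral>\<^sup>+x. liminf (\<lambda>n. ennreal ((cmod (f n x))\<^sup>2)) \<partial>M)"
  proof (rule nn_integral_cong_AE, use lim in eventually_elim)
    case (elim x)
    have "(\<lambda>n. ennreal ((cmod (f n x))\<^sup>2)) \<longlonglongrightarrow> ennreal ((cmod (g x))\<^sup>2)"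
      by (intro tendsto_ennrealI tendsto_intros elim)
    from lim_imp_Liminf[OF _ this] show ?case
      by simp
  qed
  also have "\<dots> \<le> liminf (\<lambda>n. \<integral>\<^sup>+x. ennreal ((cmod (f n x))\<^sup>2) \<partial>M)"
    by (rule nn_integral_liminf) measurable
  also have "\<dots> \<le> liminf (\<lambda>n::nat. ennreal B)"
  proof (intro Liminf_mono always_eventually allI)
    fix n
    have "(\<integral>\<^sup>+x. ennreal ((cmod (f n x))\<^sup>2) \<partial>M) = ennreal (LINT x|M. (cmod (f n x))\<^sup>2)"
      using f[of n] by (intro nn_integral_eq_integral) (auto simp: square_integrable_def)
    then show "(\<integral>\<^sup>+x. ennreal ((cmod (f n x))\<^sup>2) \<partial>M) \<le> ennreal B"
      using bound[of n] by (simp add: ennreal_leI)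
  qed
  also have "\<dots> = ennreal B"
    by (simp add: Liminf_const)
  finally have *: "(\<integral>\<^sup>+x. ennreal ((cmod (g x))\<^sup>2) \<partial>M) \<le> ennreal B" .
  have i: "integrable M (\<lambda>x. (cmod (g x))\<^sup>2)"
    using * by (intro integrableI_nonneg) (auto simp: less_top[symmetric] top_unique)
  then show "square_integrable M g"
    using g by (simp add: square_integrable_def)
  have "ennreal (LINT x|M. (cmod (g x))\<^sup>2) \<le> ennreal B"
    using * by (subst (asm) nn_integral_eq_integral[OF i]) auto
  then show "(LINT x|M. (cmod (g x))\<^sup>2) \<le> B"
    using B by simp
qed

text \<open>
  A limit almost everywhere of an \<open>L\<^sup>2\<close> Cauchy sequence is its \<open>L\<^sup>2\<close> limit, by Fatou's lemma
  applied to the differences \<open>f i - f n\<close> as \<open>n\<close> tends to infinity.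
\<close>

lemma square_integrable_AE_lim:
  fixes f :: "nat \<Rightarrow> real \<Rightarrow> complex" and X :: "nat \<Rightarrow> 'd::l2_domain l2"
  assumes f: "\<And>n. square_integrable (l2_measure TYPE('d)) (f n)"
    and g: "g \<in> borel_measurable (l2_measure TYPE('d))"
    and lim: "AE x in l2_measure TYPE('d). (\<lambda>n. f n x) \<longlonglongrightarrow> g x"
    and Cauchy: "Cauchy (\<lambda>n. abs_l2 (f n) :: 'd l2)"
  shows "square_integrable (l2_measure TYPE('d)) g"
    and "(\<lambda>n. abs_l2 (f n) :: 'd l2) \<longlonglongrightarrow> abs_l2 g"
proof -
  let ?M = "l2_measure TYPE('d)" and ?X = "\<lambda>n. abs_l2 (f n) :: 'd l2"
  from Cauchy_Bseq[OF Cauchy] obtain B where B: "\<And>n. norm (?X n) \<le> B"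
    by (auto simp: Bseq_def)
  have "(LINT x|?M. (cmod (f n x))\<^sup>2) \<le> B\<^sup>2" for n
    using B[of n] norm_abs_l2_power2[OF f[of n], symmetric]
    by (metis norm_ge_zero power_mono)
  from square_integrable_Fatou(1)[OF f g lim this] show sg: "square_integrable ?M g" .
  show "?X \<longlonglongrightarrow> abs_l2 g"
  proof (rule LIMSEQ_I)
    fix e :: real assume e: "0 < e"
    then obtain N where N: "\<And>i j. i \<ge> N \<Longrightarrow> j \<ge> N \<Longrightarrow> norm (?X i - ?X j) < e/2"
      using CauchyD[OF Cauchy, of "e/2"] by auto
    have "norm (?X i - abs_l2 g) < e" if i: "i \<ge> N" for i
    proof -
      have "(LINT x|?M. (cmod (f i x - g x))\<^sup>2) \<le> (e/2)\<^sup>2"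
      proof (rule square_integrable_Fatou(2)[where f = "\<lambda>n x. f i x - f (n + N) x"])
        show "square_integrable ?M (\<lambda>x. f i x - f (n + N) x)" for n
          by (intro square_integrable_diff f)
        show "(\<lambda>x. f i x - g x) \<in> borel_measurable ?M"
          using f[of i] g by (auto simp: square_integrable_def)
        show "AE x in ?M. (\<lambda>n. f i x - f (n + N) x) \<longlonglongrightarrow> f i x - g x"
          using lim by eventually_elim (intro tendsto_intros LIMSEQ_ignore_initial_segment)
        show "(LINT x|?M. (cmod (f i x - f (n + N) x))\<^sup>2) \<le> (e/2)\<^sup>2" for n
        proof -
          have "(LINT x|?M. (cmod (f i x - f (n + N) x))\<^sup>2) = (norm (?X i - ?X (n + N)))\<^sup>2"
            by (simp add: abs_l2_diff f norm_abs_l2_power2 square_integrable_diff)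
          also have "\<dots> \<le> (e/2)\<^sup>2"
            using N[OF i, of "n + N"] by (intro power_mono) auto
          finally show ?thesis .
        qed
      qed
      then have "(norm (?X i - abs_l2 g))\<^sup>2 \<le> (e/2)\<^sup>2"
        by (simp add: abs_l2_diff f sg norm_abs_l2_power2 square_integrable_diff)
      then have "norm (?X i - abs_l2 g) \<le> e/2"
        using e by (simp add: power2_le_iff_abs_le)
      with e show ?thesis by simp
    qed
    then show "\<exists>N. \<forall>i\<ge>N. norm (?X i - abs_l2 g) < e" by blast
  qed
qed

text \<open>
  This identifies an abstract limit, such as the one in the definition of the Fourier transform,
  with a function known pointwise.
\<close>

lemma l2_limit_eq_AE_limit:
  fixes f :: "nat \<Rightarrow> real \<Rightarrow> complex" and G :: "'d::l2_domain l2"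
  assumes f: "\<And>n. square_integrable (l2_measure TYPE('d)) (f n)"
    and g: "g \<in> borel_measurable (l2_measure TYPE('d))"
    and lim: "AE x in l2_measure TYPE('d). (\<lambda>n. f n x) \<longlonglongrightarrow> g x"
    and G: "(\<lambda>n. abs_l2 (f n)) \<longlonglongrightarrow> G"
  shows "square_integrable (l2_measure TYPE('d)) g" "G = abs_l2 g"
proof -
  have C: "Cauchy (\<lambda>n. abs_l2 (f n) :: 'd l2)"
    using G by (intro LIMSEQ_imp_Cauchy)
  show "square_integrable (l2_measure TYPE('d)) g"
    by (rule square_integrable_AE_lim(1)[OF f g lim C])
  show "G = abs_l2 g"
    using square_integrable_AE_lim(2)[OF f g lim C] G LIMSEQ_unique by blast
qed

text \<open>
  The weights \<open>2 ^ n\<close> replace Minkowski's inequality in the proof of completeness: finiteness of the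
  sum bounds the increments by a geometric sequence of ratio \<open>1 / sqrt 2\<close>.
\<close>

lemma convergent_if_weighted_increments_summable:
  fixes z :: "nat \<Rightarrow> complex"
  assumes "(\<Sum>n. ennreal (2 ^ n * (cmod (z (Suc n) - z n))\<^sup>2)) < \<infinity>"
  shows "convergent z"
proof -
  define d where "d n = cmod (z (Suc n) - z n)" for n
  obtain C where C: "(\<Sum>n. ennreal (2 ^ n * (d n)\<^sup>2)) = ennreal C" "0 \<le> C"
    using assms by (cases "(\<Sum>n. ennreal (2 ^ n * (d n)\<^sup>2))") (auto simp: d_def)
  have "d n \<le> sqrt C * (1 / sqrt 2) ^ n" for n
  proof -
    have "ennreal (2 ^ n * (d n)\<^sup>2) = (\<Sum>k\<in>{n}. ennreal (2 ^ k * (d k)\<^sup>2))"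
      by simp
    also have "\<dots> \<le> (\<Sum>n. ennreal (2 ^ n * (d n)\<^sup>2))"
      by (rule sum_le_suminf) auto
    finally have "2 ^ n * (d n)\<^sup>2 \<le> C"
      using C by simp
    then have "(d n)\<^sup>2 \<le> C / 2 ^ n"
      by (simp add: field_simps)
    also have "\<dots> = (sqrt C * (1 / sqrt 2) ^ n)\<^sup>2"
    proof -
      have "((1 / sqrt 2) ^ n)\<^sup>2 = ((1 / sqrt 2)\<^sup>2) ^ n"
        unfolding power_mult[symmetric] by (subst mult.commute) (rule refl)
      then show ?thesis
        using C(2) by (simp add: power_mult_distrib) (simp add: power_divide)
    qed
    finally show ?thesis
      by (rule power2_le_imp_le) (use C(2) in auto)
  qed
  then have "norm (d n) \<le> sqrt C * (1 / sqrt 2) ^ n" for n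
    by (simp add: d_def)
  moreover have "summable (\<lambda>n. sqrt C * (1 / sqrt 2) ^ n)"
    by (rule summable_mult, rule summable_geometric) simp
  ultimately have "summable d"
    by (rule summable_comparison_test'[rotated])
  then have "summable (\<lambda>n. z (Suc n) - z n)"
    unfolding d_def by (rule summable_norm_cancel)
  then have "convergent (\<lambda>n. \<Sum>i<n. z (Suc i) - z i)"
    by (simp add: summable_iff_convergent)
  then have "convergent (\<lambda>n. z n - z 0)"
    by (simp add: sum_lessThan_telescope)
  from convergent_add[OF this convergent_const[of "z 0"]] show ?thesis
    by simp
qed

text \<open>
  Along a subsequence with increments at most \<open>2\<^sup>-\<^sup>n\<close> in norm, the weighted sum of the squared increments
  has a finite integral, hence is finite almost everywhere; so the subsequence converges almost
  everywhere.
\<close>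

instance l2 :: (l2_domain) complete_space
proof
  fix X :: "nat \<Rightarrow> 'a l2" assume X: "Cauchy X"
  let ?M = "l2_measure TYPE('a)"
  have "\<exists>N. \<forall>i\<ge>N. \<forall>j\<ge>N. norm (X i - X j) < (1/2) ^ n" for n
    using CauchyD[OF X, of "(1/2)^n"] by auto
  then obtain N where N: "\<And>n i j. i \<ge> N n \<Longrightarrow> j \<ge> N n \<Longrightarrow> norm (X i - X j) < (1/2) ^ n"
    by metis
  \<comment> \<open>a strictly increasing sequence that dominates \<open>N\<close>\<close>
  define r where "r n = (\<Sum>k\<le>n. N k) + n" for n
  have rN: "r n \<ge> N n" "r (Suc n) \<ge> N n" for n
  proof -
    show "r n \<ge> N n"
      unfolding r_def by (intro trans_le_add1 member_le_sum) auto
    have "N n \<le> (\<Sum>k\<le>Suc n. N k)"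
      by (intro member_le_sum) auto
    then show "r (Suc n) \<ge> N n"
      unfolding r_def by linarith
  qed
  have sm: "strict_mono r"
    by (auto simp: strict_mono_Suc_iff r_def)
  define f where "f n = rep_l2 (X (r n))" for n
  have f: "square_integrable ?M (f n)" for n
    by (simp add: f_def square_integrable_rep_l2)
  then have [measurable]: "f n \<in> borel_measurable ?M" for n
    by (simp add: square_integrable_def)
  have Xr: "X (r n) = abs_l2 (f n)" for n
    by (simp add: f_def abs_rep_l2)
  have d: "(\<integral>\<^sup>+x. ennreal (2 ^ n * (cmod (f (Suc n) x - f n x))\<^sup>2) \<partial>?M) \<le> ennreal ((1/2) ^ n)" for n
  proof -
    have sq: "square_integrable ?M (\<lambda>x. f (Suc n) x - f n x)"
      by (intro square_integrable_diff f)
    have "(\<integral>\<^sup>+x. ennreal (2 ^ n * (cmod (f (Suc n) x - f n x))\<^sup>2) \<partial>?M) =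
        ennreal (LINT x|?M. 2 ^ n * (cmod (f (Suc n) x - f n x))\<^sup>2)"
      using sq by (intro nn_integral_eq_integral) (auto simp: square_integrable_def)
    also have "(LINT x|?M. 2 ^ n * (cmod (f (Suc n) x - f n x))\<^sup>2) = 2 ^ n * (norm (X (r (Suc n)) - X (r n)))\<^sup>2"
      by (simp add: Xr abs_l2_diff f sq norm_abs_l2_power2)
    also have "\<dots> \<le> 2 ^ n * ((1/2) ^ n)\<^sup>2"
      using N[OF rN(2,1), of n] by (intro mult_left_mono power_mono) auto
    also have "\<dots> = (1/2) ^ n"
      by (simp add: power2_eq_square power_divide)
    finally show ?thesis
      by (simp add: ennreal_leI)
  qed
  have "(\<integral>\<^sup>+x. (\<Sum>n. ennreal (2 ^ n * (cmod (f (Suc n) x - f n x))\<^sup>2)) \<partial>?M) =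
      (\<Sum>n. \<integral>\<^sup>+x. ennreal (2 ^ n * (cmod (f (Suc n) x - f n x))\<^sup>2) \<partial>?M)"
    by (intro nn_integral_suminf) measurable
  also have "\<dots> \<le> (\<Sum>n. ennreal ((1/2) ^ n))"
    by (intro suminf_le d) auto
  also have "\<dots> < \<infinity>"
    by (subst suminf_ennreal2) (auto intro!: summable_geometric)
  finally have "AE x in ?M. (\<Sum>n. ennreal (2 ^ n * (cmod (f (Suc n) x - f n x))\<^sup>2)) \<noteq> \<infinity>"
    by (intro nn_integral_PInf_AE) auto
  then have conv: "AE x in ?M. (\<lambda>n. f n x) \<longlonglongrightarrow> lim (\<lambda>n. f n x)"
    by eventually_elim
       (auto simp: less_top convergent_LIMSEQ_iff[symmetric]
         intro!: convergent_if_weighted_increments_summable)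
  have C: "Cauchy (\<lambda>n. abs_l2 (f n) :: 'a l2)"
    using Cauchy_subseq_Cauchy[OF X sm] by (simp add: o_def Xr)
  have "(X \<circ> r) \<longlonglongrightarrow> abs_l2 (\<lambda>x. lim (\<lambda>n. f n x))"
    using square_integrable_AE_lim(2)[OF f _ conv C] by (simp add: o_def Xr)
  with X sm have "X \<longlonglongrightarrow> abs_l2 (\<lambda>x. lim (\<lambda>n. f n x))"
    by (rule Cauchy_converges_subseq)
  then show "convergent X"
    by (rule convergentI)
qed

section \<open>Orthogonal projection\<close>

text \<open>
  By the parallelogram law a minimizing sequence for the distance from \<open>x\<close> to \<open>S\<close> is Cauchy, and the
  closest point has the orthogonality property by the usual variation along \<open>z\<close>.
\<close>

lemma orthogonal_projection_exists:
  fixes S :: "'a :: {real_inner, complete_space} set"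
  assumes S: "closed S" "subspace S"
  shows "\<exists>y\<in>S. \<forall>z\<in>S. (x - y) \<bullet> z = 0"
proof -
  define d where "d = infdist x S"
  have ne: "S \<noteq> {}" using subspace_0[OF S(2)] by auto
  have dz: "d \<le> norm (x - z)" if "z \<in> S" for z
    using infdist_le[OF that, of x] by (simp add: d_def dist_norm)
  have d0: "0 \<le> d" by (simp add: d_def infdist_nonneg)
  have "\<exists>z\<in>S. (norm (x - z))\<^sup>2 < d\<^sup>2 + 1 / Suc n" for n
  proof -
    have "d < sqrt (d\<^sup>2 + 1 / Suc n)"
      using d0 by (intro real_less_rsqrt) auto
    with ne obtain z where z: "z \<in> S" "dist x z < sqrt (d\<^sup>2 + 1 / Suc n)"
      unfolding d_def by (metis infdist_notempty cINF_less_iff bdd_below_image_dist)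
    then have "(norm (x - z))\<^sup>2 < (sqrt (d\<^sup>2 + 1 / Suc n))\<^sup>2"
      by (intro power_strict_mono) (auto simp: dist_norm)
    with z(1) show ?thesis by (auto simp: add_nonneg_nonneg)
  qed
  then obtain y where y: "\<And>n. y n \<in> S" "\<And>n. (norm (x - y n))\<^sup>2 < d\<^sup>2 + 1 / Suc n"
    by metis
  have par: "(norm (y n - y m))\<^sup>2 \<le> 2 / Suc n + 2 / Suc m" for n m
  proof -
    \<comment> \<open>the midpoint lies in \<open>S\<close>, so it is not closer to \<open>x\<close> than \<open>d\<close>\<close>
    have "(1/2) *\<^sub>R (y n + y m) \<in> S"
      by (intro subspace_scale[OF S(2)] subspace_add[OF S(2)] y)
    then have "d\<^sup>2 \<le> (norm (x - (1/2) *\<^sub>R (y n + y m)))\<^sup>2"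
      using dz d0 by (intro power_mono) auto
    moreover have "(norm (y n - y m))\<^sup>2 + 4 * (norm (x - (1/2) *\<^sub>R (y n + y m)))\<^sup>2 =
        2 * (norm (x - y n))\<^sup>2 + 2 * (norm (x - y m))\<^sup>2"
      by (simp add: power2_norm_eq_inner inner_diff_left inner_diff_right inner_add_left
          inner_add_right inner_commute algebra_simps)
    ultimately show ?thesis
      using y(2)[of n] y(2)[of m] by simp
  qed
  have "Cauchy y"
  proof (rule metric_CauchyI)
    fix e :: real assume e: "0 < e"
    then obtain N where N: "4 / e\<^sup>2 < real N"
      using reals_Archimedean2 by blast
    have "dist (y n) (y m) < e" if "n \<ge> N" "m \<ge> N" for n m
    proof -
      have "2 / Suc k < e\<^sup>2 / 2" if "k \<ge> N" for k
      proof -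
        have "4 / e\<^sup>2 < Suc k" using N that by simp
        then show ?thesis using e by (simp add: field_simps)
      qed
      from this[OF that(1)] this[OF that(2)] have "(norm (y n - y m))\<^sup>2 < e\<^sup>2"
        using par[of n m] by simp
      then show ?thesis
        using e by (simp add: dist_norm power2_less_imp_less)
    qed
    then show "\<exists>N. \<forall>m\<ge>N. \<forall>n\<ge>N. dist (y m) (y n) < e" by blast
  qed
  then obtain l where l: "y \<longlonglongrightarrow> l"
    using Cauchy_convergent_iff convergent_def by blast
  have lS: "l \<in> S"
    using closed_sequentially[OF S(1) y(1) l] .
  have "(norm (x - l))\<^sup>2 \<le> d\<^sup>2"
  proof (rule LIMSEQ_le)
    show "(\<lambda>n. (norm (x - y n))\<^sup>2) \<longlonglongrightarrow> (norm (x - l))\<^sup>2"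
      by (intro tendsto_intros l)
    have "(\<lambda>n. d\<^sup>2 + 1 / Suc n) \<longlonglongrightarrow> d\<^sup>2 + 0"
      by (intro tendsto_add tendsto_const LIMSEQ_Suc lim_1_over_n)
    then show "(\<lambda>n. d\<^sup>2 + 1 / Suc n) \<longlonglongrightarrow> d\<^sup>2" by simp
    show "\<exists>N. \<forall>n\<ge>N. (norm (x - y n))\<^sup>2 \<le> d\<^sup>2 + 1 / Suc n"
      using y(2) by (meson less_imp_le)
  qed
  have "(x - l) \<bullet> z = 0" if z: "z \<in> S" for z
  proof (cases "z = 0")
    case False
    \<comment> \<open>the minimizer of \<open>norm (x - (l + t z))\<close> over real \<open>t\<close>\<close>
    define t where "t = ((x - l) \<bullet> z) / (z \<bullet> z)"
    have "l + t *\<^sub>R z \<in> S"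
      by (intro subspace_add[OF S(2)] subspace_scale[OF S(2)] lS z)
    then have "d\<^sup>2 \<le> (norm (x - (l + t *\<^sub>R z)))\<^sup>2"
      using dz d0 by (intro power_mono) auto
    also have "x - (l + t *\<^sub>R z) = (x - l) - t *\<^sub>R z"
      by simp
    also have "(norm ((x - l) - t *\<^sub>R z))\<^sup>2 = (norm (x - l))\<^sup>2 - 2 * t * ((x - l) \<bullet> z) + t\<^sup>2 * (z \<bullet> z)"
      using inner_commute[of z "x - l"]
      unfolding power2_norm_eq_inner inner_diff_left[of "x - l"] inner_diff_right[of _ "x - l"]
        inner_scaleR_left inner_scaleR_right power2_eq_square[of t] by (simp add: right_diff_distrib)
    also have "\<dots> = (norm (x - l))\<^sup>2 - ((x - l) \<bullet> z)\<^sup>2 / (z \<bullet> z)"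
    proof -
      have "t * (z \<bullet> z) = (x - l) \<bullet> z"
        using False by (simp add: t_def)
      then have "t\<^sup>2 * (z \<bullet> z) = t * ((x - l) \<bullet> z)"
        by (simp add: power2_eq_square)
      moreover have "t * ((x - l) \<bullet> z) = ((x - l) \<bullet> z)\<^sup>2 / (z \<bullet> z)"
        by (simp add: t_def power2_eq_square)
      ultimately show ?thesis by linarith
    qed
    finally have "((x - l) \<bullet> z)\<^sup>2 / (z \<bullet> z) \<le> 0"
      using \<open>(norm (x - l))\<^sup>2 \<le> d\<^sup>2\<close> by simp
    with False have "((x - l) \<bullet> z)\<^sup>2 \<le> 0"
      using inner_gt_zero_iff[of z] by (auto simp: divide_le_0_iff simp del: inner_gt_zero_iff)
    then show ?thesis by simp
  qed simp
  with lS show ?thesis by blast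
qed

section \<open>Multiplication operators\<close>

lemma square_integrable_bounded_mult:
  assumes p: "p \<in> borel_measurable M" and B: "AE x in M. cmod (p x) \<le> B"
    and f: "square_integrable M f"
  shows "square_integrable M (\<lambda>x. p x * f x)"
proof -
  have [measurable]: "f \<in> borel_measurable M" "p \<in> borel_measurable M"
    using f p by (auto simp: square_integrable_def)
  have "integrable M (\<lambda>x. (cmod (p x * f x))\<^sup>2)"
  proof (rule Bochner_Integration.integrable_bound)
    show "integrable M (\<lambda>x. B\<^sup>2 * (cmod (f x))\<^sup>2)"
      using f by (simp add: square_integrable_def)
    show "AE x in M. norm ((cmod (p x * f x))\<^sup>2) \<le> norm (B\<^sup>2 * (cmod (f x))\<^sup>2)"
      using B by eventually_elim (auto simp: norm_mult power_mult_distrib intro!: mult_right_mono power_mono)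
  qed measurable
  then show ?thesis by (simp add: square_integrable_def)
qed

lemma mult_l2_abs_l2:
  fixes f :: "real \<Rightarrow> complex"
  assumes p: "p \<in> borel_measurable (l2_measure TYPE('d))"
    and B: "AE x in l2_measure TYPE('d). cmod (p x) \<le> B"
    and f: "square_integrable (l2_measure TYPE('d)) f"
  shows "mult_l2 p (abs_l2 f) = (abs_l2 (\<lambda>x. p x * f x) :: 'd::l2_domain l2)"
  unfolding mult_l2_def
  by (rule abs_l2_cong_AE[OF square_integrable_bounded_mult[OF p B square_integrable_rep_l2]])
     (use square_integrable_bounded_mult[OF p B f] rep_abs_l2[OF f]
       in \<open>auto simp: square_integrable_def\<close>)

lemma norm_mult_l2_le:
  fixes F :: "'d::l2_domain l2"
  assumes p: "p \<in> borel_measurable (l2_measure TYPE('d))"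
    and B: "AE x in l2_measure TYPE('d). cmod (p x) \<le> B" "0 \<le> B"
  shows "norm (mult_l2 p F) \<le> B * norm F"
proof -
  obtain f where f: "square_integrable (l2_measure TYPE('d)) f" "F = abs_l2 f"
    by (rule l2_cases)
  have "(norm (mult_l2 p F))\<^sup>2 = (LINT x|l2_measure TYPE('d). (cmod (p x * f x))\<^sup>2)"
    using f by (simp add: mult_l2_abs_l2[OF p B(1)] norm_abs_l2_power2
        square_integrable_bounded_mult[OF p B(1)])
  also have "\<dots> \<le> (LINT x|l2_measure TYPE('d). B\<^sup>2 * (cmod (f x))\<^sup>2)"
  proof (rule integral_mono_AE)
    show "AE x in l2_measure TYPE('d). (cmod (p x * f x))\<^sup>2 \<le> B\<^sup>2 * (cmod (f x))\<^sup>2"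
      using B(1) by eventually_elim (auto simp: norm_mult power_mult_distrib intro!: mult_right_mono power_mono)
  qed (use f square_integrable_bounded_mult[OF p B(1) f(1)] in \<open>auto simp: square_integrable_def\<close>)
  also have "\<dots> = (B * norm F)\<^sup>2"
    using f by (simp add: power_mult_distrib norm_abs_l2_power2)
  finally show ?thesis
    by (rule power2_le_imp_le) (use B in auto)
qed

lemma bounded_linear_mult_l2:
  assumes p: "p \<in> borel_measurable (l2_measure TYPE('d))"
    and B: "AE x in l2_measure TYPE('d). cmod (p x) \<le> B" "0 \<le> B"
  shows "bounded_linear (mult_l2 p :: 'd::l2_domain l2 \<Rightarrow> 'd l2)"
proof (rule bounded_linear_intro[where K = B])
  fix F G :: "'d l2" and c :: real
  obtain f where f: "square_integrable (l2_measure TYPE('d)) f" "F = abs_l2 f"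
    by (rule l2_cases)
  obtain g where g: "square_integrable (l2_measure TYPE('d)) g" "G = abs_l2 g"
    by (rule l2_cases)
  note * = mult_l2_abs_l2[OF p B(1)] square_integrable_bounded_mult[OF p B(1)]
  show "mult_l2 p (F + G) = mult_l2 p F + mult_l2 p G"
    using f(1) g(1) unfolding f(2) g(2)
    by (simp add: abs_l2_add * square_integrable_add distrib_left)
  show "mult_l2 p (c *\<^sub>R F) = c *\<^sub>R mult_l2 p F"
    using f(1) unfolding f(2)
    by (simp add: scaleR_scaleC abs_l2_scaleC * square_integrable_mult_const mult.left_commute)
  show "norm (mult_l2 p F) \<le> norm F * B"
    using norm_mult_l2_le[OF p B, of F] by (simp add: mult.commute)
qed

lemma mult_l2_scaleC:
  assumes p: "p \<in> borel_measurable (l2_measure TYPE('d))"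
    and B: "AE x in l2_measure TYPE('d). cmod (p x) \<le> B"
  shows "mult_l2 p (scaleC c F) = scaleC c (mult_l2 p F :: 'd::l2_domain l2)"
proof -
  obtain f where f: "square_integrable (l2_measure TYPE('d)) f" "F = abs_l2 f"
    by (rule l2_cases)
  then show ?thesis
    by (simp add: abs_l2_scaleC mult_l2_abs_l2[OF p B] square_integrable_bounded_mult[OF p B]
        square_integrable_mult_const mult.left_commute)
qed

lemma mult_l2_mult_l2:
  assumes p: "p \<in> borel_measurable (l2_measure TYPE('d))"
    and B: "AE x in l2_measure TYPE('d). cmod (p x) \<le> B"
    and q: "q \<in> borel_measurable (l2_measure TYPE('d))"
    and C: "AE x in l2_measure TYPE('d). cmod (q x) \<le> C"
  shows "mult_l2 p (mult_l2 q F) = (mult_l2 (\<lambda>x. p x * q x) F :: 'd::l2_domain l2)"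
proof -
  obtain f where f: "square_integrable (l2_measure TYPE('d)) f" "F = abs_l2 f"
    by (rule l2_cases)
  have m: "(\<lambda>x. p x * q x) \<in> borel_measurable (l2_measure TYPE('d))"
    using p q by measurable
  have "AE x in l2_measure TYPE('d). cmod (p x * q x) \<le> B * C"
    using B C
  proof eventually_elim
    case (elim x)
    then show ?case
      unfolding norm_mult by (intro mult_mono) (auto intro: order_trans[OF norm_ge_zero])
  qed
  from mult_l2_abs_l2[OF m this f(1)] f show ?thesis
    by (simp add: mult_l2_abs_l2[OF p B] mult_l2_abs_l2[OF q C] square_integrable_bounded_mult[OF q C]
        mult.assoc)
qed

section \<open>Borel representatives and integrals over intervals\<close>

lemma l2_real_line: "l2_measure TYPE(real_line) = lebesgue"
  by (rule l2_measure_real_line_def)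

text \<open>
  Products, convolutions and Fubini's theorem are handled with Borel functions and \<open>lborel\<close>, while the classes
  consist of Lebesgue measurable functions. This lemma is the bridge between them.
\<close>

lemma lebesgue_measurable_eq_borel_AE:
  fixes f :: "real \<Rightarrow> complex"
  assumes "f \<in> borel_measurable lebesgue"
  obtains g where "g \<in> borel_measurable borel" "AE x in lborel. f x = g x"
proof -
  have "(\<lambda>x. Re (f x)) \<in> borel_measurable lebesgue" "(\<lambda>x. Im (f x)) \<in> borel_measurable lebesgue"
    using assms by measurable
  from this[THEN completion_ex_borel_measurable_real]
  obtain u v where uv: "u \<in> borel_measurable lborel" "v \<in> borel_measurable lborel"
    and ae: "AE x in lborel. Re (f x) = u x" "AE x in lborel. Im (f x) = v x"
    by blast
  have "(\<lambda>x. Complex (u x) (v x)) \<in> borel_measurable borel"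
    using uv by (simp add: borel_measurable_complex_iff)
  moreover have "AE x in lborel. f x = Complex (u x) (v x)"
    using ae by eventually_elim (simp add: complex_eq_iff)
  ultimately show thesis by (rule that)
qed

lemma square_integrable_lebesgue_if_lborel:
  "square_integrable lborel f \<Longrightarrow> square_integrable lebesgue f"
  by (auto simp: square_integrable_def integrable_completion measurable_completion)

lemma square_integrable_lborel_iff:
  "f \<in> borel_measurable borel \<Longrightarrow> square_integrable lborel f \<longleftrightarrow> square_integrable lebesgue f"
  by (auto simp: square_integrable_def integrable_completion measurable_completion)

lemma real_line_borel_cases:
  obtains f where "f \<in> borel_measurable borel" "square_integrable lborel f"
    "(F :: real_line l2) = abs_l2 f"
proof -
  obtain f where f: "square_integrable lebesgue f" "F = abs_l2 f"
    using l2_cases[where 'd = real_line] by (metis l2_real_line)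
  then obtain g where g: "g \<in> borel_measurable borel" "AE x in lborel. f x = g x"
    using lebesgue_measurable_eq_borel_AE[of f] by (auto simp: square_integrable_def)
  have ae: "AE x in lebesgue. f x = g x"
    using g(2) by (rule AE_completion)
  have gl: "g \<in> borel_measurable lebesgue"
    using g(1) by (simp add: measurable_completion)
  have "square_integrable lebesgue g"
    by (rule square_integrable_AE_cong[OF f(1) gl ae])
  moreover have "F = abs_l2 g"
    unfolding f(2) by (rule abs_l2_cong_AE) (use f gl ae in \<open>simp_all only: l2_real_line\<close>)
  ultimately show thesis
    using that g(1) by (simp add: square_integrable_lborel_iff)
qed

text \<open>
  The closed intervals are an intersection stable generator of the Borel sets, so the set integrals
  vanish over all Borel sets.
\<close>

lemma set_integral_intervals_zero_imp_zero_AE: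
  fixes h :: "real \<Rightarrow> complex"
  assumes h: "integrable lborel h" and zero: "\<And>a b. (LINT x:{a..b}|lborel. h x) = 0"
  shows "AE x in lborel. h x = 0"
proof -
  have si: "set_integrable lborel A h" if "A \<in> sets borel" for A
    unfolding set_integrable_def by (intro integrable_mult_indicator) (use h that in auto)
  have UN: "(LINT x|lborel. h x) = 0"
  proof (rule LIMSEQ_unique)
    show "(\<lambda>n::nat. LINT x|lborel. indicator {- real n..real n} x *\<^sub>R h x) \<longlonglongrightarrow> (LINT x|lborel. h x)"
    proof (rule integral_dominated_convergence[where w = "\<lambda>x. cmod (h x)"])
      show "AE x in lborel. (\<lambda>n::nat. indicator {- real n..real n} x *\<^sub>R h x) \<longlonglongrightarrow> h x"
      proof (intro AE_I2 tendsto_eventually)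
        fix x
        obtain N :: nat where "\<bar>x\<bar> \<le> real N" using real_arch_simple by blast
        then show "\<forall>\<^sub>F n::nat in sequentially. indicator {- real n..real n} x *\<^sub>R h x = h x"
          by (intro eventually_sequentiallyI[of N]) (auto simp: indicator_def)
      qed
    qed (use h in \<open>auto simp: indicator_def\<close>)
    show "(\<lambda>n::nat. LINT x|lborel. indicator {- real n..real n} x *\<^sub>R h x) \<longlonglongrightarrow> 0"
      using zero by (simp add: set_lebesgue_integral_def)
  qed
  have "(LINT x:A|lborel. h x) = 0" if "A \<in> sets borel" for A
  proof -
    let ?G = "range (\<lambda>(a, b). {a..b::real})"
    have "Int_stable ?G" "?G \<subseteq> Pow UNIV"
      by (auto simp: Int_stable_def intro!: image_eqI)
    moreover have "A \<in> sigma_sets UNIV ?G"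
      using that by (simp add: borel_eq_atLeastAtMost)
    ultimately show ?thesis
    proof (induct rule: sigma_sets_induct_disjoint)
      case (basic A)
      then show ?case using zero by auto
    next
      case empty
      show ?case by (simp add: set_lebesgue_integral_def)
    next
      case (compl A)
      then have A: "A \<in> sets borel" by (simp add: borel_eq_atLeastAtMost)
      have "(LINT x:UNIV - A|lborel. h x) = (LINT x|lborel. h x - indicator A x *\<^sub>R h x)"
        unfolding set_lebesgue_integral_def
        by (intro Bochner_Integration.integral_cong) (auto simp: indicator_def)
      also have "\<dots> = (LINT x|lborel. h x) - (LINT x:A|lborel. h x)"
        unfolding set_lebesgue_integral_def
        by (intro Bochner_Integration.integral_diff h si[OF A, unfolded set_integrable_def])
      finally show ?case using UN compl(2) by simp
    next
      case (union A)
      then have A: "range A \<subseteq> sets borel" by (auto simp: borel_eq_atLeastAtMost)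
      have "(LINT x:(\<Union>i. A i)|lborel. h x) = (\<Sum>i. (LINT x:A i|lborel. h x))"
        using union(1) A
        by (intro lebesgue_integral_countable_add si) (auto simp: disjoint_family_on_def)
      then show ?case using union(3) by simp
    qed
  qed
  then show ?thesis
    using sigma_finite_measure.density_unique_banach[OF sigma_finite_lborel h, of "\<lambda>x. 0"] by (simp add: set_lebesgue_integral_def)
qed

lemma set_integral_intervals_zero_imp_zero_AE_lebesgue:
  fixes h :: "real \<Rightarrow> complex"
  assumes h: "integrable lebesgue h" and zero: "\<And>a b. (LINT x:{a..b}|lebesgue. h x) = 0"
  shows "AE x in lebesgue. h x = 0"
proof -
  obtain g where g: "g \<in> borel_measurable borel" "AE x in lborel. h x = g x"
    using lebesgue_measurable_eq_borel_AE[OF borel_measurable_integrable[OF h]] by blast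
  have ae: "AE x in lebesgue. h x = g x"
    using g(2) by (rule AE_completion)
  have gl: "g \<in> borel_measurable lebesgue"
    using g(1) by (simp add: measurable_completion)
  have "integrable lebesgue g"
    using integrable_cong_AE[OF _ gl ae] h by auto
  then have gi: "integrable lborel g"
    using g(1) by (simp add: integrable_completion)
  have "(LINT x:{a..b}|lborel. g x) = 0" for a b
  proof -
    have "(LINT x:{a..b}|lborel. g x) = (LINT x:{a..b}|lebesgue. g x)"
      using g(1) unfolding set_lebesgue_integral_def by (intro integral_completion[symmetric]) auto
    also have "\<dots> = (LINT x:{a..b}|lebesgue. h x)"
      unfolding set_lebesgue_integral_def
    proof (rule integral_cong_AE)
      show "AE x in lebesgue. indicator {a..b} x *\<^sub>R g x = indicator {a..b} x *\<^sub>R h x"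
        using ae by eventually_elim simp
    qed (use gl h in \<open>auto intro!: borel_measurable_scaleR borel_measurable_indicator\<close>)
    finally show ?thesis using zero by simp
  qed
  from set_integral_intervals_zero_imp_zero_AE[OF gi this] have "AE x in lebesgue. g x = 0"
    by (rule AE_completion)
  with ae show ?thesis by eventually_elim simp
qed

section \<open>Uniqueness for the powers of the Cayley transform\<close>

definition cayley :: "real \<Rightarrow> complex" where
  "cayley s = (1 + 2 * \<i> * of_real s) / (1 - 2 * \<i> * of_real s)"

lemma cayley_denom: "1 - 2 * \<i> * complex_of_real s \<noteq> 0" "1 + 2 * \<i> * complex_of_real s \<noteq> 0"
  by (auto simp: complex_eq_iff)

lemma norm_cayley [simp]: "cmod (cayley s) = 1"
proof -
  have "cmod (1 + 2 * \<i> * of_real s) = cmod (1 - 2 * \<i> * of_real s)"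
    by (simp add: cmod_def)
  then show ?thesis
    using cayley_denom[of s] by (simp add: cayley_def norm_divide)
qed

lemma cayley_mult_cnj [simp]: "cayley s * cnj (cayley s) = 1"
  by (simp add: complex_norm_square[symmetric])

lemma inj_cayley: "inj cayley"
proof
  fix s t assume "cayley s = cayley t"
  then show "s = t"
    using cayley_denom[of s] cayley_denom[of t]
    by (simp add: cayley_def frac_eq_eq algebra_simps)
qed

lemma continuous_on_cayley: "continuous_on A cayley"
  unfolding cayley_def using cayley_denom by (intro continuous_intros) auto

lemma cayley_borel [measurable]: "cayley \<in> borel_measurable borel"
  by (intro borel_measurable_continuous_onI continuous_on_cayley)

lemma cayley_lebesgue: "cayley \<in> borel_measurable lebesgue"
  by (simp add: measurable_completion)

text \<open>
  The integrable functions that annihilate all integer powers of the Cayley transform; negative powers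
  are written as powers of the conjugate.
\<close>

definition cayley_null :: "(real \<Rightarrow> complex) \<Rightarrow> bool" where
  "cayley_null h \<longleftrightarrow> integrable lebesgue h \<and>
     (\<forall>n. (LINT s|lebesgue. cayley s ^ n * h s) = 0 \<and> (LINT s|lebesgue. cnj (cayley s) ^ n * h s) = 0)"

lemma integrable_bounded_mult:
  fixes h p :: "'a \<Rightarrow> complex"
  assumes h: "integrable M h" and p: "p \<in> borel_measurable M" "\<And>s. cmod (p s) \<le> B"
  shows "integrable M (\<lambda>s. p s * h s)"
proof (rule Bochner_Integration.integrable_bound)
  show "integrable M (\<lambda>s. B * cmod (h s))" using h by auto
  show "AE x in M. norm (p x * h x) \<le> norm (B * cmod (h x))"
    using p(2) order_trans[OF norm_ge_zero p(2)]
    by (auto simp: norm_mult abs_mult intro!: AE_I2 mult_right_mono)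
qed (use h p(1) in measurable)

lemma cnj_borel_measurable [measurable]: "cnj \<in> borel_measurable borel"
  by (intro borel_measurable_continuous_onI continuous_intros)

lemma integrable_cayley_power_mult:
  assumes "integrable lebesgue h"
  shows "integrable lebesgue (\<lambda>s. cayley s ^ n * h s)" "integrable lebesgue (\<lambda>s. cnj (cayley s) ^ n * h s)"
  by (rule integrable_bounded_mult[OF assms, where B = 1]; auto simp: norm_power measurable_completion)+

lemma cayley_null_add: "cayley_null h \<Longrightarrow> cayley_null k \<Longrightarrow> cayley_null (\<lambda>s. h s + k s)"
  by (auto simp: cayley_null_def distrib_left integrable_cayley_power_mult)

lemma cayley_null_scale: "cayley_null h \<Longrightarrow> cayley_null (\<lambda>s. c * h s)"
  by (auto simp: cayley_null_def mult.left_commute[of _ c])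

lemma cayley_null_cayley:
  assumes "cayley_null h"
  shows "cayley_null (\<lambda>s. cayley s * h s)" "cayley_null (\<lambda>s. cnj (cayley s) * h s)"
proof -
  have h: "integrable lebesgue h" "\<And>n. (LINT s|lebesgue. cayley s ^ n * h s) = 0"
    "\<And>n. (LINT s|lebesgue. cnj (cayley s) ^ n * h s) = 0"
    using assms by (auto simp: cayley_null_def)
  have a: "(LINT s|lebesgue. cayley s ^ n * (cayley s * h s)) = 0" for n
    using h(2)[of "Suc n"] by (simp add: ac_simps)
  have b: "(LINT s|lebesgue. cnj (cayley s) ^ n * (cnj (cayley s) * h s)) = 0" for n
    using h(3)[of "Suc n"] by (simp add: ac_simps)
  have c: "(LINT s|lebesgue. cnj (cayley s) ^ n * (cayley s * h s)) = 0" for n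
  proof (cases n)
    case 0
    then show ?thesis using h(2)[of 1] by simp
  next
    case (Suc m)
    have "cnj (cayley s) ^ n * (cayley s * h s) = (cayley s * cnj (cayley s)) * (cnj (cayley s) ^ m * h s)" for s
      unfolding Suc power_Suc by (simp only: ac_simps)
    then show ?thesis unfolding cayley_mult_cnj using h(3)[of m] by (simp only: mult_1_left)
  qed
  have d: "(LINT s|lebesgue. cayley s ^ n * (cnj (cayley s) * h s)) = 0" for n
  proof (cases n)
    case 0
    then show ?thesis using h(3)[of 1] by simp
  next
    case (Suc m)
    have "cayley s ^ n * (cnj (cayley s) * h s) = (cayley s * cnj (cayley s)) * (cayley s ^ m * h s)" for s
      unfolding Suc power_Suc by (simp only: ac_simps)
    then show ?thesis unfolding cayley_mult_cnj using h(2)[of m] by (simp only: mult_1_left)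
  qed
  show "cayley_null (\<lambda>s. cayley s * h s)"
    using a c integrable_cayley_power_mult(1)[OF h(1), of 1] by (simp add: cayley_null_def)
  show "cayley_null (\<lambda>s. cnj (cayley s) * h s)"
    using b d integrable_cayley_power_mult(2)[OF h(1), of 1] by (simp add: cayley_null_def)
qed

text \<open>
  The annihilator of the powers is stable under multiplication by the Cayley transform and its
  conjugate, hence by any linear function of it; induction on the polynomial does the rest, without
  expanding products.
\<close>

lemma cayley_null_polynomial:
  assumes "real_polynomial_function p"
  shows "cayley_null h \<Longrightarrow> cayley_null (\<lambda>s. of_real (p (cayley s)) * h s)"
  using assms
proof (induction arbitrary: h)
  case (linear f)
  interpret f: bounded_linear f by fact
  \<comment> \<open>a real linear functional of \<open>z\<close> is a complex combination of \<open>z\<close> and \<open>cnj z\<close>\<close>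
  define c d where "c = (of_real (f 1) - \<i> * of_real (f \<i>)) / 2"
    and "d = (of_real (f 1) + \<i> * of_real (f \<i>)) / 2"
  have "of_real (f z) = c * z + d * cnj z" for z
  proof -
    have "f z = f (Re z *\<^sub>R 1 + Im z *\<^sub>R \<i>)"
      by (simp add: complex_eq[symmetric] scaleR_conv_of_real mult.commute)
    also have "\<dots> = Re z * f 1 + Im z * f \<i>"
      by (simp add: f.add f.scaleR)
    finally show ?thesis
      by (simp add: complex_eq_iff c_def d_def field_simps)
  qed
  then have "(\<lambda>s. of_real (f (cayley s)) * h s) = (\<lambda>s. c * (cayley s * h s) + d * (cnj (cayley s) * h s))"
    by (simp add: distrib_right mult.assoc)
  then show ?case
    by (simp add: cayley_null_add cayley_null_scale cayley_null_cayley linear)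
next
  case (const c)
  then show ?case by (rule cayley_null_scale)
next
  case (add f g)
  from cayley_null_add[OF add.IH(1)[OF add.prems] add.IH(2)[OF add.prems]] show ?case
    by (simp add: distrib_right)
next
  case (mult f g)
  from mult.IH(1)[OF mult.IH(2)[OF mult.prems]] show ?case
    by (simp add: mult.assoc)
qed

text \<open>
  By the Stone-Weierstrass theorem on the unit circle, \<open>g\<close> is a uniform limit of polynomials, for which
  the integral vanishes.
\<close>

lemma cayley_null_continuous:
  fixes g :: "complex \<Rightarrow> real"
  assumes h: "cayley_null h" and g: "continuous_on (sphere 0 1) g"
  shows "(LINT s|lebesgue. of_real (g (cayley s)) * h s) = 0"
proof -
  have hi: "integrable lebesgue h" using h by (simp add: cayley_null_def)
  let ?C = "LINT s|lebesgue. cmod (h s)"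
  have C: "0 \<le> ?C" by simp
  have img: "cayley ` A \<subseteq> sphere 0 1" for A by auto
  have gc: "continuous_on UNIV (\<lambda>s. complex_of_real (g (cayley s)))"
    by (intro continuous_on_of_real continuous_on_compose2[OF g continuous_on_cayley]) auto
  then have gm: "(\<lambda>s. complex_of_real (g (cayley s))) \<in> borel_measurable lebesgue"
    by (intro measurable_completion) (simp add: borel_measurable_continuous_onI)
  have "bounded (g ` sphere 0 1)"
    by (intro compact_imp_bounded compact_continuous_image g) auto
  then obtain B where B: "\<And>z. z \<in> sphere 0 1 \<Longrightarrow> \<bar>g z\<bar> \<le> B"
    unfolding bounded_iff real_norm_def by blast
  have gi: "integrable lebesgue (\<lambda>s. of_real (g (cayley s)) * h s)"
    by (rule integrable_bounded_mult[OF hi gm, where B = B]) (auto intro!: B)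
  have "cmod (LINT s|lebesgue. of_real (g (cayley s)) * h s) \<le> e * ?C" if e: "0 < e" for e
  proof -
    obtain p where p: "real_polynomial_function p" "\<And>z. z \<in> sphere 0 1 \<Longrightarrow> \<bar>g z - p z\<bar> < e"
      using Stone_Weierstrass_real_polynomial_function[OF compact_sphere g e] by blast
    have pn: "cayley_null (\<lambda>s. of_real (p (cayley s)) * h s)"
      by (rule cayley_null_polynomial[OF p(1) h])
    then have pi: "integrable lebesgue (\<lambda>s. of_real (p (cayley s)) * h s)"
      "(LINT s|lebesgue. of_real (p (cayley s)) * h s) = 0"
      by (auto simp: cayley_null_def dest!: spec[of _ "0::nat"])
    have "(LINT s|lebesgue. of_real (g (cayley s)) * h s) =
        (LINT s|lebesgue. of_real (g (cayley s)) * h s - of_real (p (cayley s)) * h s)"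
      using gi pi by simp
    also have "cmod \<dots> \<le> (LINT s|lebesgue. cmod (of_real (g (cayley s)) * h s - of_real (p (cayley s)) * h s))"
      by (rule integral_norm_bound)
    also have "\<dots> \<le> (LINT s|lebesgue. e * cmod (h s))"
    proof (rule integral_mono)
      fix s
      have "cmod (of_real (g (cayley s)) * h s - of_real (p (cayley s)) * h s) =
          \<bar>g (cayley s) - p (cayley s)\<bar> * cmod (h s)"
        by (simp flip: left_diff_distrib of_real_diff add: norm_mult)
      then show "cmod (of_real (g (cayley s)) * h s - of_real (p (cayley s)) * h s) \<le> e * cmod (h s)"
        using p(2)[of "cayley s"] by (auto intro!: mult_right_mono)
    qed (use gi pi hi in auto)
    finally show ?thesis by simp
  qed
  note * = this
  have "cmod (LINT s|lebesgue. of_real (g (cayley s)) * h s) \<le> e" if "0 < e" for e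
  proof -
    have "cmod (LINT s|lebesgue. of_real (g (cayley s)) * h s) \<le> e / (?C + 1) * ?C"
      using that C by (intro *) (simp add: add_nonneg_pos)
    also have "\<dots> \<le> e"
    proof -
      have "e * ?C \<le> e * (?C + 1)" "0 < ?C + 1"
        using that C by (simp, linarith)
      then show ?thesis by (simp add: divide_le_eq)
    qed
    finally show ?thesis .
  qed
  then show ?thesis
    using field_le_epsilon[of "cmod (LINT s|lebesgue. of_real (g (cayley s)) * h s)" 0] by simp
qed

text \<open>
  The image \<open>K\<close> of an interval under the Cayley transform is compact, and the continuous functions
  \<open>max 0 (1 - n * infdist z K)\<close> decrease to its indicator. By injectivity this gives the indicator of
  the interval on the line.
\<close>

theorem cayley_null_imp_zero_AE:
  assumes h: "cayley_null h"
  shows "AE s in lebesgue. h s = 0"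
proof (rule set_integral_intervals_zero_imp_zero_AE_lebesgue)
  show hi: "integrable lebesgue h" using h by (simp add: cayley_null_def)
  fix a b :: real
  show "(LINT x:{a..b}|lebesgue. h x) = 0"
  proof (cases "a \<le> b")
    case True
    define K where "K = cayley ` {a..b}"
    have K: "closed K" "K \<noteq> {}"
      using True compact_continuous_image[OF continuous_on_cayley compact_Icc, of a b]
      by (auto simp: K_def compact_imp_closed)
    define g where "g n z = max 0 (1 - real n * infdist z K)" for n z
    have cont: "continuous_on A (g n)" for A n
      unfolding g_def by (intro continuous_intros)
    have lim: "(\<lambda>n. g n (cayley s)) \<longlonglongrightarrow> indicator {a..b} s" for s
    proof (cases "s \<in> {a..b}")
      case True
      then have "cayley s \<in> K" by (auto simp: K_def)
      then have "g n (cayley s) = 1" for n by (simp add: g_def)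
      with True show ?thesis by simp
    next
      case False
      then have "cayley s \<notin> K"
        using inj_cayley unfolding K_def by (metis imageE injD)
      then have pos: "infdist (cayley s) K > 0"
        using K by (simp add: infdist_pos_not_in_closed)
      obtain N :: nat where N: "1 / infdist (cayley s) K < real N"
        using reals_Archimedean2 by blast
      have "g n (cayley s) = 0" if "n \<ge> N" for n
      proof -
        have "1 / infdist (cayley s) K < real n" using N that by simp
        then show ?thesis using pos by (simp add: g_def field_simps)
      qed
      then have "\<forall>\<^sub>F n in sequentially. g n (cayley s) = 0"
        by (auto simp: eventually_sequentially)
      with False show ?thesis by (simp add: tendsto_eventually)
    qed
    have gb: "\<bar>g n z\<bar> \<le> 1" for n z
      by (auto simp: g_def infdist_nonneg)
    have gm: "(\<lambda>s. complex_of_real (g n (cayley s))) \<in> borel_measurable lebesgue" for n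
    proof -
      have "continuous_on UNIV (\<lambda>s. complex_of_real (g n (cayley s)))"
        by (intro continuous_on_of_real continuous_on_compose2[OF cont continuous_on_cayley]) auto
      then show ?thesis
        by (intro measurable_completion) (simp add: borel_measurable_continuous_onI)
    qed
    have "(\<lambda>n. LINT s|lebesgue. of_real (g n (cayley s)) * h s) \<longlonglongrightarrow>
        (LINT s|lebesgue. indicator {a..b} s *\<^sub>R h s)"
    proof (rule integral_dominated_convergence[where w = "\<lambda>s. cmod (h s)"])
      show "AE s in lebesgue. (\<lambda>n. of_real (g n (cayley s)) * h s) \<longlonglongrightarrow> indicator {a..b} s *\<^sub>R h s"
        unfolding scaleR_conv_of_real by (intro AE_I2 tendsto_intros lim)
      show "AE s in lebesgue. norm (of_real (g n (cayley s)) * h s) \<le> cmod (h s)" for n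
        using gb by (auto simp: norm_mult intro!: AE_I2 mult_left_le_one_le)
      show "(\<lambda>s. of_real (g n (cayley s)) * h s) \<in> borel_measurable lebesgue" for n
        using gm hi by (intro borel_measurable_times) auto
      show "(\<lambda>s. indicator {a..b} s *\<^sub>R h s) \<in> borel_measurable lebesgue"
        using hi by (intro borel_measurable_scaleR borel_measurable_indicator) auto
    qed (use hi in auto)
    then show ?thesis
      by (simp add: cayley_null_continuous[OF h cont] set_lebesgue_integral_def LIMSEQ_const_iff)
  qed (simp add: set_lebesgue_integral_def)
qed

section \<open>Truncation and totality of the intervals\<close>

lemma real_line_borel_measurable: "f \<in> borel_measurable borel \<Longrightarrow> f \<in> borel_measurable (l2_measure TYPE(real_line))"
  by (simp add: l2_real_line measurable_completion)

lemma square_integrable_real_line: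
  "square_integrable lborel f \<Longrightarrow> square_integrable (l2_measure TYPE(real_line)) f"
  by (simp add: l2_real_line square_integrable_lebesgue_if_lborel)

lemma square_integrable_borel: "square_integrable lborel f \<Longrightarrow> f \<in> borel_measurable borel"
  by (simp add: square_integrable_def)

lemma norm_real_line_power2:
  "square_integrable lborel f \<Longrightarrow> (norm (abs_l2 f :: real_line l2))\<^sup>2 = (LINT x|lborel. (cmod (f x))\<^sup>2)"
  unfolding norm_abs_l2_power2[OF square_integrable_real_line] l2_real_line
  by (rule integral_completion) (auto simp: square_integrable_def)

lemma cinner_real_line:
  "square_integrable lborel f \<Longrightarrow> square_integrable lborel g \<Longrightarrow>
     cinner (abs_l2 f) (abs_l2 g :: real_line l2) = (LINT x|lborel. f x * cnj (g x))"
  unfolding cinner_abs_l2[OF square_integrable_real_line square_integrable_real_line] l2_real_line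
  by (rule integral_completion)
     (auto simp: square_integrable_def intro!: borel_measurable_times measurable_compose[OF _ cnj_borel_measurable])

lemma l2_dominated_convergence:
  fixes f :: "nat \<Rightarrow> real \<Rightarrow> complex"
  assumes f: "\<And>n. f n \<in> borel_measurable borel" and g: "g \<in> borel_measurable borel"
    and w: "square_integrable lborel w"
    and lim: "AE x in lborel. (\<lambda>n. f n x) \<longlonglongrightarrow> g x"
    and dom: "\<And>n x. cmod (f n x) \<le> cmod (w x)"
  shows "square_integrable lborel (f n)" "square_integrable lborel g"
    and "(\<lambda>n. abs_l2 (f n) :: real_line l2) \<longlonglongrightarrow> abs_l2 g"
proof -
  note [measurable] = f g square_integrable_borel[OF w]
  have wi: "integrable lborel (\<lambda>x. (cmod (w x))\<^sup>2)"
    using w by (simp add: square_integrable_def)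
  have domg: "AE x in lborel. cmod (g x) \<le> cmod (w x)"
    using lim by eventually_elim (rule LIMSEQ_le_const2[OF tendsto_norm], auto intro: dom)
  show sf: "square_integrable lborel (f n)" for n
    unfolding square_integrable_def
    by (intro conjI Bochner_Integration.integrable_bound[OF wi] AE_I2)
       (auto intro!: power_mono dom simp: f)
  show sg: "square_integrable lborel g"
    unfolding square_integrable_def
    by (intro conjI Bochner_Integration.integrable_bound[OF wi] AE_mp[OF domg AE_I2])
       (auto intro!: power_mono simp: g)
  have "(\<lambda>n. LINT x|lborel. (cmod (f n x - g x))\<^sup>2) \<longlonglongrightarrow> (LINT x|(lborel :: real measure). 0 :: real)"
  proof (rule integral_dominated_convergence[where f = "\<lambda>x. 0" and w = "\<lambda>x. 4 * (cmod (w x))\<^sup>2"])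
    show "AE x in lborel. (\<lambda>n. (cmod (f n x - g x))\<^sup>2) \<longlonglongrightarrow> (0::real)"
      using lim
    proof eventually_elim
      case (elim x)
      have "(\<lambda>n. (cmod (f n x - g x))\<^sup>2) \<longlonglongrightarrow> (cmod (g x - g x))\<^sup>2"
        by (intro tendsto_intros elim)
      then show ?case by simp
    qed
    show "AE x in lborel. norm ((cmod (f n x - g x))\<^sup>2) \<le> 4 * (cmod (w x))\<^sup>2" for n
      using domg
    proof eventually_elim
      case (elim x)
      have "cmod (f n x - g x) \<le> 2 * cmod (w x)"
        using norm_triangle_ineq4[of "f n x" "g x"] dom[of n x] elim by simp
      then have "(cmod (f n x - g x))\<^sup>2 \<le> (2 * cmod (w x))\<^sup>2"
        by (intro power_mono) auto
      then show ?case by (simp add: power_mult_distrib)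
    qed
  qed (use wi in auto)
  then have "(\<lambda>n. (norm (abs_l2 (f n) - abs_l2 g :: real_line l2))\<^sup>2) \<longlonglongrightarrow> 0"
    using sf sg
    by (simp add: abs_l2_diff square_integrable_real_line norm_real_line_power2 square_integrable_diff)
  then have "(\<lambda>n. sqrt ((norm (abs_l2 (f n) - abs_l2 g :: real_line l2))\<^sup>2)) \<longlonglongrightarrow> sqrt 0"
    by (rule tendsto_real_sqrt)
  then have "(\<lambda>n. norm (abs_l2 (f n) - abs_l2 g :: real_line l2)) \<longlonglongrightarrow> 0"
    by simp
  then show "(\<lambda>n. abs_l2 (f n) :: real_line l2) \<longlonglongrightarrow> abs_l2 g"
    by (rule LIM_zero_cancel[OF tendsto_norm_zero_cancel])
qed

definition trunc :: "nat \<Rightarrow> (real \<Rightarrow> complex) \<Rightarrow> real \<Rightarrow> complex" where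
  "trunc n f x = indicator {- real n..real n} x * f x"

lemma trunc_borel [measurable]: "f \<in> borel_measurable borel \<Longrightarrow> trunc n f \<in> borel_measurable borel"
  unfolding trunc_def by measurable

lemma cmod_trunc_le: "cmod (trunc n f x) \<le> cmod (f x)"
  by (simp add: trunc_def indicator_def)

lemma trunc_tendsto: "(\<lambda>n. trunc n f x) \<longlonglongrightarrow> f x"
proof (rule tendsto_eventually)
  obtain N :: nat where "\<bar>x\<bar> \<le> real N" using real_arch_simple by blast
  then show "\<forall>\<^sub>F n in sequentially. trunc n f x = f x"
    by (intro eventually_sequentiallyI[of N]) (auto simp: indicator_def trunc_def)
qed

lemma square_integrable_trunc: "square_integrable lborel f \<Longrightarrow> square_integrable lborel (trunc n f)"
  by (rule l2_dominated_convergence(1)[where g = f and w = f])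
     (auto intro: square_integrable_borel trunc_borel simp: trunc_tendsto cmod_trunc_le)

lemma abs_l2_trunc_tendsto:
  "square_integrable lborel f \<Longrightarrow> (\<lambda>n. abs_l2 (trunc n f) :: real_line l2) \<longlonglongrightarrow> abs_l2 f"
  by (rule l2_dominated_convergence(3)[where g = f and w = f])
     (auto intro: square_integrable_borel trunc_borel simp: trunc_tendsto cmod_trunc_le)

lemma square_integrable_indicator: "square_integrable lborel (indicator {a..b} :: real \<Rightarrow> complex)"
proof -
  have "(cmod (indicator {a..b} x))\<^sup>2 = indicator {a..b} x" for x :: real
    by (simp add: indicator_def)
  then show ?thesis
    by (simp add: square_integrable_def integrable_indicator_iff emeasure_lborel_Icc_eq)
qed

lemma integrable_trunc:
  assumes "square_integrable lborel f"
  shows "integrable lborel (trunc n f)"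
proof -
  have "integrable lborel (\<lambda>x. indicator {- real n..real n} x * f x)"
    by (rule square_integrable_mult[OF square_integrable_indicator assms])
  then show ?thesis by (simp add: trunc_def[abs_def])
qed

text \<open>
  The function itself need not be integrable, so the criterion for integrable functions is applied to its
  truncations.
\<close>

lemma l2_zero_if_orthogonal_to_intervals:
  fixes F :: "real_line l2"
  assumes "\<And>a b. cinner F (abs_l2 (indicator {a..b})) = 0"
  shows "F = 0"
proof -
  obtain f where f: "f \<in> borel_measurable borel" "square_integrable lborel f" "F = abs_l2 f"
    by (rule real_line_borel_cases)
  have "AE x in lborel. trunc n f x = 0" for n
  proof (rule set_integral_intervals_zero_imp_zero_AE[OF integrable_trunc[OF f(2)]])
    fix a b :: real
    have "(LINT x:{a..b}|lborel. trunc n f x) =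
        (LINT x|lborel. f x * cnj (indicator {max a (- real n)..min b (real n)} x))"
      unfolding set_lebesgue_integral_def
      by (intro Bochner_Integration.integral_cong) (auto simp: trunc_def indicator_def)
    also have "\<dots> = 0"
      using assms f by (simp add: cinner_real_line[symmetric] square_integrable_indicator)
    finally show "(LINT x:{a..b}|lborel. trunc n f x) = 0" .
  qed
  then have "AE x in lborel. \<forall>n. trunc n f x = 0"
    by (simp add: AE_all_countable)
  then have "AE x in lborel. f x = 0"
  proof eventually_elim
    case (elim x)
    then show ?case using trunc_tendsto[of f x] by (simp add: LIMSEQ_const_iff)
  qed
  then have "AE x in lebesgue. f x = 0"
    by (rule AE_completion)
  then show ?thesis
    using abs_l2_eq_iff[where 'd = real_line, of f "\<lambda>x. 0"] f
    unfolding l2_real_line abs_l2_zero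
    by (simp add: square_integrable_zero square_integrable_lebesgue_if_lborel)
qed

lemma subspace_if_l2_subspace: "l2.subspace S \<Longrightarrow> subspace S"
  by (auto simp: l2.subspace_def subspace_def scaleR_scaleC)

lemma l2_projection:
  fixes S :: "'d::l2_domain l2 set"
  assumes "closed S" "l2.subspace S"
  obtains y where "y \<in> S" "\<And>z. z \<in> S \<Longrightarrow> cinner (x - y) z = 0"
proof -
  obtain y where y: "y \<in> S" "\<And>z. z \<in> S \<Longrightarrow> (x - y) \<bullet> z = 0"
    using orthogonal_projection_exists[OF assms(1) subspace_if_l2_subspace[OF assms(2)], of x] by blast
  have "cinner (x - y) z = 0" if "z \<in> S" for z
    using y(2)[OF that] y(2)[OF l2.subspace_scale[OF assms(2) that]] by (simp add: cinner_eq_0_iff)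
  with y(1) show thesis by (rule that)
qed

lemma closed_subspace_with_intervals_eq_UNIV:
  fixes S :: "real_line l2 set"
  assumes S: "closed S" "l2.subspace S" and ind: "\<And>a b. abs_l2 (indicator {a..b}) \<in> S"
  shows "S = UNIV"
proof (intro equalityI subset_UNIV subsetI)
  fix x :: "real_line l2"
  obtain y where y: "y \<in> S" "\<And>z. z \<in> S \<Longrightarrow> cinner (x - y) z = 0"
    using l2_projection[OF S] by blast
  have "x - y = 0"
    by (rule l2_zero_if_orthogonal_to_intervals) (rule y(2)[OF ind])
  with y(1) show "x \<in> S" by simp
qed

section \<open>Convolution\<close>

definition convol :: "(real \<Rightarrow> complex) \<Rightarrow> (real \<Rightarrow> complex) \<Rightarrow> real \<Rightarrow> complex" where
  "convol k g x = (LINT w|lborel. k w * g (x - w))"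

lemma convol_borel:
  assumes [measurable]: "k \<in> borel_measurable borel" "g \<in> borel_measurable borel"
  shows "convol k g \<in> borel_measurable borel"
  unfolding convol_def[abs_def] by measurable

lemma square_integrable_shift:
  fixes g :: "real \<Rightarrow> complex"
  shows "square_integrable lborel g \<Longrightarrow> square_integrable lborel (\<lambda>w. g (x - w))"
  using lborel_integrable_real_affine[of "\<lambda>x. (cmod (g x))\<^sup>2" "-1" x]
  by (auto simp: square_integrable_def)

lemma convol_integrable:
  fixes k g :: "real \<Rightarrow> complex"
  shows "square_integrable lborel k \<Longrightarrow> square_integrable lborel g \<Longrightarrow>
     integrable lborel (\<lambda>w. k w * g (x - w))"
  by (rule square_integrable_mult[OF _ square_integrable_shift[of g x]])

text \<open>
  Writing \<open>|k| |g| = sqrt |k| * (sqrt |k| |g|)\<close>, the Cauchy-Schwarz inequality bounds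
  \<open>|(k * g)(x)|\<^sup>2\<close> by the \<open>L\<^sup>1\<close> norm of \<open>k\<close> times the convolution of \<open>|k|\<close> with \<open>|g|\<^sup>2\<close>; integrate in
  \<open>x\<close> and exchange the order of integration.
\<close>

lemma Young_convol:
  assumes k: "integrable lborel k" and g: "square_integrable lborel g"
  shows "square_integrable lborel (convol k g)"
    and "norm (abs_l2 (convol k g) :: real_line l2) \<le> (LINT w|lborel. cmod (k w)) * norm (abs_l2 g :: real_line l2)"
proof -
  have [measurable]: "k \<in> borel_measurable borel" "g \<in> borel_measurable borel"
    using k g by (auto simp: square_integrable_def)
  note [measurable] = convol_borel[of k g]
  let ?K = "LINT w|lborel. cmod (k w)" and ?G = "LINT x|lborel. (cmod (g x))\<^sup>2"
  have K: "(\<integral>\<^sup>+w. ennreal (cmod (k w)) \<partial>lborel) = ennreal ?K"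
    using k by (intro nn_integral_eq_integral) auto
  have G: "(\<integral>\<^sup>+w. ennreal ((cmod (g w))\<^sup>2) \<partial>lborel) = ennreal ?G"
    using g by (intro nn_integral_eq_integral) (auto simp: square_integrable_def)
  have sq: "ennreal (sqrt (cmod z)) * ennreal (sqrt (cmod z)) = ennreal (cmod z)" for z
    by (subst ennreal_mult[symmetric]) auto
  have pt: "ennreal ((cmod (convol k g x))\<^sup>2) \<le>
      ennreal ?K * (\<integral>\<^sup>+w. ennreal (cmod (k w)) * ennreal ((cmod (g (x - w)))\<^sup>2) \<partial>lborel)" for x
  proof -
    let ?I = "\<integral>\<^sup>+w. ennreal (cmod (k w)) * ennreal (cmod (g (x - w))) \<partial>lborel"
    have "ennreal (cmod (convol k g x)) \<le> ?I"
    proof (cases "integrable lborel (\<lambda>w. k w * g (x - w))")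
      case True
      from integral_norm_bound_ennreal[OF this] show ?thesis
        by (simp add: convol_def norm_mult ennreal_mult)
    next
      case False
      then show ?thesis by (simp add: convol_def not_integrable_integral_eq)
    qed
    then have "(ennreal (cmod (convol k g x)))\<^sup>2 \<le> ?I\<^sup>2"
      by (rule power_mono) simp
    also have "?I = (\<integral>\<^sup>+w. ennreal (sqrt (cmod (k w))) * (ennreal (sqrt (cmod (k w))) * ennreal (cmod (g (x - w)))) \<partial>lborel)"
      by (simp add: sq mult.assoc[symmetric])
    also have "\<dots>\<^sup>2 \<le> (\<integral>\<^sup>+w. (ennreal (sqrt (cmod (k w))))\<^sup>2 \<partial>lborel) *
        (\<integral>\<^sup>+w. (ennreal (sqrt (cmod (k w))) * ennreal (cmod (g (x - w))))\<^sup>2 \<partial>lborel)"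
      by (rule Cauchy_Schwarz_nn_integral) measurable
    also have "(\<integral>\<^sup>+w. (ennreal (sqrt (cmod (k w))))\<^sup>2 \<partial>lborel) = ennreal ?K"
      by (simp add: power2_eq_square sq K)
    also have "(\<lambda>w. (ennreal (sqrt (cmod (k w))) * ennreal (cmod (g (x - w))))\<^sup>2) =
        (\<lambda>w. ennreal (cmod (k w)) * ennreal ((cmod (g (x - w)))\<^sup>2))"
      unfolding power_mult_distrib by (simp add: power2_eq_square sq ennreal_mult)
    finally show ?thesis by (simp add: ennreal_power)
  qed
  have "(\<integral>\<^sup>+x. ennreal ((cmod (convol k g x))\<^sup>2) \<partial>lborel) \<le>
      (\<integral>\<^sup>+x. ennreal ?K * (\<integral>\<^sup>+w. ennreal (cmod (k w)) * ennreal ((cmod (g (x - w)))\<^sup>2) \<partial>lborel) \<partial>lborel)"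
    by (intro nn_integral_mono pt)
  also have "\<dots> = ennreal ?K * (\<integral>\<^sup>+x. (\<integral>\<^sup>+w. ennreal (cmod (k w)) * ennreal ((cmod (g (x - w)))\<^sup>2) \<partial>lborel) \<partial>lborel)"
    by (rule nn_integral_cmult) measurable
  also have "(\<integral>\<^sup>+x. (\<integral>\<^sup>+w. ennreal (cmod (k w)) * ennreal ((cmod (g (x - w)))\<^sup>2) \<partial>lborel) \<partial>lborel) =
      (\<integral>\<^sup>+w. (\<integral>\<^sup>+x. ennreal (cmod (k w)) * ennreal ((cmod (g (x - w)))\<^sup>2) \<partial>lborel) \<partial>lborel)"
    by (rule lborel_pair.Fubini') measurable
  also have "\<dots> = (\<integral>\<^sup>+w. ennreal (cmod (k w)) * ennreal ?G \<partial>lborel)"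
  proof (rule nn_integral_cong)
    fix w
    have "(\<integral>\<^sup>+x. ennreal (cmod (k w)) * ennreal ((cmod (g (x - w)))\<^sup>2) \<partial>lborel) =
        ennreal (cmod (k w)) * (\<integral>\<^sup>+x. ennreal ((cmod (g (x - w)))\<^sup>2) \<partial>lborel)"
      by (rule nn_integral_cmult) measurable
    also have "(\<integral>\<^sup>+x. ennreal ((cmod (g (x - w)))\<^sup>2) \<partial>lborel) = ennreal ?G"
      using nn_integral_real_affine[of "\<lambda>x. ennreal ((cmod (g x))\<^sup>2)" 1 "- w"] G by simp
    finally show "(\<integral>\<^sup>+x. ennreal (cmod (k w)) * ennreal ((cmod (g (x - w)))\<^sup>2) \<partial>lborel) =
        ennreal (cmod (k w)) * ennreal ?G" .
  qed
  also have "\<dots> = ennreal ?K * ennreal ?G"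
    by (subst nn_integral_multc) (auto simp: K)
  also have "ennreal ?K * (ennreal ?K * ennreal ?G) = ennreal (?K\<^sup>2 * ?G)"
    by (simp add: ennreal_mult power2_eq_square mult.assoc)
  finally have *: "(\<integral>\<^sup>+x. ennreal ((cmod (convol k g x))\<^sup>2) \<partial>lborel) \<le> ennreal (?K\<^sup>2 * ?G)" .
  then have i: "integrable lborel (\<lambda>x. (cmod (convol k g x))\<^sup>2)"
    by (intro integrableI_nonneg) (auto simp: less_top[symmetric] top_unique)
  then show s: "square_integrable lborel (convol k g)"
    by (simp add: square_integrable_def convol_borel)
  have "ennreal (LINT x|lborel. (cmod (convol k g x))\<^sup>2) \<le> ennreal (?K\<^sup>2 * ?G)"
    using * by (subst (asm) nn_integral_eq_integral[OF i]) auto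
  then have "(LINT x|lborel. (cmod (convol k g x))\<^sup>2) \<le> ?K\<^sup>2 * ?G"
    by (subst (asm) ennreal_le_iff) auto
  then have "(norm (abs_l2 (convol k g) :: real_line l2))\<^sup>2 \<le> (?K * norm (abs_l2 g :: real_line l2))\<^sup>2"
    by (simp add: norm_real_line_power2 s g power_mult_distrib)
  then show "norm (abs_l2 (convol k g) :: real_line l2) \<le> ?K * norm (abs_l2 g :: real_line l2)"
    by (rule power2_le_imp_le) auto
qed

text \<open>
  Square integrability of the kernel makes the convolution integral converge at every point, so that
  convolution is additive pointwise.
\<close>

lemma convol_diff:
  assumes "square_integrable lborel k" "square_integrable lborel f" "square_integrable lborel g"
  shows "convol k (\<lambda>x. f x - g x) = (\<lambda>x. convol k f x - convol k g x)"
  using convol_integrable[OF assms(1,2)] convol_integrable[OF assms(1,3)]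
  by (simp add: fun_eq_iff convol_def right_diff_distrib)

lemma convol_trunc_tendsto:
  assumes k: "integrable lborel k" "square_integrable lborel k" and g: "square_integrable lborel g"
  shows "(\<lambda>n. abs_l2 (convol k (trunc n g)) :: real_line l2) \<longlonglongrightarrow> abs_l2 (convol k g)"
proof -
  let ?K = "LINT w|lborel. cmod (k w)"
  have "(\<lambda>n. abs_l2 (convol k (trunc n g)) - abs_l2 (convol k g) :: real_line l2) \<longlonglongrightarrow> 0"
  proof (rule Lim_null_comparison)
    show "\<forall>\<^sub>F n in sequentially. norm (abs_l2 (convol k (trunc n g)) - abs_l2 (convol k g) :: real_line l2) \<le>
        ?K * norm (abs_l2 (trunc n g) - abs_l2 g :: real_line l2)"
    proof (intro always_eventually allI)
      fix n
      note s = square_integrable_real_line Young_convol(1)[OF k(1)] g square_integrable_trunc[OF g, of n]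
      have "abs_l2 (convol k (trunc n g)) - abs_l2 (convol k g) =
          (abs_l2 (convol k (\<lambda>x. trunc n g x - g x)) :: real_line l2)"
        by (simp add: abs_l2_diff s convol_diff[OF k(2)])
      then show "norm (abs_l2 (convol k (trunc n g)) - abs_l2 (convol k g) :: real_line l2) \<le>
          ?K * norm (abs_l2 (trunc n g) - abs_l2 g :: real_line l2)"
        using Young_convol(2)[OF k(1) square_integrable_diff[OF square_integrable_trunc[OF g, of n] g]]
        by (simp add: abs_l2_diff s)
    qed
    have "(\<lambda>n. ?K * norm (abs_l2 (trunc n g) - abs_l2 g :: real_line l2)) \<longlonglongrightarrow> ?K * norm (abs_l2 g - abs_l2 g :: real_line l2)"
      by (intro tendsto_intros abs_l2_trunc_tendsto g)
    then show "(\<lambda>n. ?K * norm (abs_l2 (trunc n g) - abs_l2 g :: real_line l2)) \<longlonglongrightarrow> 0"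
      by simp
  qed
  then show ?thesis by (simp add: LIM_zero_iff)
qed

section \<open>The Fourier integral\<close>

text \<open>
  The Fourier integral with the unitary normalization. It is meaningful for integrable \<open>f\<close>; for all other
  functions the Bochner integral has the default value zero.
\<close>

definition FT :: "(real \<Rightarrow> complex) \<Rightarrow> real \<Rightarrow> complex" where
  "FT f s = 1 / of_real (sqrt (2 * pi)) * (LINT x|lborel. f x * exp (- (\<i> * of_real x * of_real s)))"

lemma cmod_fourier_kernel [simp]: "cmod (exp (- (\<i> * of_real x * of_real s))) = 1"
  by simp

lemma integrable_mult_fourier_kernel:
  assumes "integrable lborel f"
  shows "integrable lborel (\<lambda>x. f x * exp (- (\<i> * of_real x * of_real s)))"
  unfolding mult.commute[of "f _"]
  by (rule integrable_bounded_mult[OF assms, where B = 1]) auto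

lemma FT_borel [measurable]:
  assumes [measurable]: "f \<in> borel_measurable borel"
  shows "FT f \<in> borel_measurable borel"
  unfolding FT_def[abs_def] by measurable

lemma FT_add:
  "integrable lborel f \<Longrightarrow> integrable lborel g \<Longrightarrow> FT (\<lambda>x. f x + g x) = (\<lambda>s. FT f s + FT g s)"
  by (simp add: fun_eq_iff FT_def distrib_right integrable_mult_fourier_kernel distrib_left)

lemma FT_cmult: "FT (\<lambda>x. c * f x) = (\<lambda>s. c * FT f s)"
  by (simp add: fun_eq_iff FT_def mult.assoc)

lemma FT_cnj: "FT (\<lambda>x. cnj (f x)) = (\<lambda>s. cnj (FT f (- s)))"
proof
  fix s
  have "(LINT x|lborel. cnj (f x) * exp (- (\<i> * of_real x * of_real s))) =
      (LINT x|lborel. cnj (f x * exp (- (\<i> * of_real x * of_real (- s)))))"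
    by (simp add: exp_cnj)
  also have "\<dots> = cnj (LINT x|lborel. f x * exp (- (\<i> * of_real x * of_real (- s))))"
    by (rule Bochner_Integration.integral_cnj)
  finally show "FT (\<lambda>x. cnj (f x)) s = cnj (FT f (- s))" by (simp add: FT_def)
qed

lemma FT_reflect: "FT (\<lambda>x. f (- x)) = (\<lambda>s. FT f (- s))"
  using lborel_integral_real_affine[of "-1" "\<lambda>x. f x * exp (- (\<i> * of_real x * of_real (- s)))" 0 for s]
  by (simp add: fun_eq_iff FT_def)

lemma cmod_FT_le:
  "cmod (FT f s) \<le> 1 / sqrt (2 * pi) * (LINT x|lborel. cmod (f x))"
proof -
  have "cmod (LINT x|lborel. f x * exp (- (\<i> * of_real x * of_real s))) \<le> (LINT x|lborel. cmod (f x))"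
    using integral_norm_bound[of lborel "\<lambda>x. f x * exp (- (\<i> * of_real x * of_real s))"]
    by (simp add: norm_mult)
  then show ?thesis
    unfolding FT_def by (simp add: norm_mult norm_divide divide_right_mono)
qed

lemma Fubini_bounded_kernel:
  fixes f h :: "real \<Rightarrow> complex" and K :: "real \<Rightarrow> real \<Rightarrow> complex"
  assumes f: "integrable lborel f" and h: "integrable lborel h"
    and K: "case_prod K \<in> borel_measurable (borel \<Otimes>\<^sub>M borel)" "\<And>x s. cmod (K x s) \<le> 1"
  shows "(LINT s|lborel. LINT x|lborel. f x * h s * K x s) =
      (LINT x|lborel. LINT s|lborel. f x * h s * K x s)"
proof -
  have [measurable]: "f \<in> borel_measurable borel" "h \<in> borel_measurable borel"
    "case_prod K \<in> borel_measurable (borel \<Otimes>\<^sub>M borel)"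
    using f h K by auto
  have Kx: "K x \<in> borel_measurable borel" for x
    by measurable
  have i2: "integrable lborel (\<lambda>s. f x * h s * K x s)" for x
  proof -
    have "integrable lborel (\<lambda>s. K x s * (f x * h s))"
      by (rule integrable_bounded_mult[where B = 1]) (use h Kx K(2) in auto)
    then show ?thesis by (simp add: mult.commute)
  qed
  have "integrable (lborel \<Otimes>\<^sub>M lborel) (\<lambda>(x, s). f x * h s * K x s)"
  proof (rule lborel_pair.Fubini_integrable)
    show "integrable lborel (\<lambda>x. LINT s|lborel. norm (case (x, s) of (x, s) \<Rightarrow> f x * h s * K x s))"
    proof (rule Bochner_Integration.integrable_bound)
      show "integrable lborel (\<lambda>x. cmod (f x) * (LINT s|lborel. cmod (h s)))"
        using f by simp
      have "(LINT s|lborel. cmod (f x * h s * K x s)) \<le> (LINT s|lborel. cmod (f x) * cmod (h s))" for x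
      proof (rule integral_mono)
        show "integrable lborel (\<lambda>s. cmod (f x * h s * K x s))"
          using i2[of x] by simp
        show "integrable lborel (\<lambda>s. cmod (f x) * cmod (h s))"
          using h by simp
        show "cmod (f x * h s * K x s) \<le> cmod (f x) * cmod (h s)" for s
          using K(2)[of x s] by (simp add: norm_mult mult_left_le)
      qed
      then show "AE x in lborel. norm (LINT s|lborel. norm (case (x, s) of (x, s) \<Rightarrow> f x * h s * K x s))
          \<le> norm (cmod (f x) * (LINT s|lborel. cmod (h s)))"
        by simp
    qed measurable
  qed (use i2 in auto)
  then show ?thesis
    by (rule lborel_pair.Fubini_integral)
qed

lemma fourier_kernel_measurable:
  "(\<lambda>(x, s). exp (- (\<i> * complex_of_real x * complex_of_real s))) \<in> borel_measurable (borel \<Otimes>\<^sub>M borel)"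
  unfolding borel_prod case_prod_beta' by (intro borel_measurable_continuous_onI continuous_intros)

text \<open>
  The Fourier integral can be moved from one factor to the other, by Fubini's theorem.
\<close>

lemma FT_multiplication_formula:
  assumes f: "integrable lborel f" and h: "integrable lborel h"
  shows "(LINT s|lborel. FT f s * h s) = (LINT x|lborel. f x * FT h x)"
proof -
  let ?c = "1 / complex_of_real (sqrt (2 * pi))" and ?K = "\<lambda>x s. exp (- (\<i> * complex_of_real x * complex_of_real s))"
  have "(LINT s|lborel. FT f s * h s) = (LINT s|lborel. ?c * (LINT x|lborel. f x * h s * ?K x s))"
  proof (rule Bochner_Integration.integral_cong)
    fix s
    have "(LINT x|lborel. f x * h s * ?K x s) = (LINT x|lborel. f x * ?K x s * h s)"
      by (simp add: ac_simps)
    also have "\<dots> = (LINT x|lborel. f x * ?K x s) * h s"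
      by simp
    finally show "FT f s * h s = ?c * (LINT x|lborel. f x * h s * ?K x s)"
      by (simp add: FT_def)
  qed simp
  also have "\<dots> = ?c * (LINT s|lborel. LINT x|lborel. f x * h s * ?K x s)"
    by simp
  also have "(LINT s|lborel. LINT x|lborel. f x * h s * ?K x s) = (LINT x|lborel. LINT s|lborel. f x * h s * ?K x s)"
    by (rule Fubini_bounded_kernel[OF f h fourier_kernel_measurable]) simp
  also have "?c * \<dots> = (LINT x|lborel. ?c * (LINT s|lborel. f x * h s * ?K x s))"
    by simp
  also have "\<dots> = (LINT x|lborel. f x * FT h x)"
    by (rule Bochner_Integration.integral_cong) (simp_all add: FT_def ac_simps)
  finally show ?thesis .
qed

lemma
  fixes k g :: "real \<Rightarrow> complex"
  assumes k: "integrable lborel k" and g: "integrable lborel g"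
  shows integrable_convol: "integrable lborel (convol k g)"
    and FT_convol: "FT (convol k g) s = of_real (sqrt (2 * pi)) * FT k s * FT g s"
proof -
  have [measurable]: "k \<in> borel_measurable borel" "g \<in> borel_measurable borel"
    using k g by auto
  let ?K = "\<lambda>x s. exp (- (\<i> * complex_of_real x * complex_of_real s))"
  have gs: "integrable lborel (\<lambda>x. g (x - w))" for w
    using lborel_integrable_real_affine[OF g, of 1 "-w"] by simp
  have gn: "(LINT x|lborel. cmod (g (x - w))) = (LINT x|lborel. cmod (g x))" for w
    using lborel_integral_real_affine[of 1 "\<lambda>x. cmod (g x)" "-w"] by simp
  have prod: "integrable (lborel \<Otimes>\<^sub>M lborel) (\<lambda>(w, x). k w * g (x - w))"
  proof (rule lborel_pair.Fubini_integrable)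
    show "integrable lborel (\<lambda>w. LINT x|lborel. norm (case (w, x) of (w, x) \<Rightarrow> k w * g (x - w)))"
      using k by (simp add: norm_mult gn)
  qed (use gs in auto)
  from lborel_pair.integrable_snd[OF prod] show "integrable lborel (convol k g)"
    by (simp add: convol_def[abs_def])
  have prodK: "integrable (lborel \<Otimes>\<^sub>M lborel) (\<lambda>(w, x). k w * g (x - w) * ?K x s)"
  proof -
    have "integrable (lborel \<Otimes>\<^sub>M lborel) (\<lambda>p. ?K (snd p) s * (case p of (w, x) \<Rightarrow> k w * g (x - w)))"
    proof (rule integrable_bounded_mult[OF prod])
      show "(\<lambda>p. ?K (snd p) s) \<in> borel_measurable (lborel \<Otimes>\<^sub>M lborel)"
        by measurable
      show "cmod (?K (snd p) s) \<le> 1" for p :: "real \<times> real"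
        by simp
    qed
    then show ?thesis by (simp add: case_prod_beta' mult.commute)
  qed
  have "(LINT x|lborel. convol k g x * ?K x s) = (LINT x|lborel. LINT w|lborel. k w * g (x - w) * ?K x s)"
    by (simp add: convol_def)
  also have "\<dots> = (LINT w|lborel. LINT x|lborel. k w * g (x - w) * ?K x s)"
    by (rule lborel_pair.Fubini_integral[OF prodK])
  also have "\<dots> = (LINT w|lborel. k w * ?K w s * (LINT x|lborel. g x * ?K x s))"
  proof (rule Bochner_Integration.integral_cong)
    fix w
    have "(LINT x|lborel. g x * ?K x s) = (LINT x|lborel. g (x - w) * ?K (x - w) s)"
      using lborel_integral_real_affine[of 1 "\<lambda>x. g x * ?K x s" "-w"] by simp
    also have "k w * ?K w s * \<dots> = (LINT x|lborel. k w * ?K w s * (g (x - w) * ?K (x - w) s))"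
      by simp
    also have "(\<lambda>x. k w * ?K w s * (g (x - w) * ?K (x - w) s)) = (\<lambda>x. k w * g (x - w) * ?K x s)"
    proof
      fix x
      have "?K x s = ?K w s * ?K (x - w) s"
        by (simp add: exp_add[symmetric] algebra_simps)
      then show "k w * ?K w s * (g (x - w) * ?K (x - w) s) = k w * g (x - w) * ?K x s"
        by (simp only: ac_simps)
    qed
    finally show "(LINT x|lborel. k w * g (x - w) * ?K x s) = k w * ?K w s * (LINT x|lborel. g x * ?K x s)"
      by simp
  qed simp
  also have "\<dots> = (LINT w|lborel. k w * ?K w s) * (LINT x|lborel. g x * ?K x s)"
    by simp
  finally show "FT (convol k g) s = of_real (sqrt (2 * pi)) * FT k s * FT g s"
    by (simp add: FT_def)
qed

section \<open>The Poisson kernel and Abel summation\<close>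

text \<open>
  This Laplace integral is behind both explicit transforms used below, that of \<open>exp (- e |s|)\<close> and that of
  the kernel of the Cesaro operator.
\<close>

lemma
  assumes z: "Re z > 0"
  shows integrable_exp_half_line: "integrable lborel (\<lambda>s. indicator {0<..} s * exp (- (z * of_real s)))"
    and integral_exp_half_line: "(LINT s|lborel. indicator {0<..} s * exp (- (z * of_real s))) = 1 / z"
proof -
  let ?f = "\<lambda>s. exp (- (z * of_real s))"
  have lim: "((\<lambda>s. exp (- Re z * s)) \<longlongrightarrow> 0) at_top"
    using z by (intro filterlim_compose[OF exp_at_bot] filterlim_tendsto_neg_mult_at_bot[OF tendsto_const] filterlim_ident) simp
  have "(\<integral>\<^sup>+s. ennreal (exp (- Re z * s)) * indicator {0..} s \<partial>lborel) = ennreal (0 - (- exp (- Re z * 0) / Re z))"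
  proof (rule nn_integral_FTC_atLeast[where F = "\<lambda>s. - exp (- Re z * s) / Re z"])
    show "((\<lambda>s. - exp (- Re z * s) / Re z) \<longlongrightarrow> 0) at_top"
      using tendsto_divide[OF tendsto_minus[OF lim] tendsto_const, of "Re z"] z by simp
  qed (use z in \<open>auto intro!: derivative_eq_intros\<close>)
  then have fin: "(\<integral>\<^sup>+s. ennreal (exp (- Re z * s)) * indicator {0..} s \<partial>lborel) < \<infinity>"
    by simp
  show i: "integrable lborel (\<lambda>s. indicator {0<..} s * ?f s)"
  proof (rule integrableI_bounded)
    have "(\<integral>\<^sup>+s. ennreal (norm (indicator {0<..} s * ?f s)) \<partial>lborel) \<le>
        (\<integral>\<^sup>+s. ennreal (exp (- Re z * s)) * indicator {0..} s \<partial>lborel)"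
      by (intro nn_integral_mono) (auto simp: indicator_def)
    with fin show "(\<integral>\<^sup>+s. ennreal (norm (indicator {0<..} s * ?f s)) \<partial>lborel) < \<infinity>"
      by (rule le_less_trans[rotated])
  qed measurable
  have ind: "indicator {0<..} s * ?f s = indicator {0<..} s *\<^sub>R ?f s" for s :: real
    by (simp add: indicator_def)
  have z0: "z \<noteq> 0" using z by auto
  have "(LBINT s=0..\<infinity>. ?f s) = 0 - (- (1 / z))"
  proof (rule interval_integral_FTC_integrable[where F = "\<lambda>s. - (?f s / z)"])
    show "((\<lambda>s. - (?f s / z)) has_vector_derivative ?f x) (at x)" for x
      using z0 by (auto intro!: derivative_eq_intros has_vector_derivative_real_field)
    show "set_integrable lborel (einterval 0 \<infinity>) ?f"
      using i unfolding ind by (simp add: set_integrable_def zero_ereal_def)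
    show "(((\<lambda>s. - (?f s / z)) \<circ> real_of_ereal) \<longlongrightarrow> - (1 / z)) (at_right 0)"
    proof -
      have "((\<lambda>s. - (?f s / z)) \<longlongrightarrow> - (?f 0 / z)) (at_right 0)"
        using z0 by (intro tendsto_intros) auto
      then show ?thesis by (simp add: zero_ereal_def ereal_tendsto_simps)
    qed
    have "((\<lambda>s. cmod (?f s)) \<longlongrightarrow> 0) at_top"
      using lim by simp
    then have "(?f \<longlongrightarrow> 0) at_top"
      by (rule tendsto_norm_zero_cancel)
    then have "((\<lambda>s. - (?f s / z)) \<longlongrightarrow> - (0 / z)) at_top"
      using z0 by (intro tendsto_intros) auto
    then show "(((\<lambda>s. - (?f s / z)) \<circ> real_of_ereal) \<longlongrightarrow> 0) (at_left \<infinity>)"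
      by (simp add: ereal_tendsto_simps)
  qed auto
  then show "(LINT s|lborel. indicator {0<..} s * ?f s) = 1 / z"
    unfolding ind by (simp add: interval_lebesgue_integral_0_infty set_lebesgue_integral_def)
qed

definition abel_factor :: "real \<Rightarrow> real \<Rightarrow> complex" where
  "abel_factor e s = of_real (exp (- e * \<bar>s\<bar>))"

definition poisson :: "real \<Rightarrow> real \<Rightarrow> complex" where
  "poisson e x = of_real (e / (pi * (e\<^sup>2 + x\<^sup>2)))"

lemma abel_borel [measurable]: "abel_factor e \<in> borel_measurable borel"
  unfolding abel_factor_def[abs_def] by measurable

lemma poisson_borel [measurable]: "poisson e \<in> borel_measurable borel"
  unfolding poisson_def[abs_def] by measurable

text \<open>
  The two half lines give two Laplace integrals; the formula fails only at \<open>s = 0\<close>.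
\<close>

lemma abel_split:
  "AE s in lborel. abel_factor e s * exp (- (\<i> * of_real s * of_real x)) =
     indicator {0<..} s * exp (- ((of_real e + \<i> * of_real x) * of_real s)) +
     indicator {0<..} (- s) * exp (- ((of_real e - \<i> * of_real x) * of_real (- s)))"
  using AE_lborel_singleton[of 0]
  by eventually_elim
     (auto simp: abel_factor_def indicator_def exp_of_real[symmetric] exp_add[symmetric] algebra_simps)

lemma
  assumes e: "0 < e"
  shows integrable_abel: "integrable lborel (abel_factor e)"
    and FT_abel: "1 / of_real (sqrt (2 * pi)) * FT (abel_factor e) x = poisson e x"
proof -
  let ?p = "\<lambda>s. indicator {0<..} s * exp (- ((of_real e + \<i> * of_real x) * of_real s))"
  let ?m = "\<lambda>s. indicator {0<..} s * exp (- ((of_real e - \<i> * of_real x) * of_real s))"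
  have p: "integrable lborel ?p" "(LINT s|lborel. ?p s) = 1 / (of_real e + \<i> * of_real x)"
    using integrable_exp_half_line[of "of_real e + \<i> * of_real x"]
      integral_exp_half_line[of "of_real e + \<i> * of_real x"] e by simp_all
  have m: "integrable lborel ?m" "(LINT s|lborel. ?m s) = 1 / (of_real e - \<i> * of_real x)"
    using integrable_exp_half_line[of "of_real e - \<i> * of_real x"]
      integral_exp_half_line[of "of_real e - \<i> * of_real x"] e by simp_all
  have m': "integrable lborel (\<lambda>s. ?m (- s))" "(LINT s|lborel. ?m (- s)) = 1 / (of_real e - \<i> * of_real x)"
    using lborel_integrable_real_affine[OF m(1), of "-1" 0] lborel_integral_real_affine[of "-1" ?m 0] m(2)
    by simp_all
  have meas: "(\<lambda>s. abel_factor e s * exp (- (\<i> * of_real s * of_real x))) \<in> borel_measurable lborel"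
    "(\<lambda>s. ?p s + ?m (- s)) \<in> borel_measurable lborel"
    using p(1) m'(1) by auto
  have i: "integrable lborel (\<lambda>s. abel_factor e s * exp (- (\<i> * of_real s * of_real x)))"
    unfolding integrable_cong_AE[OF meas abel_split[of e x]] using p(1) m'(1) by simp
  have "(LINT s|lborel. abel_factor e s * exp (- (\<i> * of_real s * of_real x))) = (LINT s|lborel. ?p s + ?m (- s))"
    by (rule integral_cong_AE[OF meas abel_split])
  also have "\<dots> = 1 / (of_real e + \<i> * of_real x) + 1 / (of_real e - \<i> * of_real x)"
    using p m' by simp
  also have "\<dots> = of_real (2 * e / (e\<^sup>2 + x\<^sup>2))"
  proof -
    have ne: "of_real e + \<i> * of_real x \<noteq> 0" "of_real e - \<i> * of_real x \<noteq> 0"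
      using e by (auto simp: complex_eq_iff)
    have "(of_real e + \<i> * of_real x) * (of_real e - \<i> * of_real x) = of_real (e\<^sup>2 + x\<^sup>2)"
      by (simp add: algebra_simps power2_eq_square)
    moreover have "1 / (of_real e + \<i> * of_real x) + 1 / (of_real e - \<i> * of_real x) =
        of_real (2 * e) / ((of_real e + \<i> * of_real x) * (of_real e - \<i> * of_real x))"
      using ne by (simp add: add_frac_eq)
    ultimately show ?thesis by simp
  qed
  finally have I: "(LINT s|lborel. abel_factor e s * exp (- (\<i> * of_real s * of_real x))) = of_real (2 * e / (e\<^sup>2 + x\<^sup>2))" .
  have c: "complex_of_real (sqrt (2 * pi)) * complex_of_real (sqrt (2 * pi)) = of_real (2 * pi)"
    unfolding of_real_mult[symmetric] by simp
  have J: "1 / complex_of_real (sqrt (2 * pi)) * (1 / of_real (sqrt (2 * pi)) * of_real r) = of_real (r / (2 * pi))" for r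
  proof -
    have "1 / complex_of_real (sqrt (2 * pi)) * (1 / of_real (sqrt (2 * pi)) * of_real r) =
        of_real r / (complex_of_real (sqrt (2 * pi)) * complex_of_real (sqrt (2 * pi)))"
      by (simp only: times_divide_times_eq mult_1_left mult_1_right times_divide_eq_left divide_divide_eq_left)
    then show ?thesis unfolding c by simp
  qed
  have "2 * e / (e\<^sup>2 + x\<^sup>2) / (2 * pi) = e / (pi * (e\<^sup>2 + x\<^sup>2))"
    by (simp add: mult.commute)
  then show "1 / of_real (sqrt (2 * pi)) * FT (abel_factor e) x = poisson e x"
    unfolding FT_def I J poisson_def by (simp only:)
  show "integrable lborel (abel_factor e)"
  proof -
    have "integrable lborel (\<lambda>s. exp (\<i> * of_real s * of_real x) * (abel_factor e s * exp (- (\<i> * of_real s * of_real x))))"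
      by (rule integrable_bounded_mult[OF i, where B = 1]) auto
    then show ?thesis by (simp add: exp_minus mult.left_commute[of "exp _"])
  qed
qed

lemma
  assumes e: "0 < e"
  shows integrable_poisson: "integrable lborel (poisson e)"
    and integral_poisson_le: "(LINT x|lborel. cmod (poisson e x)) \<le> 1"
proof -
  let ?p = "\<lambda>x. e / (pi * (e\<^sup>2 + x\<^sup>2))"
  have pos: "0 < e\<^sup>2 + x\<^sup>2" for x using e by (simp add: add_pos_nonneg)
  have nn: "0 \<le> ?p x" for x using e pos[of x] by simp
  have cm: "cmod (poisson e x) = ?p x" for x
    unfolding poisson_def norm_of_real by (rule abs_of_nonneg[OF nn])
  have half: "(\<integral>\<^sup>+x. ennreal (?p x) * indicator {0..} x \<partial>lborel) = ennreal (1/2 - arctan (0 / e) / pi)"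
  proof (rule nn_integral_FTC_atLeast[where F = "\<lambda>x. arctan (x / e) / pi"])
    show "((\<lambda>x. arctan (x / e) / pi) \<longlongrightarrow> 1/2) at_top"
    proof -
      have "((\<lambda>x. arctan (x / e) / pi) \<longlongrightarrow> (pi/2) / pi) at_top"
      proof (intro tendsto_divide tendsto_const filterlim_compose[OF tendsto_arctan_at_top])
        have "filterlim (\<lambda>x. 1 / e * x) at_top at_top"
          using e by (intro filterlim_tendsto_pos_mult_at_top[OF tendsto_const _ filterlim_ident]) simp
        then show "filterlim (\<lambda>x. x / e) at_top at_top" by simp
      qed simp
      then show ?thesis by simp
    qed
    show "((\<lambda>x. arctan (x / e) / pi) has_real_derivative ?p x) (at x)" for x
    proof -
      have "inverse (1 + (x / e)\<^sup>2) * (1 / e) / pi = ?p x"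
        using e pos[of x] by (simp add: field_simps power2_eq_square)
      then show ?thesis
        using e by (auto intro!: derivative_eq_intros)
    qed
  qed (use nn in auto)
  have "(\<integral>\<^sup>+x. ennreal (?p x) * indicator {..<0} x \<partial>lborel) = (\<integral>\<^sup>+x. ennreal (?p x) * indicator {..<0} (- x) \<partial>lborel)"
    using nn_integral_real_affine[of "\<lambda>x. ennreal (?p x) * indicator {..<0} x" "-1" 0] by simp
  also have "\<dots> \<le> (\<integral>\<^sup>+x. ennreal (?p x) * indicator {0..} x \<partial>lborel)"
    by (intro nn_integral_mono) (auto simp: indicator_def)
  finally have neg: "(\<integral>\<^sup>+x. ennreal (?p x) * indicator {..<0} x \<partial>lborel) \<le> ennreal (1/2)"
    using half by simp
  have "(\<integral>\<^sup>+x. ennreal (?p x) \<partial>lborel) =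
      (\<integral>\<^sup>+x. ennreal (?p x) * indicator {0..} x + ennreal (?p x) * indicator {..<0} x \<partial>lborel)"
    by (intro nn_integral_cong) (auto simp: indicator_def)
  also have "\<dots> = (\<integral>\<^sup>+x. ennreal (?p x) * indicator {0..} x \<partial>lborel) + (\<integral>\<^sup>+x. ennreal (?p x) * indicator {..<0} x \<partial>lborel)"
    by (rule nn_integral_add) auto
  also have "\<dots> \<le> ennreal (1/2) + ennreal (1/2)"
    using half neg by (intro add_mono) auto
  also have "\<dots> = ennreal 1"
    by (subst ennreal_plus[symmetric]) auto
  finally have *: "(\<integral>\<^sup>+x. ennreal (?p x) \<partial>lborel) \<le> ennreal 1" .
  have i: "integrable lborel ?p"
    using * nn by (intro integrableI_nonneg) (auto simp: less_top[symmetric] top_unique)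
  then show ip: "integrable lborel (poisson e)"
    unfolding poisson_def[abs_def] by (simp only: integrable_of_real)
  have "ennreal (LINT x|lborel. ?p x) \<le> ennreal 1"
    using * by (subst (asm) nn_integral_eq_integral[OF i]) (use nn in auto)
  then show "(LINT x|lborel. cmod (poisson e x)) \<le> 1"
    unfolding cm by (subst (asm) ennreal_le_iff) auto
qed

lemma integrable_abel_mult_FT:
  assumes e: "0 < e" and f: "integrable lborel f"
  shows "integrable lborel (\<lambda>s. abel_factor e s * FT f s)"
proof -
  have "integrable lborel (\<lambda>s. FT f s * abel_factor e s)"
    by (rule integrable_bounded_mult[OF integrable_abel[OF e] _ cmod_FT_le])
       (use f in \<open>simp add: FT_borel\<close>)
  then show ?thesis by (simp add: mult.commute)
qed

text \<open>
  Transforming back a damped Fourier transform amounts to convolution with the Poisson kernel: apply the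
  multiplication formula to \<open>f\<close> and to the damping factor modulated by \<open>exp (\<i> s x)\<close>.
\<close>

lemma FT_abel_FT:
  assumes e: "0 < e" and f: "integrable lborel f"
  shows "FT (\<lambda>s. abel_factor e s * FT f s) (- x) = convol (poisson e) f x"
proof -
  let ?c = "1 / complex_of_real (sqrt (2 * pi))"
  define h where "h s = abel_factor e s * exp (\<i> * of_real s * of_real x)" for s
  have h: "integrable lborel h"
  proof -
    have "integrable lborel (\<lambda>s. exp (\<i> * of_real s * of_real x) * abel_factor e s)"
      by (rule integrable_bounded_mult[OF integrable_abel[OF e], where B = 1]) auto
    then show ?thesis by (simp add: h_def[abs_def] mult.commute)
  qed
  have FTh: "FT h y = FT (abel_factor e) (y - x)" for y
  proof -
    have "h s * exp (- (\<i> * of_real s * of_real y)) = abel_factor e s * exp (- (\<i> * of_real s * of_real (y - x)))" for s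
      by (simp add: h_def mult.assoc exp_add[symmetric] algebra_simps)
    then show ?thesis by (simp add: FT_def)
  qed
  have "(\<lambda>s. abel_factor e s * FT f s * exp (- (\<i> * of_real s * of_real (- x)))) = (\<lambda>s. FT f s * h s)"
    by (simp add: h_def fun_eq_iff)
  then have "FT (\<lambda>s. abel_factor e s * FT f s) (- x) = ?c * (LINT s|lborel. FT f s * h s)"
    unfolding FT_def[of "\<lambda>s. abel_factor e s * FT f s"] by (simp only:)
  also have "\<dots> = (LINT y|lborel. f y * (?c * FT h y))"
    by (simp add: FT_multiplication_formula[OF f h] mult.left_commute)
  also have "\<dots> = (LINT y|lborel. f y * poisson e (y - x))"
    by (simp only: FTh FT_abel[OF e])
  also have "\<dots> = (LINT w|lborel. f (x - w) * poisson e (- w))"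
    using lborel_integral_real_affine[of "-1" "\<lambda>y. f y * poisson e (y - x)" x] by simp
  also have "\<dots> = convol (poisson e) f x"
    by (simp add: convol_def poisson_def mult.commute)
  finally show ?thesis .
qed

text \<open>
  Half of Plancherel's theorem. By the multiplication formula, \<open>\<integral> exp (- e |s|) |FT f|\<^sup>2\<close> is the inner
  product of \<open>f\<close> with its Poisson integral, which is at most the squared norm of \<open>f\<close> by Young's inequality.
  Let \<open>e\<close> tend to zero and use Fatou's lemma.
\<close>

lemma
  assumes f: "integrable lborel f" "square_integrable lborel f"
  shows square_integrable_FT: "square_integrable lborel (FT f)"
    and norm_FT_le: "norm (abs_l2 (FT f) :: real_line l2) \<le> norm (abs_l2 f :: real_line l2)"
proof -
  let ?F = "abs_l2 f :: real_line l2"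
  have [measurable]: "f \<in> borel_measurable borel"
    using f by simp
  \<comment> \<open>half the exponent, as squaring the modulus doubles it\<close>
  have ab: "integrable lborel (\<lambda>s. (cmod (abel_factor (e/2) s * FT f s))\<^sup>2)"
    "(LINT s|lborel. (cmod (abel_factor (e/2) s * FT f s))\<^sup>2) \<le> (norm ?F)\<^sup>2" if e: "0 < e" for e
  proof -
    let ?g = "\<lambda>s. abel_factor e s * FT f s" and ?u = "convol (poisson e) f"
    have g: "integrable lborel ?g" by (rule integrable_abel_mult_FT[OF e f(1)])
    then have gc: "integrable lborel (\<lambda>s. cnj (?g s))" by (simp del: complex_cnj_mult)
    have u: "square_integrable lborel ?u"
      by (rule Young_convol(1)[OF integrable_poisson[OF e] f(2)])
    have eq: "complex_of_real ((cmod (abel_factor (e/2) s * FT f s))\<^sup>2) = FT f s * cnj (?g s)" for s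
    proof -
      have "(exp (- (e/2) * \<bar>s\<bar>))\<^sup>2 = exp (- e * \<bar>s\<bar>)"
        by (simp add: power2_eq_square exp_add[symmetric])
      then have "(cmod (abel_factor (e/2) s * FT f s))\<^sup>2 = exp (- e * \<bar>s\<bar>) * (cmod (FT f s))\<^sup>2"
        by (simp add: norm_mult power_mult_distrib abel_factor_def)
      then show ?thesis
        by (simp add: abel_factor_def complex_norm_square mult.left_commute del: of_real_power)
    qed
    have "integrable lborel (\<lambda>s. FT f s * cnj (?g s))"
      by (rule integrable_bounded_mult[OF gc _ cmod_FT_le]) simp
    then show "integrable lborel (\<lambda>s. (cmod (abel_factor (e/2) s * FT f s))\<^sup>2)"
      unfolding eq[symmetric] complex_of_real_integrable_eq .
    have "complex_of_real (LINT s|lborel. (cmod (abel_factor (e/2) s * FT f s))\<^sup>2) = (LINT s|lborel. FT f s * cnj (?g s))"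
      unfolding eq[symmetric] by (rule integral_complex_of_real[symmetric])
    also have "\<dots> = (LINT x|lborel. f x * FT (\<lambda>s. cnj (?g s)) x)"
      by (rule FT_multiplication_formula[OF f(1) gc])
    also have "\<dots> = (LINT x|lborel. f x * cnj (?u x))"
      by (simp only: FT_cnj FT_abel_FT[OF e f(1)])
    also have "\<dots> = cinner ?F (abs_l2 ?u)"
      by (rule cinner_real_line[OF f(2) u, symmetric])
    finally have "(LINT s|lborel. (cmod (abel_factor (e/2) s * FT f s))\<^sup>2) = ?F \<bullet> abs_l2 ?u"
      by (simp add: cinner_def complex_eq_iff)
    also have "\<dots> \<le> norm ?F * norm (abs_l2 ?u :: real_line l2)"
      by (rule norm_cauchy_schwarz)
    also have "\<dots> \<le> norm ?F * norm ?F"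
    proof (rule mult_left_mono)
      have "norm (abs_l2 ?u :: real_line l2) \<le> (LINT x|lborel. cmod (poisson e x)) * norm ?F"
        by (rule Young_convol(2)[OF integrable_poisson[OF e] f(2)])
      also have "\<dots> \<le> 1 * norm ?F"
        by (rule mult_right_mono[OF integral_poisson_le[OF e]]) simp
      finally show "norm (abs_l2 ?u :: real_line l2) \<le> norm ?F" by simp
    qed simp
    finally show "(LINT s|lborel. (cmod (abel_factor (e/2) s * FT f s))\<^sup>2) \<le> (norm ?F)\<^sup>2"
      by (simp add: power2_eq_square)
  qed
  have sq: "square_integrable lborel (\<lambda>s. abel_factor (1 / real (Suc n) / 2) s * FT f s)" for n
    unfolding square_integrable_def
  proof
    show "(\<lambda>s. abel_factor (1 / real (Suc n) / 2) s * FT f s) \<in> borel_measurable lborel"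
      by simp
    show "integrable lborel (\<lambda>s. (cmod (abel_factor (1 / real (Suc n) / 2) s * FT f s))\<^sup>2)"
      by (rule ab(1)) simp
  qed
  have lim: "(\<lambda>n. abel_factor (1 / real (Suc n) / 2) s * FT f s) \<longlonglongrightarrow> FT f s" for s
  proof -
    have "(\<lambda>n. exp (- (1 / real (Suc n) / 2) * \<bar>s\<bar>)) \<longlonglongrightarrow> exp (- (0 / 2) * \<bar>s\<bar>)"
      by (intro tendsto_intros LIMSEQ_Suc lim_1_over_n) simp
    then have "(\<lambda>n. abel_factor (1 / real (Suc n) / 2) s * FT f s) \<longlonglongrightarrow> of_real (exp (- (0 / 2) * \<bar>s\<bar>)) * FT f s"
      unfolding abel_factor_def by (intro tendsto_mult tendsto_of_real tendsto_const)
    then show ?thesis by simp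
  qed
  have bd: "(LINT s|lborel. (cmod (abel_factor (1 / real (Suc n) / 2) s * FT f s))\<^sup>2) \<le> (norm ?F)\<^sup>2" for n
    by (rule ab(2)) simp
  have FTm: "FT f \<in> borel_measurable lborel" by simp
  note Fatou = square_integrable_Fatou[OF sq FTm AE_I2[OF lim] bd]
  show "square_integrable lborel (FT f)" by (rule Fatou(1))
  then have "(norm (abs_l2 (FT f) :: real_line l2))\<^sup>2 \<le> (norm ?F)\<^sup>2"
    using Fatou(2) by (simp add: norm_real_line_power2)
  then show "norm (abs_l2 (FT f) :: real_line l2) \<le> norm ?F"
    by (rule power2_le_imp_le) simp
qed

section \<open>The Fourier transform as an operator\<close>

text \<open>
  The definition of the Fourier transform refers to a chosen representative. The integral does not
  depend on it, which gives access to Borel representatives.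
\<close>

lemma fourier_truncation_eq:
  assumes g: "square_integrable lborel g"
  shows "(LINT x:{- real n..real n}|lebesgue. rep_l2 (abs_l2 g :: real_line l2) x * exp (- (\<i> * of_real x * of_real s))) =
    (LINT x|lborel. trunc n g x * exp (- (\<i> * of_real x * of_real s)))"
proof -
  let ?r = "rep_l2 (abs_l2 g :: real_line l2)" and ?K = "\<lambda>x. exp (- (\<i> * complex_of_real x * of_real s))"
  have [measurable]: "g \<in> borel_measurable borel"
    by (rule square_integrable_borel[OF g])
  have r: "?r \<in> borel_measurable lebesgue"
    using square_integrable_rep_l2[of "abs_l2 g :: real_line l2"] unfolding l2_real_line square_integrable_def by simp
  have ae: "AE x in lebesgue. ?r x = g x"
    using rep_abs_l2[OF square_integrable_real_line[OF g]] unfolding l2_real_line .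
  have K: "?K \<in> borel_measurable lebesgue"
    by (intro measurable_completion) measurable
  have m: "(\<lambda>x. trunc n g x * ?K x) \<in> borel_measurable lborel"
    by measurable
  have "(LINT x:{- real n..real n}|lebesgue. ?r x * ?K x) = (LINT x|lebesgue. trunc n g x * ?K x)"
    unfolding set_lebesgue_integral_def
  proof (rule integral_cong_AE)
    show "(\<lambda>x. indicator {- real n..real n} x *\<^sub>R (?r x * ?K x)) \<in> borel_measurable lebesgue"
      using r K by (intro borel_measurable_scaleR borel_measurable_times borel_measurable_indicator) auto
    show "(\<lambda>x. trunc n g x * ?K x) \<in> borel_measurable lebesgue"
      using m by (rule measurable_completion)
    show "AE x in lebesgue. indicator {- real n..real n} x *\<^sub>R (?r x * ?K x) = trunc n g x * ?K x"
      using ae by eventually_elim (simp add: trunc_def indicator_def)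
  qed
  also have "\<dots> = (LINT x|lborel. trunc n g x * ?K x)"
    by (rule integral_completion[OF m])
  finally show ?thesis .
qed

text \<open>
  The contraction property turns the convergent truncations into a Cauchy sequence of transforms, so the
  limit in the definition exists.
\<close>

lemma fourier_tendsto:
  assumes g: "square_integrable lborel g"
  shows "(\<lambda>n. abs_l2 (FT (trunc n g))) \<longlonglongrightarrow> fourier (abs_l2 g)"
proof -
  let ?t = "\<lambda>n. abs_l2 (trunc n g) :: real_line l2" and ?X = "\<lambda>n. abs_l2 (FT (trunc n g)) :: real_line l2"
  note sq = square_integrable_FT[OF integrable_trunc[OF g] square_integrable_trunc[OF g]]
  have le: "norm (?X m - ?X n) \<le> norm (?t m - ?t n)" for m n
  proof -
    let ?d = "\<lambda>x. trunc m g x + (- 1) * trunc n g x"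
    have i: "integrable lborel ?d"
      by (intro Bochner_Integration.integrable_add integrable_mult_right integrable_trunc g)
    have s: "square_integrable lborel ?d"
      by (intro square_integrable_add square_integrable_mult_const square_integrable_trunc g)
    have "integrable lborel (\<lambda>x. (- 1) * trunc n g x)"
      by (intro integrable_mult_right integrable_trunc g)
    from FT_add[OF integrable_trunc[OF g] this] have "FT ?d = (\<lambda>s. FT (trunc m g) s - FT (trunc n g) s)"
      unfolding FT_cmult by simp
    then have "?X m - ?X n = abs_l2 (FT ?d)"
      by (simp only: abs_l2_diff square_integrable_real_line sq)
    moreover have "?t m - ?t n = abs_l2 ?d"
      by (simp add: abs_l2_diff square_integrable_real_line square_integrable_trunc[OF g])
    ultimately show ?thesis
      using norm_FT_le[OF i s] by simp
  qed
  have "Cauchy ?t"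
    by (rule LIMSEQ_imp_Cauchy[OF abs_l2_trunc_tendsto[OF g]])
  then have "Cauchy ?X"
    unfolding Cauchy_iff by (meson le le_less_trans)
  then have "convergent ?X"
    by (simp add: Cauchy_convergent_iff)
  then have "?X \<longlonglongrightarrow> lim ?X"
    by (simp add: convergent_LIMSEQ_iff)
  moreover have "fourier (abs_l2 g) = lim ?X"
    unfolding fourier_def fourier_truncation_eq[OF g] FT_def[abs_def] ..
  ultimately show ?thesis by simp
qed

text \<open>
  For integrable functions the transforms of the truncations also converge pointwise.
\<close>

lemma fourier_abs_l2_L1:
  assumes g: "integrable lborel g" "square_integrable lborel g"
  shows "fourier (abs_l2 g) = abs_l2 (FT g)"
proof (rule l2_limit_eq_AE_limit(2)[OF _ _ _ fourier_tendsto[OF g(2)]])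
  have gm [measurable]: "g \<in> borel_measurable borel"
    using g by simp
  show "square_integrable (l2_measure TYPE(real_line)) (FT (trunc n g))" for n
    by (intro square_integrable_real_line square_integrable_FT integrable_trunc square_integrable_trunc g)
  show "FT g \<in> borel_measurable (l2_measure TYPE(real_line))"
    by (intro real_line_borel_measurable FT_borel gm)
  show "AE s in l2_measure TYPE(real_line). (\<lambda>n. FT (trunc n g) s) \<longlonglongrightarrow> FT g s"
  proof (rule AE_I2)
    fix s
    let ?K = "\<lambda>x. exp (- (\<i> * complex_of_real x * of_real s))"
    have "(\<lambda>n. LINT x|lborel. trunc n g x * ?K x) \<longlonglongrightarrow> (LINT x|lborel. g x * ?K x)"
    proof (rule integral_dominated_convergence[where w = "\<lambda>x. cmod (g x)"])
      show "AE x in lborel. (\<lambda>n. trunc n g x * ?K x) \<longlonglongrightarrow> g x * ?K x"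
        by (intro AE_I2 tendsto_mult tendsto_const trunc_tendsto)
      show "AE x in lborel. norm (trunc n g x * ?K x) \<le> cmod (g x)" for n
        by (simp add: norm_mult cmod_trunc_le)
    qed (use g in auto)
    then show "(\<lambda>n. FT (trunc n g) s) \<longlonglongrightarrow> FT g s"
      unfolding FT_def by (intro tendsto_mult tendsto_const)
  qed
qed

lemma trunc_add: "trunc n (\<lambda>x. f x + g x) = (\<lambda>x. trunc n f x + trunc n g x)"
  by (simp add: trunc_def fun_eq_iff distrib_left)

lemma trunc_cmult: "trunc n (\<lambda>x. c * f x) = (\<lambda>x. c * trunc n f x)"
  by (simp add: trunc_def fun_eq_iff mult.left_commute)

lemma fourier_add: "fourier (F + G) = fourier F + fourier G"
proof -
  obtain f where f: "square_integrable lborel f" "F = abs_l2 f" by (rule real_line_borel_cases)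
  obtain g where g: "square_integrable lborel g" "G = abs_l2 g" by (rule real_line_borel_cases)
  have "(\<lambda>n. abs_l2 (FT (trunc n (\<lambda>x. f x + g x)))) \<longlonglongrightarrow> fourier (abs_l2 (\<lambda>x. f x + g x))"
    by (intro fourier_tendsto square_integrable_add f g)
  moreover have "abs_l2 (FT (trunc n (\<lambda>x. f x + g x))) = (abs_l2 (FT (trunc n f)) + abs_l2 (FT (trunc n g)) :: real_line l2)" for n
    using f g by (simp add: trunc_add FT_add abs_l2_add square_integrable_real_line
        square_integrable_FT integrable_trunc square_integrable_trunc)
  moreover have "(\<lambda>n. abs_l2 (FT (trunc n f)) + abs_l2 (FT (trunc n g))) \<longlonglongrightarrow> fourier F + fourier G"
    unfolding f(2) g(2) by (intro tendsto_add fourier_tendsto f g)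
  ultimately show ?thesis
    using LIMSEQ_unique f g by (simp add: abs_l2_add square_integrable_real_line)
qed

lemma bounded_linear_scaleC: "bounded_linear (scaleC c :: 'd::l2_domain l2 \<Rightarrow> _)"
  by (rule bounded_linear_intro[where K = "cmod c"])
     (simp_all add: l2.scale_right_distrib scaleR_scaleC l2.scale_left_commute norm_scaleC)

lemma fourier_scaleC: "fourier (scaleC c F) = scaleC c (fourier F)"
proof -
  obtain f where f: "square_integrable lborel f" "F = abs_l2 f" by (rule real_line_borel_cases)
  have "(\<lambda>n. abs_l2 (FT (trunc n (\<lambda>x. c * f x)))) \<longlonglongrightarrow> fourier (abs_l2 (\<lambda>x. c * f x))"
    by (intro fourier_tendsto square_integrable_mult_const f)
  moreover have "abs_l2 (FT (trunc n (\<lambda>x. c * f x))) = (scaleC c (abs_l2 (FT (trunc n f))) :: real_line l2)" for n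
    using f by (simp add: trunc_cmult FT_cmult abs_l2_scaleC square_integrable_real_line
        square_integrable_FT integrable_trunc square_integrable_trunc)
  moreover have "(\<lambda>n. scaleC c (abs_l2 (FT (trunc n f)))) \<longlonglongrightarrow> scaleC c (fourier F)"
    unfolding f(2) by (intro bounded_linear.tendsto[OF bounded_linear_scaleC] fourier_tendsto f)
  ultimately show ?thesis
    using LIMSEQ_unique f by (simp add: abs_l2_scaleC square_integrable_real_line)
qed

lemma norm_fourier_le: "norm (fourier F) \<le> norm F"
proof -
  obtain f where f: "square_integrable lborel f" "F = abs_l2 f" by (rule real_line_borel_cases)
  show ?thesis
  proof (rule LIMSEQ_le)
    show "(\<lambda>n. norm (abs_l2 (FT (trunc n f)) :: real_line l2)) \<longlonglongrightarrow> norm (fourier F)"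
      unfolding f(2) by (intro tendsto_norm fourier_tendsto f)
    show "(\<lambda>n. norm (abs_l2 (trunc n f) :: real_line l2)) \<longlonglongrightarrow> norm F"
      unfolding f(2) by (intro tendsto_norm abs_l2_trunc_tendsto f)
  qed (use f in \<open>auto intro!: norm_FT_le integrable_trunc square_integrable_trunc\<close>)
qed

lemma bounded_linear_fourier: "bounded_linear fourier"
  by (rule bounded_linear_intro[where K = 1])
     (simp_all add: fourier_add scaleR_scaleC fourier_scaleC norm_fourier_le)

section \<open>Reflection and conjugation\<close>

text \<open>
  A square integrable Borel representative is selected because reflecting it is trivially measurable.
\<close>

definition reflect_l2 :: "real_line l2 \<Rightarrow> real_line l2" where
  "reflect_l2 F = abs_l2 (\<lambda>x. (SOME f. square_integrable lborel f \<and> F = abs_l2 f) (- x))"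

lemma AE_lborel_reflect:
  assumes "AE x in lborel. P (x::real)"
  shows "AE x in lborel. P (- x)"
proof -
  obtain N where N: "N \<in> null_sets lborel" "{x \<in> space lborel. \<not> P x} \<subseteq> N"
    using assms unfolding eventually_ae_filter by blast
  have "AE x in distr lborel borel uminus. x \<notin> N"
    unfolding lborel_distr_uminus using N(1) by (rule AE_not_in)
  then have "AE x in lborel. - x \<notin> N"
    using AE_distrD[of uminus lborel borel "\<lambda>x. x \<notin> N"] by simp
  then show ?thesis
    using N(2) by (auto elim!: eventually_mono)
qed

lemma square_integrable_reflect:
  "square_integrable lborel g \<Longrightarrow> square_integrable lborel (\<lambda>x. g (- x :: real))"
  using square_integrable_shift[of g 0] by simp

lemma reflect_abs_l2:
  assumes f: "square_integrable lborel f"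
  shows "reflect_l2 (abs_l2 f) = abs_l2 (\<lambda>x. f (- x))"
proof -
  define g where "g = (SOME g. square_integrable lborel g \<and> (abs_l2 f :: real_line l2) = abs_l2 g)"
  have "square_integrable lborel g \<and> (abs_l2 f :: real_line l2) = abs_l2 g"
    unfolding g_def by (rule someI[of "\<lambda>g. square_integrable lborel g \<and> (abs_l2 f :: real_line l2) = abs_l2 g" f]) (simp add: f)
  then have g: "square_integrable lborel g" "(abs_l2 f :: real_line l2) = abs_l2 g" by auto
  have "AE x in lborel. f x = g x"
    using g(2) unfolding abs_l2_eq_iff[OF square_integrable_real_line[OF f] square_integrable_real_line[OF g(1)]]
      l2_real_line AE_completion_iff .
  from AE_lborel_reflect[OF this] have "AE x in l2_measure TYPE(real_line). f (- x) = g (- x)"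
    unfolding l2_real_line by (rule AE_completion)
  then have "(abs_l2 (\<lambda>x. f (- x)) :: real_line l2) = abs_l2 (\<lambda>x. g (- x))"
    by (simp add: abs_l2_eq_iff square_integrable_real_line square_integrable_reflect f g)
  then show ?thesis by (simp add: reflect_l2_def g_def)
qed

lemma bounded_linear_reflect_l2: "bounded_linear reflect_l2"
  and reflect_l2_scaleC: "reflect_l2 (scaleC c F) = scaleC c (reflect_l2 F)"
  and norm_reflect_l2: "norm (reflect_l2 F) = norm F"
  and reflect_l2_reflect_l2: "reflect_l2 (reflect_l2 F) = F"
proof -
  show sc: "reflect_l2 (scaleC c F) = scaleC c (reflect_l2 F)" for c F
  proof -
    obtain f where f: "square_integrable lborel f" "F = abs_l2 f" by (rule real_line_borel_cases)
    then show ?thesis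
      by (simp add: abs_l2_scaleC square_integrable_real_line reflect_abs_l2 square_integrable_reflect
          square_integrable_mult_const)
  qed
  show nm: "norm (reflect_l2 F) = norm F" for F
  proof -
    obtain f where f: "square_integrable lborel f" "F = abs_l2 f" by (rule real_line_borel_cases)
    have "(norm (reflect_l2 F))\<^sup>2 = (norm F)\<^sup>2"
      using f lborel_integral_real_affine[of "-1" "\<lambda>x. (cmod (f x))\<^sup>2" 0]
      by (simp add: reflect_abs_l2 norm_real_line_power2 square_integrable_reflect)
    then show ?thesis by simp
  qed
  show "reflect_l2 (reflect_l2 F) = F"
  proof -
    obtain f where f: "square_integrable lborel f" "F = abs_l2 f" by (rule real_line_borel_cases)
    then show ?thesis by (simp add: reflect_abs_l2 square_integrable_reflect)
  qed
  show "bounded_linear reflect_l2"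
  proof (rule bounded_linear_intro[where K = 1])
    fix F G :: "real_line l2"
    obtain f where f: "square_integrable lborel f" "F = abs_l2 f" by (rule real_line_borel_cases)
    obtain g where g: "square_integrable lborel g" "G = abs_l2 g" by (rule real_line_borel_cases)
    show "reflect_l2 (F + G) = reflect_l2 F + reflect_l2 G"
      using f g by (simp add: abs_l2_add square_integrable_real_line reflect_abs_l2 square_integrable_reflect
          square_integrable_add)
  qed (simp_all add: scaleR_scaleC sc nm)
qed

lemma trunc_reflect: "trunc n (\<lambda>x. f (- x)) = (\<lambda>x. trunc n f (- x))"
  by (auto simp: trunc_def fun_eq_iff indicator_def)

lemma fourier_reflect_l2: "fourier (reflect_l2 F) = reflect_l2 (fourier F)"
proof -
  obtain f where f: "square_integrable lborel f" "F = abs_l2 f" by (rule real_line_borel_cases)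
  have "(\<lambda>n. abs_l2 (FT (trunc n (\<lambda>x. f (- x))))) \<longlonglongrightarrow> fourier (abs_l2 (\<lambda>x. f (- x)))"
    by (intro fourier_tendsto square_integrable_reflect f)
  moreover have "abs_l2 (FT (trunc n (\<lambda>x. f (- x)))) = reflect_l2 (abs_l2 (FT (trunc n f)))" for n
    using f by (simp add: trunc_reflect FT_reflect reflect_abs_l2
        square_integrable_FT integrable_trunc square_integrable_trunc)
  moreover have "(\<lambda>n. reflect_l2 (abs_l2 (FT (trunc n f)))) \<longlonglongrightarrow> reflect_l2 (fourier F)"
    unfolding f(2) by (intro bounded_linear.tendsto[OF bounded_linear_reflect_l2] fourier_tendsto f)
  ultimately show ?thesis
    using LIMSEQ_unique f by (simp add: reflect_abs_l2)
qed

definition cnj_l2 :: "real_line l2 \<Rightarrow> real_line l2" where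
  "cnj_l2 F = abs_l2 (\<lambda>x. cnj (rep_l2 F x))"

lemma cnj_abs_l2:
  assumes f: "square_integrable lborel f"
  shows "cnj_l2 (abs_l2 f) = abs_l2 (\<lambda>x. cnj (f x))"
  unfolding cnj_l2_def
proof (rule abs_l2_cong_AE)
  show "square_integrable (l2_measure TYPE(real_line)) (\<lambda>x. cnj (rep_l2 (abs_l2 f :: real_line l2) x))"
    by (intro square_integrable_cnj square_integrable_rep_l2)
  show "(\<lambda>x. cnj (f x)) \<in> borel_measurable (l2_measure TYPE(real_line))"
    using square_integrable_cnj[OF square_integrable_real_line[OF f]] by (simp add: square_integrable_def)
  show "AE x in l2_measure TYPE(real_line). cnj (rep_l2 (abs_l2 f :: real_line l2) x) = cnj (f x)"
    using rep_abs_l2[OF square_integrable_real_line[OF f]] by eventually_elim simp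
qed

lemma norm_cnj_l2_diff: "norm (cnj_l2 F - cnj_l2 G) = norm (F - G)"
proof -
  obtain f where f: "square_integrable lborel f" "F = abs_l2 f" by (rule real_line_borel_cases)
  obtain g where g: "square_integrable lborel g" "G = abs_l2 g" by (rule real_line_borel_cases)
  have "(norm (cnj_l2 F - cnj_l2 G))\<^sup>2 = (norm (F - G))\<^sup>2"
    using f g
    by (simp add: cnj_abs_l2 abs_l2_diff square_integrable_real_line square_integrable_cnj norm_real_line_power2
        square_integrable_diff flip: complex_cnj_diff)
  then show ?thesis by simp
qed

lemma trunc_cnj: "trunc n (\<lambda>x. cnj (f x)) = (\<lambda>x. cnj (trunc n f x))"
  by (auto simp: trunc_def fun_eq_iff indicator_def)

lemma fourier_cnj_l2: "fourier (cnj_l2 F) = reflect_l2 (cnj_l2 (fourier F))"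
proof -
  obtain f where f: "square_integrable lborel f" "F = abs_l2 f" by (rule real_line_borel_cases)
  have "(\<lambda>n. abs_l2 (FT (trunc n (\<lambda>x. cnj (f x))))) \<longlonglongrightarrow> fourier (abs_l2 (\<lambda>x. cnj (f x)))"
    by (intro fourier_tendsto square_integrable_cnj f)
  moreover have "abs_l2 (FT (trunc n (\<lambda>x. cnj (f x)))) = reflect_l2 (cnj_l2 (abs_l2 (FT (trunc n f))))" for n
    using f by (simp add: trunc_cnj FT_cnj reflect_abs_l2 cnj_abs_l2 square_integrable_cnj
        square_integrable_FT integrable_trunc square_integrable_trunc)
  moreover have "(\<lambda>n. reflect_l2 (cnj_l2 (abs_l2 (FT (trunc n f))))) \<longlonglongrightarrow> reflect_l2 (cnj_l2 (fourier F))"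
  proof (rule bounded_linear.tendsto[OF bounded_linear_reflect_l2])
    have "(\<lambda>n. norm (abs_l2 (FT (trunc n f)) - fourier F)) \<longlonglongrightarrow> 0"
      unfolding f(2) using fourier_tendsto[OF f(1)] by (intro tendsto_norm_zero LIM_zero)
    then have "(\<lambda>n. norm (cnj_l2 (abs_l2 (FT (trunc n f))) - cnj_l2 (fourier F))) \<longlonglongrightarrow> 0"
      by (simp add: norm_cnj_l2_diff)
    then show "(\<lambda>n. cnj_l2 (abs_l2 (FT (trunc n f)))) \<longlonglongrightarrow> cnj_l2 (fourier F)"
      by (rule LIM_zero_cancel[OF tendsto_norm_zero_cancel])
  qed
  ultimately show ?thesis
    using LIMSEQ_unique f by (simp add: cnj_abs_l2)
qed

section \<open>Fourier inversion\<close>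

text \<open>
  The Poisson integral of the indicator of an interval is elementary. It is the seed of the
  inversion theorem.
\<close>

lemma convol_poisson_indicator:
  assumes "a \<le> b" "0 < e"
  shows "convol (poisson e) (indicator {a..b}) x = of_real ((arctan ((x - a) / e) - arctan ((x - b) / e)) / pi)"
proof -
  let ?p = "\<lambda>x. e / (pi * (e\<^sup>2 + x\<^sup>2))"
  have pos: "0 < e\<^sup>2 + x\<^sup>2" for x using assms(2) by (simp add: add_pos_nonneg)
  have "convol (poisson e) (indicator {a..b}) x = (LINT w|lborel. of_real (?p w * indicator {x - b..x - a} w))"
    unfolding convol_def poisson_def
    by (intro Bochner_Integration.integral_cong) (auto simp: indicator_def)
  also have "\<dots> = of_real (LINT w|lborel. ?p w * indicator {x - b..x - a} w)"
    by (rule integral_complex_of_real)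
  also have "(LINT w|lborel. ?p w * indicator {x - b..x - a} w) = arctan ((x - a) / e) / pi - arctan ((x - b) / e) / pi"
  proof (rule integral_FTC_Icc_nonneg[where F = "\<lambda>x. arctan (x / e) / pi"])
    show "((\<lambda>x. arctan (x / e) / pi) has_real_derivative ?p y) (at y)" for y
    proof -
      have "inverse (1 + (y / e)\<^sup>2) * (1 / e) / pi = ?p y"
        using assms(2) pos[of y] by (simp add: field_simps power2_eq_square)
      then show ?thesis
        using assms(2) by (auto intro!: derivative_eq_intros)
    qed
    show "0 \<le> ?p y" for y using assms(2) pos[of y] by simp
  qed (use assms in auto)
  finally show ?thesis by (simp add: diff_divide_distrib)
qed

lemma arctan_mult_Suc_tendsto:
  "(\<lambda>n. arctan (c * real (Suc n))) \<longlonglongrightarrow> sgn c * (pi / 2)"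
proof -
  have S: "filterlim (\<lambda>n. real (Suc n)) at_top sequentially"
    by (rule filterlim_compose[OF filterlim_real_sequentially filterlim_Suc])
  consider "c = 0" | "c > 0" | "c < 0" by linarith
  then show ?thesis
  proof cases
    case 2
    then have "filterlim (\<lambda>n. c * real (Suc n)) at_top sequentially"
      by (intro filterlim_tendsto_pos_mult_at_top[OF tendsto_const _ S])
    from filterlim_compose[OF tendsto_arctan_at_top this] show ?thesis using 2 by simp
  next
    case 3
    then have "filterlim (\<lambda>n. c * real (Suc n)) at_bot sequentially"
      by (intro filterlim_tendsto_neg_mult_at_bot[OF tendsto_const _ S])
    from filterlim_compose[OF tendsto_arctan_at_bot this] show ?thesis using 3 by simp
  qed simp
qed

text \<open>
  Damp the transform of the indicator by \<open>exp (- e |s|)\<close>. As \<open>e\<close> tends to zero this converges in \<open>L\<^sup>2\<close> to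
  the transform, so the transforms back converge in \<open>L\<^sup>2\<close>; but these are the Poisson integrals, which converge
  to the indicator except at the end points.
\<close>

lemma fourier_inversion_indicator:
  assumes ab: "a \<le> b"
  shows "reflect_l2 (fourier (fourier (abs_l2 (indicator {a..b})))) = abs_l2 (indicator {a..b})"
proof -
  let ?f = "indicator {a..b} :: real \<Rightarrow> complex"
  define e where "e n = 1 / real (Suc n)" for n
  have e: "0 < e n" for n by (simp add: e_def)
  have fs: "square_integrable lborel ?f" by (rule square_integrable_indicator)
  have "(\<lambda>x. ?f x * ?f x) = ?f"
    by (auto simp: fun_eq_iff indicator_def)
  with square_integrable_mult[OF fs fs] have fi: "integrable lborel ?f"
    by simp
  have Fs: "square_integrable lborel (FT ?f)" by (rule square_integrable_FT[OF fi fs])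
  have Fb: "FT ?f \<in> borel_measurable borel" by (rule square_integrable_borel[OF Fs])
  let ?g = "\<lambda>n s. abel_factor (e n) s * FT ?f s"
  have gi: "integrable lborel (?g n)" for n by (rule integrable_abel_mult_FT[OF e fi])
  have lim: "(\<lambda>n. ?g n s) \<longlonglongrightarrow> FT ?f s" for s
  proof -
    have "(\<lambda>n. exp (- e n * \<bar>s\<bar>)) \<longlonglongrightarrow> exp (- 0 * \<bar>s\<bar>)"
      unfolding e_def by (intro tendsto_intros LIMSEQ_Suc lim_1_over_n)
    then have "(\<lambda>n. ?g n s) \<longlonglongrightarrow> of_real (exp (- 0 * \<bar>s\<bar>)) * FT ?f s"
      unfolding abel_factor_def by (intro tendsto_mult tendsto_of_real tendsto_const)
    then show ?thesis by simp
  qed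
  have dom: "cmod (?g n s) \<le> cmod (FT ?f s)" for n s
    using e[of n] by (simp add: norm_mult abel_factor_def mult_left_le_one_le)
  have gb: "?g n \<in> borel_measurable borel" for n
    using gi by simp
  note dc = l2_dominated_convergence[OF gb Fb Fs AE_I2[OF lim] dom]
  have "(\<lambda>n. reflect_l2 (fourier (abs_l2 (?g n)))) \<longlonglongrightarrow> reflect_l2 (fourier (abs_l2 (FT ?f)))"
    by (intro bounded_linear.tendsto[OF bounded_linear_reflect_l2] bounded_linear.tendsto[OF bounded_linear_fourier] dc(3))
  moreover have "reflect_l2 (fourier (abs_l2 (?g n))) = abs_l2 (convol (poisson (e n)) ?f)" for n
    by (simp add: fourier_abs_l2_L1[OF gi dc(1)] reflect_abs_l2 square_integrable_FT[OF gi dc(1)] FT_abel_FT[OF e fi])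
  ultimately have L: "(\<lambda>n. abs_l2 (convol (poisson (e n)) ?f)) \<longlonglongrightarrow> reflect_l2 (fourier (abs_l2 (FT ?f)))"
    by simp
  have "reflect_l2 (fourier (abs_l2 (FT ?f))) = abs_l2 ?f"
  proof (rule l2_limit_eq_AE_limit(2)[OF _ _ _ L])
    show "square_integrable (l2_measure TYPE(real_line)) (convol (poisson (e n)) ?f)" for n
      by (intro square_integrable_real_line Young_convol integrable_poisson e fs)
    show "?f \<in> borel_measurable (l2_measure TYPE(real_line))"
      by (intro real_line_borel_measurable) simp
    have "AE x in lborel. (\<lambda>n. convol (poisson (e n)) ?f x) \<longlonglongrightarrow> ?f x"
      using AE_lborel_singleton[of a] AE_lborel_singleton[of b]
    proof eventually_elim
      case (elim x)
      have "(\<lambda>n. complex_of_real ((arctan ((x - a) * real (Suc n)) - arctan ((x - b) * real (Suc n))) / pi)) \<longlonglongrightarrow>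
          complex_of_real ((sgn (x - a) * (pi / 2) - sgn (x - b) * (pi / 2)) / pi)"
        by (intro tendsto_of_real tendsto_divide tendsto_diff arctan_mult_Suc_tendsto tendsto_const) simp
      moreover have "complex_of_real ((sgn (x - a) * (pi / 2) - sgn (x - b) * (pi / 2)) / pi) = ?f x"
        using elim ab by (auto simp: sgn_if indicator_def field_simps)
      ultimately show ?case
        by (simp add: convol_poisson_indicator[OF ab e]) (simp add: e_def)
    qed
    then show "AE x in l2_measure TYPE(real_line). (\<lambda>n. convol (poisson (e n)) ?f x) \<longlonglongrightarrow> ?f x"
      unfolding l2_real_line by (rule AE_completion)
  qed
  then show ?thesis by (simp add: fourier_abs_l2_L1[OF fi fs])
qed

text \<open>
  The classes for which the formula holds form a closed subspace that contains the indicators of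
  intervals.
\<close>

theorem fourier_inversion: "reflect_l2 (fourier (fourier F)) = F"
proof -
  let ?T = "\<lambda>F. reflect_l2 (fourier (fourier F))"
  have T: "bounded_linear ?T"
    by (intro bounded_linear_compose[OF bounded_linear_reflect_l2] bounded_linear_compose[OF bounded_linear_fourier]
        bounded_linear_fourier)
  have "{F. ?T F = F} = UNIV"
  proof (rule closed_subspace_with_intervals_eq_UNIV)
    show "closed {F. ?T F = F}"
      by (intro closed_Collect_eq continuous_on_id linear_continuous_on T)
    show "l2.subspace {F. ?T F = F}"
      by (auto simp: l2.subspace_def linear_0[OF bounded_linear.linear[OF T]]
          linear_add[OF bounded_linear.linear[OF T]] fourier_scaleC reflect_l2_scaleC)
    show "abs_l2 (indicator {a..b}) \<in> {F. ?T F = F}" for a b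
    proof (cases "a \<le> b")
      case False
      then have "indicator {a..b} = (\<lambda>x. 0 :: complex)" by (auto simp: indicator_def)
      then show ?thesis by (simp add: abs_l2_zero linear_0[OF bounded_linear.linear[OF T]])
    qed (simp add: fourier_inversion_indicator)
  qed
  then show ?thesis by blast
qed

text \<open>
  A contraction whose square is, up to reflection, the identity is an isometry.
\<close>

lemma norm_fourier: "norm (fourier F) = norm F"
proof (rule antisym[OF norm_fourier_le])
  have "norm F = norm (fourier (fourier F))"
    by (metis fourier_inversion norm_reflect_l2)
  also have "\<dots> \<le> norm (fourier F)" by (rule norm_fourier_le)
  finally show "norm F \<le> norm (fourier F)" .
qed

lemma bij_fourier: "bij fourier"
proof (rule o_bij)
  show "(\<lambda>F. reflect_l2 (fourier F)) \<circ> fourier = id"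
    by (simp add: fun_eq_iff fourier_inversion)
  show "fourier \<circ> (\<lambda>F. reflect_l2 (fourier F)) = id"
    by (simp add: fun_eq_iff fourier_inversion fourier_reflect_l2)
qed

text \<open>
  For the truncations of \<open>g\<close> this is the convolution theorem for integrable functions; both sides are
  continuous in \<open>g\<close>.
\<close>

theorem fourier_convol:
  assumes k: "integrable lborel k" "square_integrable lborel k" and g: "square_integrable lborel g"
  shows "fourier (abs_l2 (convol k g)) = mult_l2 (\<lambda>s. of_real (sqrt (2 * pi)) * FT k s) (fourier (abs_l2 g))"
proof -
  let ?m = "\<lambda>s. of_real (sqrt (2 * pi)) * FT k s"
  have [measurable]: "k \<in> borel_measurable borel" using k by simp
  have m: "?m \<in> borel_measurable (l2_measure TYPE(real_line))"
    by (intro real_line_borel_measurable) measurable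
  have B: "cmod (?m s) \<le> (LINT x|lborel. cmod (k x))" for s
  proof -
    have "cmod (?m s) = sqrt (2 * pi) * cmod (FT k s)" by (simp add: norm_mult)
    also have "\<dots> \<le> sqrt (2 * pi) * (1 / sqrt (2 * pi) * (LINT x|lborel. cmod (k x)))"
      by (intro mult_left_mono cmod_FT_le) simp
    finally show ?thesis by simp
  qed
  have bl: "bounded_linear (mult_l2 ?m :: real_line l2 \<Rightarrow> _)"
    by (rule bounded_linear_mult_l2[OF m AE_I2[OF B]]) simp
  have eq: "fourier (abs_l2 (convol k (trunc n g))) = mult_l2 ?m (abs_l2 (FT (trunc n g)))" for n
  proof -
    note t = integrable_trunc[OF g, of n] square_integrable_trunc[OF g, of n]
    have "fourier (abs_l2 (convol k (trunc n g))) = abs_l2 (FT (convol k (trunc n g)))"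
      by (rule fourier_abs_l2_L1[OF integrable_convol[OF k(1) t(1)] Young_convol(1)[OF k(1) t(2)]])
    also have "FT (convol k (trunc n g)) = (\<lambda>s. ?m s * FT (trunc n g) s)"
      by (simp add: fun_eq_iff FT_convol[OF k(1) t(1)])
    also have "(abs_l2 \<dots> :: real_line l2) = mult_l2 ?m (abs_l2 (FT (trunc n g)))"
      by (rule sym, rule mult_l2_abs_l2[OF m AE_I2 square_integrable_real_line[OF square_integrable_FT[OF t]]], rule B)
    finally show ?thesis .
  qed
  have "(\<lambda>n. fourier (abs_l2 (convol k (trunc n g)))) \<longlonglongrightarrow> fourier (abs_l2 (convol k g))"
    by (intro bounded_linear.tendsto[OF bounded_linear_fourier] convol_trunc_tendsto k g)
  moreover have "(\<lambda>n. mult_l2 ?m (abs_l2 (FT (trunc n g)))) \<longlonglongrightarrow> mult_l2 ?m (fourier (abs_l2 g))"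
    by (intro bounded_linear.tendsto[OF bl] fourier_tendsto g)
  ultimately show ?thesis
    unfolding eq by (rule LIMSEQ_unique)
qed

section \<open>The unit interval and the logistic substitution\<close>

lemma borel_measurable_lebesgue_AE_cong:
  fixes f g :: "real \<Rightarrow> complex"
  assumes f: "f \<in> borel_measurable lebesgue" and ae: "AE x in lebesgue. f x = g x"
  shows "g \<in> borel_measurable lebesgue"
proof (rule measurableI)
  obtain N where N: "N \<in> null_sets lebesgue" "{x \<in> space lebesgue. f x \<noteq> g x} \<subseteq> N"
    using ae unfolding eventually_ae_filter by blast
  then have fg: "f x = g x" if "x \<notin> N" for x using that by auto
  fix S :: "complex set" assume S: "S \<in> sets borel"
  have "g -` S \<inter> space lebesgue = (f -` S \<inter> space lebesgue - N) \<union> (g -` S \<inter> N)"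
    using fg by auto
  moreover have "g -` S \<inter> N \<in> null_sets lebesgue"
    using null_sets_completion_subset[OF _ N(1)] by blast
  moreover have "f -` S \<inter> space lebesgue - N \<in> sets lebesgue"
    using measurable_sets[OF f S] N(1) by auto
  ultimately show "g -` S \<inter> space lebesgue \<in> sets lebesgue"
    by (metis null_setsD2 sets.Un)
qed simp

definition logistic :: "real \<Rightarrow> real" where
  "logistic u = 1 / (1 + exp u)"

text \<open>
  The negative of the derivative of the logistic function, which is decreasing.
\<close>

definition logistic_density :: "real \<Rightarrow> real" where
  "logistic_density u = exp u / (1 + exp u)\<^sup>2"

lemma exp_plus_pos: "0 < 1 + exp (u::real)" "1 + exp (u::real) \<noteq> 0"
  using exp_gt_zero[of u] by linarith+

lemma logistic_bounds: "0 < logistic u" "logistic u < 1"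
  using exp_plus_pos[of u] by (simp_all add: logistic_def divide_less_eq)

lemma logistic_less_iff: "logistic u < logistic v \<longleftrightarrow> v < u"
  using exp_plus_pos[of u] exp_plus_pos[of v] by (simp add: logistic_def divide_less_eq field_simps)

lemma logistic_logit:
  assumes "0 < x" "x < 1"
  shows "logistic (ln ((1 - x) / x)) = x"
  using assms by (simp add: logistic_def field_simps)

lemma logit_logistic: "ln ((1 - logistic u) / logistic u) = u"
proof -
  have "(1 - logistic u) / logistic u = exp u"
    using exp_plus_pos[of u] by (simp add: logistic_def field_simps)
  then show ?thesis by simp
qed

lemma logistic_borel [measurable]: "logistic \<in> borel_measurable borel"
  unfolding logistic_def[abs_def] by measurable

lemma logistic_density_borel [measurable]: "logistic_density \<in> borel_measurable borel"
  unfolding logistic_density_def[abs_def] by measurable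

lemma logistic_density_pos: "0 < logistic_density u"
  using exp_plus_pos[of u] by (simp add: logistic_density_def)

lemma logistic_density_uminus: "logistic_density (- u) = logistic_density u"
proof -
  have "1 + exp (- u) = exp (- u) * (1 + exp u)"
    by (simp add: distrib_left exp_minus)
  then have "logistic_density (- u) = exp (- u) / ((exp (- u))\<^sup>2 * (1 + exp u)\<^sup>2)"
    by (simp add: logistic_density_def power_mult_distrib)
  also have "\<dots> = logistic_density u"
    by (simp add: logistic_density_def power2_eq_square exp_minus field_simps)
  finally show ?thesis .
qed

lemma nn_integral_logistic_density_atLeast:
  "(\<integral>\<^sup>+u. ennreal (logistic_density u) * indicator {a..} u \<partial>lborel) = ennreal (logistic a)"
proof -
  have "(\<integral>\<^sup>+u. ennreal (logistic_density u) * indicator {a..} u \<partial>lborel) = ennreal (0 - (- logistic a))"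
  proof (rule nn_integral_FTC_atLeast)
    show "((\<lambda>u. - logistic u) has_real_derivative logistic_density u) (at u)" for u
      using exp_plus_pos[of u] unfolding logistic_def logistic_density_def
      by (auto intro!: derivative_eq_intros simp: power2_eq_square)
    have "((\<lambda>u. - logistic u) \<longlongrightarrow> - 0) at_top"
      unfolding logistic_def
      by (intro tendsto_minus tendsto_divide_0[OF tendsto_const] filterlim_at_top_imp_at_infinity
          filterlim_tendsto_add_at_top[OF tendsto_const exp_at_top])
    then show "((\<lambda>u. - logistic u) \<longlongrightarrow> 0) at_top" by simp
  qed (auto intro: less_imp_le logistic_density_pos)
  then show ?thesis by simp
qed

lemma nn_integral_logistic_density_lessThan:
  "(\<integral>\<^sup>+u. ennreal (logistic_density u) * indicator {..<a} u \<partial>lborel) = ennreal (logistic (- a))"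
proof -
  have "(\<integral>\<^sup>+u. ennreal (logistic_density u) * indicator {..<a} u \<partial>lborel) =
      (\<integral>\<^sup>+u. ennreal (logistic_density (- u)) * indicator {..<a} (- u) \<partial>lborel)"
    using nn_integral_real_affine[of "\<lambda>u. ennreal (logistic_density u) * indicator {..<a} u" "-1" 0] by simp
  also have "\<dots> = (\<integral>\<^sup>+u. ennreal (logistic_density u) * indicator {- a..} u \<partial>lborel)"
    using AE_lborel_singleton[of "- a"]
    by (intro nn_integral_cong_AE) (auto elim!: eventually_mono simp: logistic_density_uminus indicator_def)
  finally show ?thesis by (simp add: nn_integral_logistic_density_atLeast)
qed

text \<open>
  The substitution \<open>x = logistic u\<close> as an identity of measures, so that integrals of arbitrary
  functions, integrability and null sets can all be transported at once. It suffices to compare the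
  measures of half lines.
\<close>

lemma distr_logistic_density:
  "distr (density lborel (\<lambda>u. ennreal (logistic_density u))) borel logistic =
   density lborel (\<lambda>x. ennreal (indicator {0<..<1} x))" (is "?L = ?R")
proof (rule measure_eqI_lessThan)
  have L: "emeasure ?L {x<..} = (\<integral>\<^sup>+u. ennreal (logistic_density u) * indicator {u. x < logistic u} u \<partial>lborel)" for x
    by (simp add: emeasure_distr emeasure_density vimage_def)
  have R: "emeasure ?R {x<..} = emeasure lborel ({0<..<1} \<inter> {x<..})" for x
  proof -
    have "emeasure ?R {x<..} = (\<integral>\<^sup>+y. ennreal (indicator {0<..<1} y) * indicator {x<..} y \<partial>lborel)"
      by (rule emeasure_density) auto
    also have "\<dots> = (\<integral>\<^sup>+y. indicator ({0<..<1} \<inter> {x<..}) y \<partial>lborel)"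
      by (intro nn_integral_cong) (auto simp: indicator_def)
    also have "\<dots> = emeasure lborel ({0<..<1} \<inter> {x<..})"
      by (rule nn_integral_indicator) auto
    finally show ?thesis .
  qed
  show *: "emeasure ?L {x<..} = emeasure ?R {x<..}" for x
  proof -
    consider "x \<le> 0" | "1 \<le> x" | "0 < x" "x < 1" by linarith
    then show ?thesis
    proof cases
      case 1
      \<comment> \<open>the whole line is split at zero, where the two one-sided formulas apply\<close>
      have "{u. x < logistic u} = UNIV"
        using logistic_bounds(1) 1 by (auto intro: le_less_trans)
      then have "emeasure ?L {x<..} = (\<integral>\<^sup>+u. ennreal (logistic_density u) * indicator {..<0} u +
          ennreal (logistic_density u) * indicator {0..} u \<partial>lborel)"
        unfolding L by (intro nn_integral_cong) (auto simp: indicator_def)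
      also have "\<dots> = ennreal (logistic 0) + ennreal (logistic 0)"
        by (subst nn_integral_add)
           (auto simp: nn_integral_logistic_density_lessThan nn_integral_logistic_density_atLeast)
      also have "\<dots> = 1"
        by (subst ennreal_plus[symmetric]) (auto simp: logistic_def)
      finally have "emeasure ?L {x<..} = 1" .
      moreover have "{0<..<1} \<inter> {x<..} = {0<..<1}" using 1 by auto
      ultimately show ?thesis unfolding R by simp
    next
      case 2
      have "\<not> x < logistic u" for u
        using logistic_bounds(2)[of u] 2 by linarith
      then have "{u. x < logistic u} = {}" by simp
      moreover have "{0<..<1} \<inter> {x<..} = {}" using 2 by auto
      ultimately show ?thesis unfolding R L by simp
    next
      case 3
      define l where "l = ln ((1 - x) / x)"
      have xl: "x = logistic l" using logistic_logit 3 by (simp add: l_def)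
      have "{u. x < logistic u} = {..<l}"
        unfolding xl logistic_less_iff by auto
      then have "emeasure ?L {x<..} = ennreal (logistic (- l))"
        unfolding L by (simp add: nn_integral_logistic_density_lessThan)
      also have "logistic (- l) = 1 - x"
        unfolding xl using exp_plus_pos[of l] by (simp add: logistic_def exp_minus field_simps)
      finally have "emeasure ?L {x<..} = ennreal (1 - x)" .
      moreover have "{0<..<1} \<inter> {x<..} = {x<..<1}" using 3 by auto
      ultimately show ?thesis unfolding R using 3 by simp
    qed
  qed
  show "emeasure ?L {x<..} < \<infinity>" for x
  proof -
    have "emeasure lborel ({0<..<1} \<inter> {x<..}) \<le> emeasure lborel {0<..<1::real}"
      by (intro emeasure_mono) auto
    then show ?thesis unfolding * R by (auto intro: le_less_trans)
  qed
qed simp_all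

lemma
  fixes F :: "real \<Rightarrow> 'b::{banach, second_countable_topology}"
  assumes [measurable]: "F \<in> borel_measurable borel"
  shows integrable_logistic: "integrable lborel (\<lambda>x. indicator {0<..<1} x *\<^sub>R F x) \<longleftrightarrow>
      integrable lborel (\<lambda>u. logistic_density u *\<^sub>R F (logistic u))"
    and integral_logistic: "(LINT x|lborel. indicator {0<..<1} x *\<^sub>R F x) =
      (LINT u|lborel. logistic_density u *\<^sub>R F (logistic u))"
proof -
  have a: "integrable lborel (\<lambda>x. indicator {0<..<1} x *\<^sub>R F x) \<longleftrightarrow>
      integrable (density lborel (\<lambda>x. ennreal (indicator {0<..<1} x))) F"
    by (rule integrable_density[symmetric]) auto
  have b: "integrable (distr (density lborel (\<lambda>u. ennreal (logistic_density u))) borel logistic) F \<longleftrightarrow>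
      integrable (density lborel (\<lambda>u. ennreal (logistic_density u))) (\<lambda>u. F (logistic u))"
    by (rule integrable_distr_eq) auto
  have c: "integrable (density lborel (\<lambda>u. ennreal (logistic_density u))) (\<lambda>u. F (logistic u)) \<longleftrightarrow>
      integrable lborel (\<lambda>u. logistic_density u *\<^sub>R F (logistic u))"
    by (rule integrable_density) (auto intro: less_imp_le logistic_density_pos)
  show "integrable lborel (\<lambda>x. indicator {0<..<1} x *\<^sub>R F x) \<longleftrightarrow>
      integrable lborel (\<lambda>u. logistic_density u *\<^sub>R F (logistic u))"
    unfolding a distr_logistic_density[symmetric] b c ..
  have a: "(LINT x|lborel. indicator {0<..<1} x *\<^sub>R F x) =
      integral\<^sup>L (density lborel (\<lambda>x. ennreal (indicator {0<..<1} x))) F"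
    by (rule integral_density[symmetric]) auto
  have b: "integral\<^sup>L (distr (density lborel (\<lambda>u. ennreal (logistic_density u))) borel logistic) F =
      integral\<^sup>L (density lborel (\<lambda>u. ennreal (logistic_density u))) (\<lambda>u. F (logistic u))"
    by (rule integral_distr) auto
  have c: "integral\<^sup>L (density lborel (\<lambda>u. ennreal (logistic_density u))) (\<lambda>u. F (logistic u)) =
      (LINT u|lborel. logistic_density u *\<^sub>R F (logistic u))"
    by (rule integral_density) (auto intro: less_imp_le logistic_density_pos)
  show "(LINT x|lborel. indicator {0<..<1} x *\<^sub>R F x) = (LINT u|lborel. logistic_density u *\<^sub>R F (logistic u))"
    unfolding a distr_logistic_density[symmetric] b c ..
qed

lemma AE_logistic:
  assumes "AE x in lborel. x \<in> {0<..<1} \<longrightarrow> P x"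
  shows "AE u in lborel. P (logistic u)"
proof -
  obtain N where N: "N \<in> null_sets lborel" "{x \<in> space lborel. \<not> (x \<in> {0<..<1} \<longrightarrow> P x)} \<subseteq> N"
    using assms unfolding eventually_ae_filter by blast
  have "AE x in density lborel (\<lambda>x. ennreal (indicator {0<..<1} x)). x \<notin> N"
    using AE_not_in[OF N(1)] by (subst AE_density) auto
  then have "AE x in distr (density lborel (\<lambda>u. ennreal (logistic_density u))) borel logistic. x \<notin> N"
    unfolding distr_logistic_density .
  then have "AE u in density lborel (\<lambda>u. ennreal (logistic_density u)). logistic u \<notin> N"
    using AE_distrD[of logistic "density lborel (\<lambda>u. ennreal (logistic_density u))" borel "\<lambda>x. x \<notin> N"] by simp
  then have "AE u in lborel. logistic u \<notin> N"
    by (subst (asm) AE_density) (auto simp: logistic_density_pos)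
  then show ?thesis
    by eventually_elim (use N(2) logistic_bounds in force)
qed

lemma l2_unit_interval: "l2_measure TYPE(unit_interval) = lebesgue_on {0<..<1}"
  by (rule l2_measure_unit_interval_def)

lemma unit_measurable_iff:
  fixes f :: "real \<Rightarrow> 'b::real_normed_vector"
  shows "f \<in> borel_measurable (lebesgue_on {0<..<1}) \<longleftrightarrow>
    (\<lambda>x. indicator {0<..<1} x *\<^sub>R f x) \<in> borel_measurable lebesgue"
  by (rule borel_measurable_restrict_space_iff) simp

lemma AE_unit_iff: "(AE x in lebesgue_on {0<..<1::real}. P x) \<longleftrightarrow> (AE x in lborel. x \<in> {0<..<1} \<longrightarrow> P x)"
  by (subst AE_restrict_space_iff) (simp_all add: AE_completion_iff)

lemma borel_measurable_unit: "f \<in> borel_measurable borel \<Longrightarrow> f \<in> borel_measurable (lebesgue_on {0<..<1})"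
  by (intro measurable_restrict_space1 measurable_completion) simp

lemma
  fixes f :: "real \<Rightarrow> 'b::{banach, second_countable_topology}"
  assumes [measurable]: "f \<in> borel_measurable borel"
  shows integrable_unit_iff: "integrable (lebesgue_on {0<..<1}) f \<longleftrightarrow>
      integrable lborel (\<lambda>u. logistic_density u *\<^sub>R f (logistic u))"
    and integral_unit_eq: "integral\<^sup>L (lebesgue_on {0<..<1}) f =
      (LINT u|lborel. logistic_density u *\<^sub>R f (logistic u))"
proof -
  have "integrable (lebesgue_on {0<..<1}) f \<longleftrightarrow> integrable lebesgue (\<lambda>x. indicator {0<..<1} x *\<^sub>R f x)"
    by (rule integrable_restrict_space) simp
  also have "\<dots> \<longleftrightarrow> integrable lborel (\<lambda>x. indicator {0<..<1} x *\<^sub>R f x)"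
    by (rule integrable_completion) measurable
  also have "\<dots> \<longleftrightarrow> integrable lborel (\<lambda>u. logistic_density u *\<^sub>R f (logistic u))"
    by (rule integrable_logistic) simp
  finally show "integrable (lebesgue_on {0<..<1}) f \<longleftrightarrow>
      integrable lborel (\<lambda>u. logistic_density u *\<^sub>R f (logistic u))" .
  have "integral\<^sup>L (lebesgue_on {0<..<1}) f = (LINT x|lebesgue. indicator {0<..<1} x *\<^sub>R f x)"
    by (rule integral_restrict_space) simp
  also have "\<dots> = (LINT x|lborel. indicator {0<..<1} x *\<^sub>R f x)"
    by (rule integral_completion) measurable
  also have "\<dots> = (LINT u|lborel. logistic_density u *\<^sub>R f (logistic u))"
    by (rule integral_logistic) simp
  finally show "integral\<^sup>L (lebesgue_on {0<..<1}) f = (LINT u|lborel. logistic_density u *\<^sub>R f (logistic u))" .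
qed

lemma unit_interval_borel_cases:
  obtains f where "f \<in> borel_measurable borel" "square_integrable (lebesgue_on {0<..<1}) f"
    "(F :: unit_interval l2) = abs_l2 f"
proof -
  obtain f where f: "square_integrable (lebesgue_on {0<..<1}) f" "F = abs_l2 f"
    using l2_cases[where 'd = unit_interval] by (metis l2_unit_interval)
  then have "(\<lambda>x. indicator {0<..<1} x *\<^sub>R f x) \<in> borel_measurable lebesgue"
    by (simp add: square_integrable_def flip: unit_measurable_iff)
  then obtain g where g: "g \<in> borel_measurable borel" "AE x in lborel. indicator {0<..<1} x *\<^sub>R f x = g x"
    by (rule lebesgue_measurable_eq_borel_AE)
  have ae: "AE x in lebesgue_on {0<..<1}. f x = g x"
    unfolding AE_unit_iff using g(2) by eventually_elim (auto simp: indicator_def)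
  have gl: "g \<in> borel_measurable (lebesgue_on {0<..<1})"
    by (rule borel_measurable_unit[OF g(1)])
  have "square_integrable (lebesgue_on {0<..<1}) g"
    by (rule square_integrable_AE_cong[OF f(1) gl ae])
  moreover have "F = abs_l2 g"
    unfolding f(2) by (rule abs_l2_cong_AE) (use f gl ae in \<open>simp_all only: l2_unit_interval\<close>)
  ultimately show thesis
    using that g(1) by blast
qed

definition Phi_fun :: "(real \<Rightarrow> complex) \<Rightarrow> real \<Rightarrow> complex" where
  "Phi_fun f u = of_real (exp (u / 2) / (1 + exp u)) * f (1 / (1 + exp u))"

lemma Phi_fun_borel [measurable]:
  assumes [measurable]: "f \<in> borel_measurable borel"
  shows "Phi_fun f \<in> borel_measurable borel"
  unfolding Phi_fun_def[abs_def] by measurable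

lemma cmod_Phi_fun: "(cmod (Phi_fun f u))\<^sup>2 = logistic_density u *\<^sub>R (cmod (f (logistic u)))\<^sup>2"
proof -
  have "(exp (u / 2))\<^sup>2 = exp u"
    by (simp add: power2_eq_square exp_add[symmetric])
  then show ?thesis
    unfolding Phi_fun_def norm_mult norm_of_real power_mult_distrib
    by (simp add: logistic_density_def logistic_def power_divide)
qed

lemma square_integrable_Phi_fun:
  assumes "f \<in> borel_measurable borel"
  shows "square_integrable lborel (Phi_fun f) \<longleftrightarrow> square_integrable (lebesgue_on {0<..<1}) f"
  using assms integrable_unit_iff[of "\<lambda>x. (cmod (f x))\<^sup>2"]
  by (simp add: square_integrable_def cmod_Phi_fun borel_measurable_unit Phi_fun_borel)

lemma Phi_abs_l2:
  assumes f: "f \<in> borel_measurable borel" "square_integrable (lebesgue_on {0<..<1}) f"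
  shows "Phi (abs_l2 f) = abs_l2 (Phi_fun f)"
proof -
  let ?r = "rep_l2 (abs_l2 f :: unit_interval l2)"
  have "AE x in lebesgue_on {0<..<1}. ?r x = f x"
    using rep_abs_l2[where 'd = unit_interval, of f] f(2) unfolding l2_unit_interval by simp
  then have "AE u in lborel. ?r (logistic u) = f (logistic u)"
    unfolding AE_unit_iff by (rule AE_logistic)
  then have "AE u in lborel. Phi_fun f u = Phi_fun ?r u"
    by eventually_elim (simp add: Phi_fun_def logistic_def)
  then have ae: "AE u in lebesgue. Phi_fun f u = Phi_fun ?r u"
    by (rule AE_completion)
  have s: "square_integrable lebesgue (Phi_fun f)"
    using f by (simp add: square_integrable_Phi_fun square_integrable_lebesgue_if_lborel)
  have m: "Phi_fun ?r \<in> borel_measurable lebesgue"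
    by (rule borel_measurable_lebesgue_AE_cong[OF _ ae]) (use s in \<open>simp add: square_integrable_def\<close>)
  have "(abs_l2 (Phi_fun f) :: real_line l2) = abs_l2 (Phi_fun ?r)"
    by (rule abs_l2_cong_AE) (use s ae m in \<open>simp_all only: l2_real_line\<close>)
  then show ?thesis by (simp add: Phi_def Phi_fun_def[abs_def])
qed

lemma norm_Phi: "norm (Phi F) = norm F"
proof -
  obtain f where f: "f \<in> borel_measurable borel" "square_integrable (lebesgue_on {0<..<1}) f" "F = abs_l2 f"
    by (rule unit_interval_borel_cases)
  have "(norm (Phi F))\<^sup>2 = (LINT u|lborel. logistic_density u *\<^sub>R (cmod (f (logistic u)))\<^sup>2)"
    using f by (simp add: Phi_abs_l2 norm_real_line_power2 square_integrable_Phi_fun cmod_Phi_fun)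
  also have "\<dots> = (LINT x|lebesgue_on {0<..<1}. (cmod (f x))\<^sup>2)"
    using f by (intro integral_unit_eq[symmetric]) measurable
  also have "\<dots> = (norm F)\<^sup>2"
    using f norm_abs_l2_power2[where 'd = unit_interval, of f] by (simp add: l2_unit_interval)
  finally show ?thesis by simp
qed

lemma Phi_add: "Phi (F + G) = Phi F + Phi G"
proof -
  obtain f where f: "f \<in> borel_measurable borel" "square_integrable (lebesgue_on {0<..<1}) f" "F = abs_l2 f"
    by (rule unit_interval_borel_cases)
  obtain g where g: "g \<in> borel_measurable borel" "square_integrable (lebesgue_on {0<..<1}) g" "G = abs_l2 g"
    by (rule unit_interval_borel_cases)
  have "F + G = abs_l2 (\<lambda>x. f x + g x)"
    using f g by (simp add: abs_l2_add l2_unit_interval)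
  then have "Phi (F + G) = abs_l2 (Phi_fun (\<lambda>x. f x + g x))"
    using f g by (simp add: Phi_abs_l2 square_integrable_add borel_measurable_add)
  also have "Phi_fun (\<lambda>x. f x + g x) = (\<lambda>u. Phi_fun f u + Phi_fun g u)"
    by (simp add: Phi_fun_def fun_eq_iff distrib_left add_divide_distrib)
  also have "abs_l2 (\<lambda>u. Phi_fun f u + Phi_fun g u) = Phi F + Phi G"
    using f g by (simp add: Phi_abs_l2 abs_l2_add square_integrable_real_line square_integrable_Phi_fun)
  finally show ?thesis .
qed

lemma Phi_scaleC: "Phi (scaleC c F) = scaleC c (Phi F)"
proof -
  obtain f where f: "f \<in> borel_measurable borel" "square_integrable (lebesgue_on {0<..<1}) f" "F = abs_l2 f"
    by (rule unit_interval_borel_cases)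
  have "scaleC c F = abs_l2 (\<lambda>x. c * f x)"
    using f by (simp add: abs_l2_scaleC l2_unit_interval)
  then have "Phi (scaleC c F) = abs_l2 (Phi_fun (\<lambda>x. c * f x))"
    using f by (simp add: Phi_abs_l2 square_integrable_mult_const borel_measurable_times)
  also have "Phi_fun (\<lambda>x. c * f x) = (\<lambda>u. c * Phi_fun f u)"
    by (simp add: Phi_fun_def fun_eq_iff mult.left_commute)
  also have "abs_l2 (\<lambda>u. c * Phi_fun f u) = scaleC c (Phi F)"
    using f by (simp add: Phi_abs_l2 abs_l2_scaleC square_integrable_real_line square_integrable_Phi_fun)
  finally show ?thesis .
qed

definition Phi_inv_fun :: "(real \<Rightarrow> complex) \<Rightarrow> real \<Rightarrow> complex" where
  "Phi_inv_fun g x = of_real (1 / x * sqrt (x / (1 - x))) * g (ln ((1 - x) / x))"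

lemma Phi_inv_fun_borel [measurable]:
  assumes [measurable]: "g \<in> borel_measurable borel"
  shows "Phi_inv_fun g \<in> borel_measurable borel"
  unfolding Phi_inv_fun_def[abs_def] by measurable

lemma Phi_inv_fun_logistic: "Phi_inv_fun g (logistic u) = of_real ((1 + exp u) * exp (- u / 2)) * g u"
proof -
  have "logistic u / (1 - logistic u) = exp (- u / 2) * exp (- u / 2)"
    using exp_plus_pos[of u] by (simp add: logistic_def exp_add[symmetric] exp_minus field_simps)
  then have "sqrt (logistic u / (1 - logistic u)) = exp (- u / 2)"
    by simp
  then show ?thesis
    unfolding Phi_inv_fun_def logit_logistic by (simp add: logistic_def)
qed

lemma Phi_fun_Phi_inv_fun: "Phi_fun (Phi_inv_fun g) = g"
proof
  fix u
  have "Phi_fun (Phi_inv_fun g) u = of_real (exp (u / 2) / (1 + exp u)) * Phi_inv_fun g (logistic u)"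
    by (simp add: Phi_fun_def logistic_def)
  also have "\<dots> = of_real (exp (u / 2) / (1 + exp u) * ((1 + exp u) * exp (- u / 2))) * g u"
    by (simp only: Phi_inv_fun_logistic of_real_mult mult.assoc)
  also have "exp (u / 2) / (1 + exp u) * ((1 + exp u) * exp (- u / 2)) = 1"
    using exp_plus_pos[of u] by (simp add: exp_minus)
  finally show "Phi_fun (Phi_inv_fun g) u = g u" by simp
qed

lemma Phi_abs_l2_Phi_inv_fun:
  assumes g: "square_integrable lborel g"
  shows "square_integrable (lebesgue_on {0<..<1}) (Phi_inv_fun g)" "Phi (abs_l2 (Phi_inv_fun g)) = abs_l2 g"
proof -
  have b: "Phi_inv_fun g \<in> borel_measurable borel"
    by (rule Phi_inv_fun_borel[OF square_integrable_borel[OF g]])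
  show s: "square_integrable (lebesgue_on {0<..<1}) (Phi_inv_fun g)"
    using square_integrable_Phi_fun[OF b] g by (simp add: Phi_fun_Phi_inv_fun)
  show "Phi (abs_l2 (Phi_inv_fun g)) = abs_l2 g"
    by (simp add: Phi_abs_l2[OF b s] Phi_fun_Phi_inv_fun)
qed

lemma bounded_linear_Phi: "bounded_linear Phi"
  by (rule bounded_linear_intro[where K = 1]) (simp_all add: Phi_add scaleR_scaleC Phi_scaleC norm_Phi)

lemma bij_Phi: "bij Phi"
proof (rule bijI)
  show "inj Phi"
  proof (rule injI)
    fix F G assume "Phi F = Phi G"
    then have "Phi (F - G) = 0"
      by (simp add: linear_diff[OF bounded_linear.linear[OF bounded_linear_Phi]])
    then have "norm (F - G) = 0"
      by (metis norm_Phi norm_zero)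
    then show "F = G" by simp
  qed
  show "surj Phi"
    unfolding surj_def
  proof
    fix G :: "real_line l2"
    obtain g where "square_integrable lborel g" "G = abs_l2 g" by (rule real_line_borel_cases)
    then show "\<exists>F. G = Phi F" using Phi_abs_l2_Phi_inv_fun(2)[of g] by metis
  qed
qed

section \<open>The Cesaro operator as a convolution\<close>

definition cesaro_kernel :: "real \<Rightarrow> complex" where
  "cesaro_kernel w = indicator {..<0} w * of_real (exp (w / 2))"

lemma
  shows integrable_cesaro_kernel: "integrable lborel cesaro_kernel"
    and square_integrable_cesaro_kernel: "square_integrable lborel cesaro_kernel"
    and FT_cesaro_kernel: "of_real (sqrt (2 * pi)) * FT cesaro_kernel s = 1 / (1 / 2 - \<i> * of_real s)"
proof -
  let ?e = "\<lambda>z s. indicator {0<..} s * exp (- (z * complex_of_real s))"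
  have r: "integrable lborel (\<lambda>s. ?e z (- s))" "(LINT s|lborel. ?e z (- s)) = 1 / z" if "Re z > 0" for z
    using lborel_integrable_real_affine[OF integrable_exp_half_line[OF that], of "-1" 0]
      lborel_integral_real_affine[of "-1" "?e z" 0] integral_exp_half_line[OF that] by simp_all
  have k: "cesaro_kernel w = ?e (1/2) (- w)" for w
    by (auto simp: cesaro_kernel_def indicator_def exp_of_real[symmetric])
  show "integrable lborel cesaro_kernel"
    unfolding k[abs_def] by (rule r(1)) simp
  then have m [measurable]: "cesaro_kernel \<in> borel_measurable borel" by simp
  have "complex_of_real ((cmod (cesaro_kernel w))\<^sup>2) = ?e 1 (- w)" for w
  proof -
    have "(exp (w / 2))\<^sup>2 = exp w" by (simp add: power2_eq_square exp_add[symmetric])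
    then show ?thesis
      by (auto simp: cesaro_kernel_def indicator_def norm_mult exp_of_real[symmetric] simp flip: of_real_power)
  qed
  then have "integrable lborel (\<lambda>w. complex_of_real ((cmod (cesaro_kernel w))\<^sup>2))"
    using r(1)[of 1] by simp
  then show "square_integrable lborel cesaro_kernel"
    unfolding complex_of_real_integrable_eq square_integrable_def by simp
  have "cesaro_kernel w * exp (- (\<i> * of_real w * of_real s)) = ?e (1/2 - \<i> * of_real s) (- w)" for w
    by (auto simp: cesaro_kernel_def indicator_def exp_of_real[symmetric] exp_add[symmetric] algebra_simps)
  then have "(LINT w|lborel. cesaro_kernel w * exp (- (\<i> * of_real w * of_real s))) = 1 / (1/2 - \<i> * of_real s)"
    using r(2)[of "1/2 - \<i> * of_real s"] by simp
  then show "of_real (sqrt (2 * pi)) * FT cesaro_kernel s = 1 / (1 / 2 - \<i> * of_real s)"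
    by (simp add: FT_def)
qed

text \<open>
  With \<open>t = logistic v\<close> the factor \<open>1 / (1 - t)\<close> cancels part of the density, and \<open>t < logistic u\<close> becomes
  \<open>v > u\<close>. What remains is \<open>\<integral> exp (- v / 2) (Phi f)(v) dv\<close> over \<open>v > u\<close>.
\<close>

lemma cesaro_integral:
  assumes f [measurable]: "f \<in> borel_measurable borel"
  shows "(LINT t:{0<..<logistic u}|lborel. f t / of_real (1 - t)) =
    of_real (exp (- u / 2)) * convol cesaro_kernel (Phi_fun f) u"
proof -
  let ?g = "Phi_fun f"
  let ?F = "\<lambda>t. indicator {0<..<logistic u} t *\<^sub>R (f t / of_real (1 - t))"
  have "(LINT t:{0<..<logistic u}|lborel. f t / of_real (1 - t)) = (LINT t|lborel. indicator {0<..<1} t *\<^sub>R ?F t)"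
    unfolding set_lebesgue_integral_def using logistic_bounds(2)[of u]
    by (intro Bochner_Integration.integral_cong) (auto simp: indicator_def)
  also have "\<dots> = (LINT v|lborel. logistic_density v *\<^sub>R ?F (logistic v))"
    by (rule integral_logistic) measurable
  also have "\<dots> = (LINT v|lborel. of_real (exp (- u / 2)) * (cesaro_kernel (u - v) * ?g v))"
  proof (rule Bochner_Integration.integral_cong[OF refl])
    fix v :: real
    have ind: "indicator {0<..<logistic u} (logistic v) = (if u < v then 1 else 0 :: real)"
      using logistic_bounds(1)[of v] by (simp add: indicator_def logistic_less_iff)
    have "1 - logistic v = exp v * logistic v"
      using exp_plus_pos[of v] by (simp add: logistic_def field_simps)
    then have "logistic_density v / (1 - logistic v) = 1 / (1 + exp v)"
      using exp_plus_pos[of v] by (simp add: logistic_def logistic_density_def power2_eq_square)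
    also have "\<dots> = exp (- u / 2) * (exp ((u - v) / 2) * (exp (v / 2) / (1 + exp v)))"
      by (simp add: exp_add[symmetric] mult.assoc[symmetric] field_simps)
    finally have e: "logistic_density v / (1 - logistic v) = exp (- u / 2) * (exp ((u - v) / 2) * (exp (v / 2) / (1 + exp v)))" .
    have "logistic_density v *\<^sub>R (f (logistic v) / of_real (1 - logistic v)) =
        of_real (logistic_density v / (1 - logistic v)) * f (logistic v)"
      by (simp add: scaleR_conv_of_real)
    also have "\<dots> = of_real (exp (- u / 2)) * (of_real (exp ((u - v) / 2)) * ?g v)"
      unfolding e by (simp add: Phi_fun_def logistic_def mult.assoc)
    finally show "logistic_density v *\<^sub>R ?F (logistic v) = of_real (exp (- u / 2)) * (cesaro_kernel (u - v) * ?g v)"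
      unfolding ind by (simp add: cesaro_kernel_def)
  qed
  also have "\<dots> = of_real (exp (- u / 2)) * (LINT v|lborel. cesaro_kernel (u - v) * ?g v)"
    by simp
  also have "(LINT v|lborel. cesaro_kernel (u - v) * ?g v) = convol cesaro_kernel ?g u"
    using lborel_integral_real_affine[of "-1" "\<lambda>v. cesaro_kernel (u - v) * ?g v" u] by (simp add: convol_def)
  finally show ?thesis .
qed

lemma Phi_cesaro_eq_convol:
  assumes f: "f \<in> borel_measurable borel" "square_integrable (lebesgue_on {0<..<1}) f"
  shows "Phi (cesaro (abs_l2 f)) = abs_l2 (convol cesaro_kernel (Phi_fun f))"
proof -
  let ?r = "rep_l2 (abs_l2 f :: unit_interval l2)" and ?h = "convol cesaro_kernel (Phi_fun f)"
  let ?c = "\<lambda>x. 1 / complex_of_real x * (LINT t:{0<..<x}|lebesgue. ?r t / of_real (1 - t))"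
  note [measurable] = f(1)
  have g: "square_integrable lborel (Phi_fun f)"
    using f by (simp add: square_integrable_Phi_fun)
  have h: "square_integrable lborel ?h"
    by (rule Young_convol(1)[OF integrable_cesaro_kernel g])
  note P = Phi_abs_l2_Phi_inv_fun[OF h]
  have "?r \<in> borel_measurable (lebesgue_on {0<..<1})"
    using square_integrable_rep_l2[of "abs_l2 f :: unit_interval l2"] unfolding l2_unit_interval square_integrable_def by simp
  then have rm: "(\<lambda>x. indicator {0<..<1} x *\<^sub>R ?r x) \<in> borel_measurable lebesgue"
    by (simp add: unit_measurable_iff)
  have "AE x in lebesgue_on {0<..<1}. ?r x = f x"
    using rep_abs_l2[where 'd = unit_interval, of f] f(2) unfolding l2_unit_interval by simp
  then have ae: "AE x in lebesgue. x \<in> {0<..<1} \<longrightarrow> ?r x = f x"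
    unfolding AE_unit_iff by (rule AE_completion)
  have eq: "?c x = Phi_inv_fun ?h x" if x: "x \<in> {0<..<1}" for x
  proof -
    define u where "u = ln ((1 - x) / x)"
    have xu: "x = logistic u" using x logistic_logit[of x] by (simp add: u_def)
    have "(LINT t:{0<..<x}|lebesgue. ?r t / of_real (1 - t)) = (LINT t:{0<..<x}|lebesgue. f t / of_real (1 - t))"
      unfolding set_lebesgue_integral_def
    proof (rule integral_cong_AE)
      have "(\<lambda>t. complex_of_real (indicator {0<..<x} t / (1 - t))) \<in> borel_measurable lebesgue"
        by (intro measurable_completion) measurable
      then have "(\<lambda>t. complex_of_real (indicator {0<..<x} t / (1 - t)) * (indicator {0<..<1} t *\<^sub>R ?r t)) \<in> borel_measurable lebesgue"
        using rm by (rule borel_measurable_times)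
      also have "(\<lambda>t. complex_of_real (indicator {0<..<x} t / (1 - t)) * (indicator {0<..<1} t *\<^sub>R ?r t)) =
          (\<lambda>t. indicator {0<..<x} t *\<^sub>R (?r t / of_real (1 - t)))"
        using x by (auto simp: fun_eq_iff indicator_def)
      finally show "(\<lambda>t. indicator {0<..<x} t *\<^sub>R (?r t / of_real (1 - t))) \<in> borel_measurable lebesgue" .
      show "(\<lambda>t. indicator {0<..<x} t *\<^sub>R (f t / of_real (1 - t))) \<in> borel_measurable lebesgue"
        by (intro measurable_completion) measurable
      show "AE t in lebesgue. indicator {0<..<x} t *\<^sub>R (?r t / of_real (1 - t)) = indicator {0<..<x} t *\<^sub>R (f t / of_real (1 - t))"
        using ae by eventually_elim (use x in \<open>auto simp: indicator_def\<close>)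
    qed
    also have "\<dots> = (LINT t:{0<..<x}|lborel. f t / of_real (1 - t))"
      unfolding set_lebesgue_integral_def by (rule integral_completion) measurable
    also have "\<dots> = of_real (exp (- u / 2)) * ?h u"
      unfolding xu by (rule cesaro_integral) simp
    finally have "?c x = 1 / complex_of_real x * (of_real (exp (- u / 2)) * ?h u)"
      by simp
    also have "\<dots> = of_real (1 + exp u) * (of_real (exp (- u / 2)) * ?h u)"
      by (simp add: xu logistic_def)
    also have "of_real (1 + exp u) * (of_real (exp (- u / 2)) * ?h u) = Phi_inv_fun ?h x"
      unfolding xu Phi_inv_fun_logistic by (simp only: of_real_mult mult.assoc)
    finally show ?thesis .
  qed
  have sp: "space (lebesgue_on {0<..<1::real}) = {0<..<1}" by simp
  have "(abs_l2 (Phi_inv_fun ?h) :: unit_interval l2) = abs_l2 ?c"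
  proof (rule abs_l2_cong_AE; unfold l2_unit_interval)
    show "square_integrable (lebesgue_on {0<..<1}) (Phi_inv_fun ?h)" by (rule P(1))
    have "?c \<in> borel_measurable (lebesgue_on {0<..<1}) \<longleftrightarrow> Phi_inv_fun ?h \<in> borel_measurable (lebesgue_on {0<..<1})"
      by (rule measurable_cong) (use eq in simp)
    then show "?c \<in> borel_measurable (lebesgue_on {0<..<1})"
      using P(1) by (simp add: square_integrable_def)
    show "AE x in lebesgue_on {0<..<1}. Phi_inv_fun ?h x = ?c x"
      by (rule AE_I2) (use eq in simp)
  qed
  then have "cesaro (abs_l2 f) = abs_l2 (Phi_inv_fun ?h)"
    by (simp add: cesaro_def)
  then show ?thesis by (simp add: P(2))
qed

section \<open>Contractive multipliers\<close>

lemma line_cases: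
  obtains f where "square_integrable lebesgue f" "(F :: real_line l2) = abs_l2 f"
  using l2_cases[where 'd = real_line] by (metis l2_real_line)

lemma line_cinner:
  "square_integrable lebesgue f \<Longrightarrow> square_integrable lebesgue g \<Longrightarrow>
     cinner (abs_l2 f) (abs_l2 g :: real_line l2) = (LINT x|lebesgue. f x * cnj (g x))"
  using cinner_abs_l2[where 'd = real_line, of f g] unfolding l2_real_line .

lemma line_eq_iff:
  "square_integrable lebesgue f \<Longrightarrow> square_integrable lebesgue g \<Longrightarrow>
     (abs_l2 f :: real_line l2) = abs_l2 g \<longleftrightarrow> (AE x in lebesgue. f x = g x)"
  using abs_l2_eq_iff[where 'd = real_line, of f g] unfolding l2_real_line .

text \<open>
  The bound one almost everywhere covers powers of the Cayley transform, indicators and unimodular functions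
  alike, and it is stable under products and conjugation.
\<close>

definition contractive :: "(real \<Rightarrow> complex) \<Rightarrow> bool" where
  "contractive p \<longleftrightarrow> p \<in> borel_measurable lebesgue \<and> (AE x in lebesgue. cmod (p x) \<le> 1)"

lemma contractive_cnj: "contractive p \<Longrightarrow> contractive (\<lambda>x. cnj (p x))"
  by (auto simp: contractive_def intro: measurable_compose[OF _ cnj_borel_measurable])

lemma contractive_mult:
  assumes "contractive p" "contractive q"
  shows "contractive (\<lambda>x. p x * q x)"
proof -
  have "AE x in lebesgue. cmod (p x) \<le> 1" "AE x in lebesgue. cmod (q x) \<le> 1"
    using assms by (auto simp: contractive_def)
  then have "AE x in lebesgue. cmod (p x * q x) \<le> 1"
    by eventually_elim (simp add: norm_mult mult_le_one)
  then show ?thesis using assms by (auto simp: contractive_def)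
qed

lemma contractive_cayley: "contractive cayley"
  by (simp add: contractive_def cayley_lebesgue)

lemma contractive_power: "contractive p \<Longrightarrow> contractive (\<lambda>x. p x ^ n)"
proof (induction n)
  case (Suc n)
  then show ?case using contractive_mult[of p "\<lambda>x. p x ^ n"] by simp
qed (simp add: contractive_def)

lemma contractive_indicator: "A \<in> sets lebesgue \<Longrightarrow> contractive (indicator A)"
  by (auto simp: contractive_def indicator_def intro!: borel_measurable_indicator AE_I2)

lemma
  assumes p: "contractive p" and f: "square_integrable lebesgue f"
  shows square_integrable_contractive_mult: "square_integrable lebesgue (\<lambda>x. p x * f x)"
    and line_mult: "mult_l2 p (abs_l2 f) = (abs_l2 (\<lambda>x. p x * f x) :: real_line l2)"
  using square_integrable_bounded_mult[of p lebesgue 1 f] mult_l2_abs_l2[where 'd = real_line, of p 1 f] assms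
  unfolding l2_real_line contractive_def by auto

lemma bounded_linear_contractive: "contractive p \<Longrightarrow> bounded_linear (mult_l2 p :: real_line l2 \<Rightarrow> _)"
  using bounded_linear_mult_l2[where 'd = real_line, of p 1] unfolding l2_real_line contractive_def by auto

lemma contractive_scaleC:
  "contractive p \<Longrightarrow> mult_l2 p (scaleC c F) = scaleC c (mult_l2 p F :: real_line l2)"
  using mult_l2_scaleC[where 'd = real_line, of p 1] unfolding l2_real_line contractive_def by auto

lemma contractive_mult_mult:
  "contractive p \<Longrightarrow> contractive q \<Longrightarrow>
     mult_l2 p (mult_l2 q F) = (mult_l2 (\<lambda>x. p x * q x) F :: real_line l2)"
  using mult_l2_mult_l2[where 'd = real_line, of p 1 q 1] unfolding l2_real_line contractive_def by auto

lemma contractive_commute: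
  "contractive p \<Longrightarrow> contractive q \<Longrightarrow>
     mult_l2 p (mult_l2 q F) = (mult_l2 q (mult_l2 p F) :: real_line l2)"
  by (simp add: contractive_mult_mult mult.commute)

lemma mult_l2_cong_AE:
  assumes "contractive p" "contractive q" "AE x in lebesgue. p x = q x"
  shows "mult_l2 p F = (mult_l2 q F :: real_line l2)"
proof -
  obtain f where f: "square_integrable lebesgue f" "F = abs_l2 f" by (rule line_cases)
  have "AE x in lebesgue. p x * f x = q x * f x"
    using assms(3) by eventually_elim simp
  then show ?thesis
    using f assms by (simp add: line_mult line_eq_iff square_integrable_contractive_mult)
qed

lemma mult_l2_one: "mult_l2 (\<lambda>x. 1) F = (F :: real_line l2)"
proof -
  obtain f where f: "square_integrable lebesgue f" "F = abs_l2 f" by (rule line_cases)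
  moreover have "contractive (\<lambda>x. 1)" by (simp add: contractive_def)
  ultimately show ?thesis by (simp add: line_mult)
qed

lemma unimodular_inverse:
  assumes p: "contractive p" and u: "AE x in lebesgue. cmod (p x) = 1"
  shows "mult_l2 p (mult_l2 (\<lambda>x. cnj (p x)) F) = (F :: real_line l2)"
    "mult_l2 (\<lambda>x. cnj (p x)) (mult_l2 p F) = (F :: real_line l2)"
proof -
  have "AE x in lebesgue. p x * cnj (p x) = 1"
    using u by eventually_elim (simp add: complex_norm_square[symmetric])
  then have "mult_l2 (\<lambda>x. p x * cnj (p x)) F = mult_l2 (\<lambda>x. 1) F"
    by (rule mult_l2_cong_AE[rotated 2]) (simp_all add: contractive_mult contractive_cnj p, simp add: contractive_def)
  then show *: "mult_l2 p (mult_l2 (\<lambda>x. cnj (p x)) F) = F"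
    by (simp add: contractive_mult_mult contractive_cnj p mult_l2_one)
  show "mult_l2 (\<lambda>x. cnj (p x)) (mult_l2 p F) = F"
    using * by (simp add: contractive_commute[OF contractive_cnj[OF p] p])
qed

lemma cinner_mult_adjoint:
  assumes p: "contractive p"
  shows "cinner (mult_l2 p F) G = cinner F (mult_l2 (\<lambda>x. cnj (p x)) G :: real_line l2)"
proof -
  obtain f where f: "square_integrable lebesgue f" "F = abs_l2 f" by (rule line_cases)
  obtain g where g: "square_integrable lebesgue g" "G = abs_l2 g" by (rule line_cases)
  show ?thesis
    using f g p contractive_cnj[OF p]
    by (simp add: line_mult line_cinner square_integrable_contractive_mult) (simp add: ac_simps)
qed

lemma cinner_commute: "cinner G F = cnj (cinner F G :: complex)" for F G :: "real_line l2"
proof -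
  obtain f where f: "square_integrable lebesgue f" "F = abs_l2 f" by (rule line_cases)
  obtain g where g: "square_integrable lebesgue g" "G = abs_l2 g" by (rule line_cases)
  have "cnj (LINT x|lebesgue. f x * cnj (g x)) = (LINT x|lebesgue. cnj (f x * cnj (g x)))"
    by (rule Bochner_Integration.integral_cnj[symmetric])
  then show ?thesis
    using f g by (simp add: line_cinner mult.commute)
qed

lemma cinner_scaleC_right: "cinner F (scaleC c G) = cnj c * cinner F (G :: real_line l2)"
proof -
  obtain f where f: "square_integrable lebesgue f" "F = abs_l2 f" by (rule line_cases)
  obtain g where g: "square_integrable lebesgue g" "G = abs_l2 g" by (rule line_cases)
  have "scaleC c G = abs_l2 (\<lambda>x. c * g x)"
    using g abs_l2_scaleC[where 'd = real_line, of g c] by (simp add: l2_real_line)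
  moreover have "(LINT x|lebesgue. f x * (cnj c * cnj (g x))) = cnj c * (LINT x|lebesgue. f x * cnj (g x))"
    by (simp add: mult.left_commute[of _ "cnj c"])
  ultimately show ?thesis
    using f g by (simp add: line_cinner square_integrable_mult_const)
qed

lemma cinner_diff_left: "cinner (F - F') G = cinner F G - cinner F' G"
  by (simp add: cinner_def inner_diff_left complex_eq_iff)

text \<open>
  The uniqueness theorem in the form in which it is used: orthogonality to the whole two-sided orbit
  of \<open>g\<close> forces disjoint supports.
\<close>

lemma orthogonal_to_cayley_orbit_imp_product_zero:
  assumes r: "square_integrable lebesgue r" and g: "square_integrable lebesgue g"
    and orth: "\<And>n. cinner (abs_l2 r) (mult_l2 (\<lambda>x. cayley x ^ n) (abs_l2 g :: real_line l2)) = 0"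
      "\<And>n. cinner (abs_l2 r) (mult_l2 (\<lambda>x. cnj (cayley x) ^ n) (abs_l2 g :: real_line l2)) = 0"
  shows "AE x in lebesgue. r x * cnj (g x) = 0"
proof (rule cayley_null_imp_zero_AE)
  note c = contractive_power[OF contractive_cayley] contractive_power[OF contractive_cnj[OF contractive_cayley]]
  have "(LINT x|lebesgue. cnj (cayley x) ^ n * (r x * cnj (g x))) = 0" for n
    unfolding orth(1)[of n, symmetric]
    by (simp add: line_mult c g line_cinner r square_integrable_contractive_mult) (simp add: ac_simps)
  moreover have "(LINT x|lebesgue. cayley x ^ n * (r x * cnj (g x))) = 0" for n
    unfolding orth(2)[of n, symmetric]
    by (simp add: line_mult c g line_cinner r square_integrable_contractive_mult) (simp add: ac_simps)
  ultimately show "cayley_null (\<lambda>x. r x * cnj (g x))"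
    using square_integrable_mult[OF r square_integrable_cnj[OF g]] by (simp add: cayley_null_def)
qed

lemma mult_power_closed:
  assumes "contractive p" "\<And>F. F \<in> N \<Longrightarrow> mult_l2 p F \<in> N" "G \<in> N"
  shows "(mult_l2 (\<lambda>x. p x ^ n) G :: real_line l2) \<in> N"
proof (induction n)
  case 0
  then show ?case using assms(3) by (simp add: mult_l2_one)
next
  case (Suc n)
  then show ?case
    using assms(2)[OF Suc] contractive_mult_mult[OF assms(1) contractive_power[OF assms(1)], of n G] by simp
qed

section \<open>Subspaces invariant under a multiplication and its adjoint\<close>

text \<open>
  Wiener's theorem. The projection \<open>y\<close> of a nowhere vanishing \<open>w\<close> to \<open>N\<close> satisfies
  \<open>(w - y) * cnj y = 0\<close>, so it is \<open>w\<close> on a set \<open>A\<close> and zero off \<open>A\<close>. The elements of \<open>N\<close> are orthogonal to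
  the orbit of \<open>w - y\<close>, so they vanish off \<open>A\<close>; and a function supported on \<open>A\<close> that is orthogonal to the
  orbit of \<open>y\<close> is zero.
\<close>

theorem reducing_subspace:
  fixes N :: "real_line l2 set" and w :: "real \<Rightarrow> complex"
  assumes N: "closed N" "l2.subspace N"
    and inv: "\<And>F. F \<in> N \<Longrightarrow> mult_l2 cayley F \<in> N" "\<And>F. F \<in> N \<Longrightarrow> mult_l2 (\<lambda>x. cnj (cayley x)) F \<in> N"
    and w: "square_integrable lborel w" "\<And>x. w x \<noteq> 0"
  shows "\<exists>A\<in>sets lebesgue. N = range (mult_l2 (indicator A))"
proof -
  have ortho: "AE x in lebesgue. r x * cnj (g x) = 0"
    if "square_integrable lebesgue r" "square_integrable lebesgue g" "abs_l2 g \<in> N"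
      "\<And>Z. Z \<in> N \<Longrightarrow> cinner (abs_l2 r) Z = 0" for r g
    using that by (intro orthogonal_to_cayley_orbit_imp_product_zero that(4)
      mult_power_closed contractive_cnj contractive_cayley inv) auto
  have wl: "square_integrable lebesgue w"
    by (rule square_integrable_lebesgue_if_lborel[OF w(1)])
  obtain Y where Y: "Y \<in> N" "\<And>Z. Z \<in> N \<Longrightarrow> cinner (abs_l2 w - Y) Z = 0"
    using l2_projection[OF N] by blast
  obtain y where y: "y \<in> borel_measurable borel" "square_integrable lborel y" "Y = abs_l2 y"
    by (rule real_line_borel_cases)
  have yl: "square_integrable lebesgue y"
    by (rule square_integrable_lebesgue_if_lborel[OF y(2)])
  have wy: "square_integrable lebesgue (\<lambda>x. w x - y x)"
    by (rule square_integrable_diff[OF wl yl])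
  have wyN: "cinner (abs_l2 (\<lambda>x. w x - y x)) Z = 0" if "Z \<in> N" for Z
    using Y(2)[OF that] y abs_l2_diff[where 'd = real_line, of w y] wl yl by (simp add: l2_real_line)
  \<comment> \<open>off \<open>A\<close> the product \<open>(w - y) * cnj y\<close> can only vanish with \<open>y\<close>\<close>
  define A where "A = {x. y x = w x}"
  have A: "A \<in> sets lebesgue"
  proof -
    have "(\<lambda>x. y x - w x) \<in> borel_measurable borel"
      using y(1) square_integrable_borel[OF w(1)] by measurable
    from measurable_sets[OF this, of "{0}"] have "A \<in> sets borel"
      by (simp add: A_def vimage_def)
    then show ?thesis by simp
  qed
  have yA: "AE x in lebesgue. x \<notin> A \<longrightarrow> y x = 0"
    using ortho[OF wy yl _ wyN] Y(1) y(3) by (auto simp: A_def elim!: eventually_mono)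
  have NA: "AE x in lebesgue. x \<notin> A \<longrightarrow> g x = 0" if g: "square_integrable lebesgue g" "abs_l2 g \<in> N" for g
  proof -
    have "AE x in lebesgue. (w x - y x) * cnj (g x) = 0"
      by (rule ortho[OF wy g wyN])
    with yA show ?thesis
    proof eventually_elim
      case (elim x)
      then show ?case using w(2)[of x] by auto
    qed
  qed
  have ind: "mult_l2 (indicator A) (abs_l2 g) = (abs_l2 g :: real_line l2)"
    if g: "square_integrable lebesgue g" "AE x in lebesgue. x \<notin> A \<longrightarrow> g x = 0" for g
  proof -
    have "AE x in lebesgue. indicator A x * g x = g x"
      using g(2) by eventually_elim (auto simp: indicator_def)
    then show ?thesis
      using g by (simp add: line_mult contractive_indicator A line_eq_iff square_integrable_contractive_mult)
  qed
  have "N = range (mult_l2 (indicator A))"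
  proof (intro equalityI subsetI)
    fix G assume G: "G \<in> N"
    obtain g where g: "square_integrable lebesgue g" "G = abs_l2 g" by (rule line_cases)
    have "G = mult_l2 (indicator A) G"
      using ind[OF g(1) NA[OF g(1)]] G g(2) by simp
    then show "G \<in> range (mult_l2 (indicator A))" by (rule range_eqI)
  next
    fix G :: "real_line l2" assume "G \<in> range (mult_l2 (indicator A))"
    then obtain H where H: "G = mult_l2 (indicator A) H" by blast
    obtain h where h: "square_integrable lebesgue h" "H = abs_l2 h" by (rule line_cases)
    let ?g = "\<lambda>x. indicator A x * h x"
    have g: "square_integrable lebesgue ?g" "G = abs_l2 ?g"
      using h H by (simp_all add: line_mult contractive_indicator A square_integrable_contractive_mult)
    obtain Z where Z: "Z \<in> N" "\<And>V. V \<in> N \<Longrightarrow> cinner (G - Z) V = 0"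
      using l2_projection[OF N] by blast
    obtain z where z: "square_integrable lebesgue z" "Z = abs_l2 z" by (rule line_cases)
    have gz: "square_integrable lebesgue (\<lambda>x. ?g x - z x)"
      by (rule square_integrable_diff[OF g(1) z(1)])
    have GZ: "G - Z = abs_l2 (\<lambda>x. ?g x - z x)"
      using g z abs_l2_diff[where 'd = real_line, of ?g z] by (simp add: l2_real_line)
    have "AE x in lebesgue. (?g x - z x) * cnj (y x) = 0"
      using ortho[OF gz yl] Z(2) GZ Y(1) y(3) by simp
    moreover have "AE x in lebesgue. x \<notin> A \<longrightarrow> z x = 0"
      using NA[OF z(1)] Z(1) z(2) by simp
    ultimately have "AE x in lebesgue. ?g x = z x"
    proof eventually_elim
      case (elim x)
      then show ?case using w(2)[of x] by (cases "x \<in> A") (auto simp: A_def)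
    qed
    then have "G = Z"
      using g z by (simp add: line_eq_iff)
    with Z(1) show "G \<in> N" by simp
  qed
  with A show ?thesis by blast
qed

section \<open>The Hardy space\<close>

lemma indicator_idem:
  assumes A: "A \<in> sets lebesgue"
  shows "F \<in> range (mult_l2 (indicator A)) \<longleftrightarrow> mult_l2 (indicator A) F = (F :: real_line l2)"
proof
  assume "F \<in> range (mult_l2 (indicator A))"
  then obtain G where G: "F = mult_l2 (indicator A) G" by blast
  have "(\<lambda>x. indicator A x * indicator A x :: complex) = indicator A"
    by (auto simp: indicator_def)
  then show "mult_l2 (indicator A) F = F"
    unfolding G by (simp add: contractive_mult_mult contractive_indicator A)
qed (metis rangeI)

lemma hardy_iff: "F \<in> hardy \<longleftrightarrow> mult_l2 (indicator {0<..}) (fourier F) = fourier F"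
proof -
  have "F \<in> hardy \<longleftrightarrow> fourier F \<in> range (mult_l2 (indicator {0<..}))"
    unfolding hardy_def
    using bij_fourier by (metis (no_types, lifting) bij_inv_eq_iff image_iff)
  then show ?thesis by (simp add: indicator_idem)
qed

lemma contractive_half_line: "contractive (indicator {0<..})"
  by (rule contractive_indicator) simp

lemma closed_hardy: "closed hardy"
proof -
  have "hardy = {F. mult_l2 (indicator {0<..}) (fourier F) = fourier F}"
    using hardy_iff by blast
  also have "closed \<dots>"
    by (intro closed_Collect_eq linear_continuous_on bounded_linear_fourier
        bounded_linear_compose[OF bounded_linear_contractive[OF contractive_half_line] bounded_linear_fourier])
  finally show ?thesis .
qed

lemma subspace_hardy: "l2.subspace hardy"
proof -
  note l = bounded_linear.linear[OF bounded_linear_fourier]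
    bounded_linear.linear[OF bounded_linear_contractive[OF contractive_half_line]]
  show ?thesis
    by (auto simp: l2.subspace_def hardy_iff linear_0[OF l(1)] linear_0[OF l(2)] linear_add[OF l(1)]
        linear_add[OF l(2)] fourier_scaleC contractive_scaleC contractive_half_line)
qed

lemma hardy_cases:
  assumes "F \<in> hardy"
  obtains g where "square_integrable lborel g" "\<And>x. x \<le> 0 \<Longrightarrow> g x = 0" "fourier F = abs_l2 g"
proof -
  obtain g where g: "square_integrable lborel g" "fourier F = abs_l2 g" by (rule real_line_borel_cases)
  let ?h = "\<lambda>x. indicator {0<..} x * g x"
  have "fourier F = mult_l2 (indicator {0<..}) (abs_l2 g)"
    using assms g by (simp add: hardy_iff)
  then have "fourier F = abs_l2 ?h"
    using g by (simp add: line_mult contractive_half_line square_integrable_lebesgue_if_lborel)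
  moreover have "square_integrable lborel ?h"
    by (rule square_integrable_bounded_mult[where B = 1]) (auto simp: g indicator_def)
  ultimately show thesis by (intro that[of ?h]) auto
qed

lemma hardyI:
  assumes g: "square_integrable lborel g" "\<And>x. x \<le> 0 \<Longrightarrow> g x = 0" "fourier F = abs_l2 g"
  shows "F \<in> hardy"
proof -
  have "(\<lambda>x. indicator {0<..} x * g x) = g"
    using g(2) by (auto simp: fun_eq_iff indicator_def not_less)
  then show ?thesis
    using g by (simp add: hardy_iff line_mult contractive_half_line square_integrable_lebesgue_if_lborel)
qed

lemma inner_fourier: "fourier F \<bullet> fourier G = F \<bullet> G"
  by (simp add: dot_norm norm_fourier fourier_add[symmetric])

lemma cinner_fourier: "cinner (fourier F) (fourier G) = cinner F G"
  by (simp add: cinner_def inner_fourier fourier_scaleC[symmetric])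

text \<open>
  The Fourier transform of a Hardy function lives on the positive half line, and that of a conjugated Hardy
  function on the negative one.
\<close>

lemma hardy_orthogonal_cnj:
  assumes F: "F \<in> hardy" and G: "G \<in> hardy"
  shows "cinner F (cnj_l2 G) = 0"
proof -
  obtain f where f: "square_integrable lborel f" "\<And>x. x \<le> 0 \<Longrightarrow> f x = 0" "fourier F = abs_l2 f"
    using hardy_cases[OF F] by blast
  obtain g where g: "square_integrable lborel g" "\<And>x. x \<le> 0 \<Longrightarrow> g x = 0" "fourier G = abs_l2 g"
    using hardy_cases[OF G] by blast
  have "fourier (cnj_l2 G) = abs_l2 (\<lambda>x. cnj (g (- x)))"
    using g by (simp add: fourier_cnj_l2 cnj_abs_l2 reflect_abs_l2 square_integrable_cnj)
  moreover have "square_integrable lborel (\<lambda>x. cnj (g (- x)))"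
    by (intro square_integrable_cnj square_integrable_reflect g)
  ultimately have "cinner F (cnj_l2 G) = (LINT x|lborel. f x * cnj (cnj (g (- x))))"
    using f by (simp add: cinner_fourier[of F, symmetric] cinner_real_line)
  also have "\<dots> = (LINT x|(lborel :: real measure). 0 :: complex)"
  proof (rule Bochner_Integration.integral_cong[OF refl])
    show "f x * cnj (cnj (g (- x))) = 0" for x
      using f(2)[of x] g(2)[of "- x"] by (cases "x \<le> 0") auto
  qed
  finally show ?thesis by simp
qed

lemma cayley_symbol: "1 / (1 / 2 - \<i> * of_real s) = 1 + cayley s"
proof -
  have "1 / 2 - \<i> * complex_of_real s \<noteq> 0" by (auto simp: complex_eq_iff)
  then show ?thesis
    using cayley_denom[of s] by (simp add: cayley_def field_simps)
qed

text \<open>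
  On the Fourier side, convolution with the Cesaro kernel is the identity plus multiplication by the Cayley
  transform.
\<close>

lemma convol_cesaro_kernel_fourier:
  assumes g: "square_integrable lborel g"
  shows "fourier (abs_l2 (convol cesaro_kernel g)) = fourier (abs_l2 g) + mult_l2 cayley (fourier (abs_l2 g))"
proof -
  obtain f where f: "square_integrable lebesgue f" "fourier (abs_l2 g) = abs_l2 f" by (rule line_cases)
  have "(\<lambda>s. of_real (sqrt (2 * pi)) * FT cesaro_kernel s) = (\<lambda>s. 1 + cayley s)"
    by (simp add: FT_cesaro_kernel cayley_symbol del: of_real_mult)
  then have "fourier (abs_l2 (convol cesaro_kernel g)) = mult_l2 (\<lambda>s. 1 + cayley s) (abs_l2 f)"
    by (simp add: fourier_convol integrable_cesaro_kernel square_integrable_cesaro_kernel g flip: f(2))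
  also have "\<dots> = abs_l2 (\<lambda>s. (1 + cayley s) * f s)"
  proof (rule mult_l2_abs_l2[where B = 2]; unfold l2_real_line)
    show "(\<lambda>s. 1 + cayley s) \<in> borel_measurable lebesgue"
      using cayley_lebesgue by (intro borel_measurable_add) auto
    show "AE s in lebesgue. cmod (1 + cayley s) \<le> 2"
    proof (rule AE_I2)
      fix s show "cmod (1 + cayley s) \<le> 2"
        using norm_triangle_ineq[of 1 "cayley s"] by simp
    qed
  qed (rule f)
  also have "\<dots> = abs_l2 f + abs_l2 (\<lambda>s. cayley s * f s)"
    using f square_integrable_contractive_mult[OF contractive_cayley f(1)]
    by (subst abs_l2_add) (simp_all add: l2_real_line distrib_right)
  finally show ?thesis
    using f by (simp add: line_mult contractive_cayley)
qed

text \<open>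
  If \<open>F\<close> is the inverse transform of \<open>g\<close>, then it is the transform of the reflection \<open>h\<close> of \<open>g\<close>. Multiplying
  by \<open>1 + cayley\<close> convolves \<open>h\<close> with the Cesaro kernel. Both live on the negative half line, hence so does
  their convolution.
\<close>

lemma mult_cayley_hardy:
  assumes "F \<in> hardy"
  shows "mult_l2 cayley F \<in> hardy"
proof -
  obtain g where g: "square_integrable lborel g" "\<And>x. x \<le> 0 \<Longrightarrow> g x = 0" "fourier F = abs_l2 g"
    using hardy_cases[OF assms] by blast
  define h where "h x = g (- x)" for x
  have h: "square_integrable lborel h"
    unfolding h_def by (rule square_integrable_reflect[OF g(1)])
  let ?c = "convol cesaro_kernel h"
  have c: "square_integrable lborel ?c"
    by (rule Young_convol(1)[OF integrable_cesaro_kernel h])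
  have Fh: "fourier (abs_l2 h) = F"
  proof -
    have "abs_l2 h = reflect_l2 (abs_l2 g)"
      using g by (simp add: reflect_abs_l2 h_def[abs_def])
    then show ?thesis
      using g(3) by (metis fourier_inversion fourier_reflect_l2)
  qed
  have eq: "F + mult_l2 cayley F = fourier (abs_l2 ?c)"
    by (simp add: convol_cesaro_kernel_fourier h Fh)
  have "fourier (fourier (abs_l2 ?c)) = reflect_l2 (abs_l2 ?c)"
    by (metis fourier_inversion reflect_l2_reflect_l2)
  then have ff: "fourier (fourier (abs_l2 ?c)) = abs_l2 (\<lambda>x. ?c (- x))"
    using c by (simp add: reflect_abs_l2)
  have "F + mult_l2 cayley F \<in> hardy"
    unfolding eq
  proof (rule hardyI[OF _ _ ff])
    show "square_integrable lborel (\<lambda>x. ?c (- x))"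
      by (rule square_integrable_reflect[OF c])
    fix x :: real assume x: "x \<le> 0"
    have "cesaro_kernel w * h (- x - w) = 0" for w
      using x g(2)[of "x + w"] by (auto simp: cesaro_kernel_def indicator_def h_def add.commute)
    then have "?c (- x) = (LINT w|(lborel :: real measure). 0)"
      unfolding convol_def by (simp only:)
    then show "?c (- x) = 0" by simp
  qed
  from l2.subspace_diff[OF subspace_hardy this assms] show ?thesis by simp
qed

text \<open>
  The function \<open>(1 + cayley) / sqrt (2 * pi)\<close>, a cyclic vector for multiplication by the Cayley transform on
  the Hardy space. The definition as a Fourier integral shows membership in the Hardy space.
\<close>

definition hardy_generator :: "real \<Rightarrow> complex" where
  "hardy_generator = FT cesaro_kernel"

lemma square_integrable_hardy_generator: "square_integrable lborel hardy_generator"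
  unfolding hardy_generator_def
  by (rule square_integrable_FT[OF integrable_cesaro_kernel square_integrable_cesaro_kernel])

lemma hardy_generator_eq: "hardy_generator s = (1 + cayley s) / of_real (sqrt (2 * pi))"
  using FT_cesaro_kernel[of s] unfolding cayley_symbol hardy_generator_def
  by (simp add: field_simps)

lemma hardy_generator_nonzero: "hardy_generator s \<noteq> 0"
proof -
  have "1 / 2 - \<i> * complex_of_real s \<noteq> 0"
    by (auto simp: complex_eq_iff)
  then have "1 + cayley s \<noteq> 0"
    unfolding cayley_symbol[symmetric] by simp
  then show ?thesis by (simp add: hardy_generator_eq)
qed

text \<open>
  Conjugating the generator is the same as multiplying it by the inverse of the Cayley transform. So the
  negative half of its orbit consists of the conjugates of the nonnegative half.
\<close>

lemma cnj_hardy_generator: "cnj (hardy_generator s) = cnj (cayley s) * hardy_generator s"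
proof -
  have "cnj (cayley s) * (1 + cayley s) = cnj (cayley s) + 1"
    using cayley_mult_cnj[of s] by (simp add: distrib_left mult.commute)
  then show ?thesis by (simp add: hardy_generator_eq add.commute)
qed

lemma hardy_generator_in_hardy: "abs_l2 hardy_generator \<in> hardy"
proof (rule hardyI)
  have "fourier (abs_l2 cesaro_kernel) = abs_l2 hardy_generator"
    unfolding hardy_generator_def
    by (rule fourier_abs_l2_L1[OF integrable_cesaro_kernel square_integrable_cesaro_kernel])
  then have "fourier (abs_l2 hardy_generator) = reflect_l2 (abs_l2 cesaro_kernel)"
    by (metis fourier_inversion reflect_l2_reflect_l2)
  then show "fourier (abs_l2 hardy_generator) = abs_l2 (\<lambda>x. cesaro_kernel (- x))"
    by (simp add: reflect_abs_l2 square_integrable_cesaro_kernel)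
  show "square_integrable lborel (\<lambda>x. cesaro_kernel (- x))"
    by (rule square_integrable_reflect[OF square_integrable_cesaro_kernel])
qed (simp add: cesaro_kernel_def)

text \<open>
  The two halves of the orbit of the generator; the second one overlaps the first one at index zero.
\<close>

abbreviation hardy_basis :: "nat \<Rightarrow> real_line l2" where
  "hardy_basis n \<equiv> mult_l2 (\<lambda>x. cayley x ^ n) (abs_l2 hardy_generator)"

abbreviation hardy_cobasis :: "nat \<Rightarrow> real_line l2" where
  "hardy_cobasis n \<equiv> mult_l2 (\<lambda>x. cnj (cayley x) ^ n) (abs_l2 hardy_generator)"

lemma hardy_basis_in_hardy: "hardy_basis n \<in> hardy"
  by (rule mult_power_closed[OF contractive_cayley mult_cayley_hardy hardy_generator_in_hardy])

lemma hardy_generator_lebesgue: "square_integrable lebesgue hardy_generator"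
  by (rule square_integrable_lebesgue_if_lborel[OF square_integrable_hardy_generator])

lemma hardy_cobasis_eq_cnj: "hardy_cobasis (Suc n) = cnj_l2 (hardy_basis n)"
proof -
  note g = square_integrable_hardy_generator
  have s: "square_integrable lborel (\<lambda>x. cayley x ^ n * hardy_generator x)"
    by (rule square_integrable_bounded_mult[where B = 1]) (auto simp: g norm_power)
  have "hardy_cobasis (Suc n) = abs_l2 (\<lambda>x. cnj (cayley x) ^ Suc n * hardy_generator x)"
    by (intro line_mult contractive_power contractive_cnj contractive_cayley hardy_generator_lebesgue)
  also have "(\<lambda>x. cnj (cayley x) ^ Suc n * hardy_generator x) = (\<lambda>x. cnj (cayley x ^ n * hardy_generator x))"
    by (simp add: fun_eq_iff cnj_hardy_generator ac_simps)
  also have "abs_l2 \<dots> = cnj_l2 (abs_l2 (\<lambda>x. cayley x ^ n * hardy_generator x))"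
    by (rule cnj_abs_l2[OF s, symmetric])
  also have "abs_l2 (\<lambda>x. cayley x ^ n * hardy_generator x) = hardy_basis n"
    by (intro line_mult[symmetric] contractive_power contractive_cayley hardy_generator_lebesgue)
  finally show ?thesis .
qed

lemma hardy_orthogonal_cobasis: "F \<in> hardy \<Longrightarrow> cinner F (hardy_cobasis (Suc n)) = 0"
  unfolding hardy_cobasis_eq_cnj by (rule hardy_orthogonal_cnj[OF _ hardy_basis_in_hardy])

lemma zero_if_orthogonal_to_bases:
  assumes "\<And>n. cinner F (hardy_basis n) = 0" "\<And>n. cinner F (hardy_cobasis (Suc n)) = 0"
  shows "F = 0"
proof -
  obtain f where f: "square_integrable lebesgue f" "F = abs_l2 f" by (rule line_cases)
  have co: "cinner F (hardy_cobasis n) = 0" for n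
    using assms(1)[of 0] assms(2)[of "n - 1"] by (cases n) auto
  have "AE x in lebesgue. f x * cnj (hardy_generator x) = 0"
    using orthogonal_to_cayley_orbit_imp_product_zero[OF f(1) hardy_generator_lebesgue] assms(1) co f(2) by simp
  then have "AE x in lebesgue. f x = 0"
    by eventually_elim (simp add: hardy_generator_nonzero)
  then have "F = abs_l2 (\<lambda>x. 0)"
    using f by (simp add: line_eq_iff square_integrable_zero)
  then show ?thesis by (simp add: abs_l2_zero)
qed

text \<open>
  Both inclusions have the same proof. The component of an element of one space orthogonal to the other
  is orthogonal to the first half of the orbit, which both spaces contain, and to the second half, to which both
  are orthogonal.
\<close>

lemma eq_hardyI:
  assumes N: "closed N" "l2.subspace N"
    and basis: "\<And>n. hardy_basis n \<in> N"
    and cobasis: "\<And>F n. F \<in> N \<Longrightarrow> cinner F (hardy_cobasis (Suc n)) = 0"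
  shows "N = hardy"
proof -
  have sub: "N \<subseteq> hardy"
  proof
    fix F assume F: "F \<in> N"
    obtain Y where Y: "Y \<in> hardy" "\<And>Z. Z \<in> hardy \<Longrightarrow> cinner (F - Y) Z = 0"
      using l2_projection[OF closed_hardy subspace_hardy] by blast
    have "F - Y = 0"
    proof (rule zero_if_orthogonal_to_bases)
      show "cinner (F - Y) (hardy_basis n) = 0" for n
        by (rule Y(2)[OF hardy_basis_in_hardy])
      show "cinner (F - Y) (hardy_cobasis (Suc n)) = 0" for n
        unfolding cinner_diff_left cobasis[OF F] hardy_orthogonal_cobasis[OF Y(1)] by simp
    qed
    with Y(1) show "F \<in> hardy" by simp
  qed
  moreover have "hardy \<subseteq> N"
  proof
    fix F assume F: "F \<in> hardy"
    obtain Y where Y: "Y \<in> N" "\<And>Z. Z \<in> N \<Longrightarrow> cinner (F - Y) Z = 0"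
      using l2_projection[OF N] by blast
    have "F - Y = 0"
    proof (rule zero_if_orthogonal_to_bases)
      show "cinner (F - Y) (hardy_basis n) = 0" for n
        by (rule Y(2)[OF basis])
      show "cinner (F - Y) (hardy_cobasis (Suc n)) = 0" for n
        unfolding cinner_diff_left cobasis[OF Y(1)] hardy_orthogonal_cobasis[OF F] by simp
    qed
    with Y(1) show "F \<in> N" by simp
  qed
  ultimately show ?thesis by blast
qed

section \<open>Simply invariant subspaces\<close>

lemma cinner_self: "cinner F F = of_real ((norm (F :: real_line l2))\<^sup>2)"
proof -
  have "Im (cinner F F) = 0"
    using cinner_commute[of F F] by (simp add: complex_eq_iff)
  then show ?thesis
    by (simp add: complex_eq_iff) (simp add: cinner_def power2_norm_eq_inner)
qed

text \<open>
  The moments of \<open>|g|\<^sup>2\<close> against the powers of the conjugate are inner products of \<open>g\<close> with its forward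
  orbit; those against the powers of the Cayley transform itself follow by conjugation.
\<close>

lemma cayley_moments_of_wandering_vector:
  assumes g: "square_integrable lebesgue g"
    and orth: "\<And>n. cinner (abs_l2 g) (mult_l2 (\<lambda>x. cayley x ^ Suc n) (abs_l2 g :: real_line l2)) = 0"
  shows "(LINT x|lebesgue. cnj (cayley x) ^ n * (g x * cnj (g x))) =
      (if n = 0 then of_real ((norm (abs_l2 g :: real_line l2))\<^sup>2) else 0)" (is "?L = ?R")
    and "(LINT x|lebesgue. cayley x ^ n * (g x * cnj (g x))) =
      (if n = 0 then of_real ((norm (abs_l2 g :: real_line l2))\<^sup>2) else 0)"
proof -
  note c = contractive_power[OF contractive_cayley]
  have "?L = cinner (abs_l2 g) (mult_l2 (\<lambda>x. cayley x ^ n) (abs_l2 g :: real_line l2))"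
    by (simp add: line_mult c g line_cinner square_integrable_contractive_mult) (simp add: ac_simps)
  also have "\<dots> = ?R"
    using orth[of "n - 1"] by (cases n) (simp_all add: mult_l2_one cinner_self)
  finally show L: "?L = ?R" .
  have "(LINT x|lebesgue. cayley x ^ n * (g x * cnj (g x))) =
      (LINT x|lebesgue. cnj (cnj (cayley x) ^ n * (g x * cnj (g x))))"
    by (simp add: mult.commute)
  also have "\<dots> = cnj ?L"
    by (rule Bochner_Integration.integral_cnj)
  finally show "(LINT x|lebesgue. cayley x ^ n * (g x * cnj (g x))) = ?R"
    unfolding L by simp
qed

lemma hardy_generator_class_nonzero: "abs_l2 hardy_generator \<noteq> (0 :: real_line l2)"
proof
  assume "abs_l2 hardy_generator = (0 :: real_line l2)"
  then have "AE x in lebesgue. hardy_generator x = 0"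
    using line_eq_iff[OF hardy_generator_lebesgue square_integrable_zero] by (simp add: abs_l2_zero)
  then have "AE x in (lborel :: real measure). False"
    by (simp add: hardy_generator_nonzero AE_completion_iff)
  then show False
    by (simp add: ae_filter_eq_bot_iff flip: trivial_limit_def)
qed

text \<open>
  The generator of the Hardy space is orthogonal to the rest of its forward orbit, too. After scaling, the two
  squared moduli have the same moments, and the uniqueness theorem applies to their difference.
\<close>

lemma wandering_vector_modulus:
  assumes p: "square_integrable lebesgue p" and p0: "abs_l2 p \<noteq> (0 :: real_line l2)"
    and orth: "\<And>n. cinner (abs_l2 p) (mult_l2 (\<lambda>x. cayley x ^ Suc n) (abs_l2 p :: real_line l2)) = 0"
  obtains c where "0 < c" "AE x in lebesgue. (cmod (p x))\<^sup>2 = c * (cmod (hardy_generator x))\<^sup>2"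
proof -
  let ?P = "abs_l2 p :: real_line l2" and ?K = "abs_l2 hardy_generator :: real_line l2"
  note k = hardy_generator_lebesgue
  \<comment> \<open>the constant that equalizes the moments of order zero\<close>
  define c where "c = (norm ?P)\<^sup>2 / (norm ?K)\<^sup>2"
  have c: "0 < c" using p0 hardy_generator_class_nonzero by (simp add: c_def)
  have Korth: "cinner ?K (mult_l2 (\<lambda>x. cayley x ^ Suc n) ?K) = 0" for n
  proof -
    have "cinner ?K (mult_l2 (\<lambda>x. cayley x ^ Suc n) ?K) = cnj (cinner (mult_l2 (\<lambda>x. cayley x ^ Suc n) ?K) ?K)"
      by (rule cinner_commute)
    also have "cinner (mult_l2 (\<lambda>x. cayley x ^ Suc n) ?K) ?K = cinner ?K (hardy_cobasis (Suc n))"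
      unfolding cinner_mult_adjoint[OF contractive_power[OF contractive_cayley]] by (simp del: power_Suc)
    also have "\<dots> = 0"
      by (rule hardy_orthogonal_cobasis[OF hardy_generator_in_hardy])
    finally show ?thesis by simp
  qed
  note mp = cayley_moments_of_wandering_vector[OF p orth]
  note mk = cayley_moments_of_wandering_vector[OF k Korth]
  let ?h = "\<lambda>x. p x * cnj (p x) - of_real c * (hardy_generator x * cnj (hardy_generator x))"
  have ip: "integrable lebesgue (\<lambda>x. p x * cnj (p x))"
    by (rule square_integrable_mult[OF p square_integrable_cnj[OF p]])
  have ik: "integrable lebesgue (\<lambda>x. hardy_generator x * cnj (hardy_generator x))"
    by (rule square_integrable_mult[OF k square_integrable_cnj[OF k]])
  have zero: "(if n = 0 then complex_of_real ((norm ?P)\<^sup>2) else 0) - of_real c * (if n = 0 then of_real ((norm ?K)\<^sup>2) else 0) = 0" for n :: nat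
  proof -
    have "(norm ?P)\<^sup>2 = c * (norm ?K)\<^sup>2"
      using hardy_generator_class_nonzero by (simp add: c_def)
    then have "complex_of_real ((norm ?P)\<^sup>2) = of_real c * of_real ((norm ?K)\<^sup>2)"
      by (simp only: of_real_mult)
    then show ?thesis by (simp del: of_real_power)
  qed
  have "AE x in lebesgue. ?h x = 0"
  proof (rule cayley_null_imp_zero_AE)
    have split: "u * ?h x = u * (p x * cnj (p x)) - of_real c * (u * (hardy_generator x * cnj (hardy_generator x)))" for u x
      by (simp add: right_diff_distrib mult.left_commute)
    have "(LINT x|lebesgue. cayley x ^ n * ?h x) = 0" for n
    proof -
      have "(LINT x|lebesgue. cayley x ^ n * ?h x) = (LINT x|lebesgue. cayley x ^ n * (p x * cnj (p x))) -
          of_real c * (LINT x|lebesgue. cayley x ^ n * (hardy_generator x * cnj (hardy_generator x)))"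
        unfolding split
        by (simp add: integrable_cayley_power_mult(1)[OF ip] integrable_cayley_power_mult(1)[OF ik])
      then show ?thesis unfolding mp(2) mk(2) zero .
    qed
    moreover have "(LINT x|lebesgue. cnj (cayley x) ^ n * ?h x) = 0" for n
    proof -
      have "(LINT x|lebesgue. cnj (cayley x) ^ n * ?h x) = (LINT x|lebesgue. cnj (cayley x) ^ n * (p x * cnj (p x))) -
          of_real c * (LINT x|lebesgue. cnj (cayley x) ^ n * (hardy_generator x * cnj (hardy_generator x)))"
        unfolding split
        by (simp add: integrable_cayley_power_mult(2)[OF ip] integrable_cayley_power_mult(2)[OF ik])
      then show ?thesis unfolding mp(1) mk(1) zero .
    qed
    moreover have "integrable lebesgue ?h"
      by (intro Bochner_Integration.integrable_diff integrable_mult_right ip ik)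
    ultimately show "cayley_null ?h"
      by (simp add: cayley_null_def)
  qed
  then have "AE x in lebesgue. (cmod (p x))\<^sup>2 = c * (cmod (hardy_generator x))\<^sup>2"
  proof eventually_elim
    case (elim x)
    then have "complex_of_real ((cmod (p x))\<^sup>2) = of_real (c * (cmod (hardy_generator x))\<^sup>2)"
      by (simp add: complex_norm_square del: of_real_power)
    then show ?case by (simp only: of_real_eq_iff)
  qed
  with c show thesis by (rule that)
qed

text \<open>
  The theorem of Beurling and Helson. Let \<open>b\<close> be the Cayley transform and let \<open>F \<in> N\<close> with \<open>cnj b F \<notin> N\<close>. Remove
  from \<open>cnj b F\<close> its projection to \<open>N\<close> and multiply by \<open>b\<close>: the result \<open>P\<close> is a nonzero element of \<open>N\<close> orthogonal
  to \<open>b N\<close>. It has the form \<open>sqrt c * q * k\<close> with \<open>k\<close> the generator of the Hardy space and \<open>q\<close> unimodular, and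
  the space of all \<open>g\<close> with \<open>q g \<in> N\<close> contains the forward orbit of \<open>k\<close> and is orthogonal to the rest of it.
\<close>

theorem simply_invariant_subspace:
  fixes N :: "real_line l2 set"
  assumes N: "closed N" "l2.subspace N"
    and inv: "\<And>F. F \<in> N \<Longrightarrow> mult_l2 cayley F \<in> N"
    and F: "F \<in> N" "mult_l2 (\<lambda>x. cnj (cayley x)) F \<notin> N"
  shows "\<exists>q\<in>borel_measurable lebesgue. (AE x in lebesgue. cmod (q x) = 1) \<and> N = mult_l2 q ` hardy"
proof -
  let ?b = "mult_l2 cayley :: real_line l2 \<Rightarrow> _" and ?B = "mult_l2 (\<lambda>x. cnj (cayley x)) :: real_line l2 \<Rightarrow> _"
  let ?K = "abs_l2 hardy_generator :: real_line l2"
  note cb = contractive_cayley and cB = contractive_cnj[OF contractive_cayley]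
  have bB: "?b (?B G) = G" "?B (?b G) = G" for G
    using unimodular_inverse[OF cb] by simp_all
  have pow: "mult_l2 (\<lambda>x. cayley x ^ n) G \<in> N" if "G \<in> N" for G n
    by (rule mult_power_closed[OF cb inv that])
  have pow_Suc: "mult_l2 (\<lambda>x. cayley x ^ Suc n) G = ?b (mult_l2 (\<lambda>x. cayley x ^ n) G)" for G n
    by (simp add: contractive_mult_mult cb contractive_power)
  obtain Y where Y: "Y \<in> N" "\<And>Z. Z \<in> N \<Longrightarrow> cinner (?B F - Y) Z = 0"
    using l2_projection[OF N] by blast
  define P where "P = ?b (?B F - Y)"
  \<comment> \<open>multiplication by \<open>b\<close> undoes multiplication by its conjugate\<close>
  have "P = F - ?b Y"
    by (simp add: P_def linear_diff[OF bounded_linear.linear[OF bounded_linear_contractive[OF cb]]] bB)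
  then have PN: "P \<in> N"
    using l2.subspace_diff[OF N(2) F(1) inv[OF Y(1)]] by simp
  have orth: "cinner P (?b G) = 0" if "G \<in> N" for G
    using Y(2)[OF that] by (simp add: P_def cinner_mult_adjoint[OF cb] bB)
  have P0: "P \<noteq> 0"
  proof
    assume "P = 0"
    then have "?B F - Y = ?B 0"
      using bB(2)[of "?B F - Y"] by (simp add: P_def)
    then have "?B F = Y"
      by (simp add: linear_0[OF bounded_linear.linear[OF bounded_linear_contractive[OF cB]]])
    with F(2) Y(1) show False by simp
  qed
  obtain p where p: "square_integrable lebesgue p" "P = abs_l2 p" by (rule line_cases)
  note k = hardy_generator_lebesgue
  have Porth: "cinner (abs_l2 p) (mult_l2 (\<lambda>x. cayley x ^ Suc n) (abs_l2 p :: real_line l2)) = 0" for n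
    using orth[OF pow[OF PN, of n]] unfolding pow_Suc p(2) .
  obtain c where c: "0 < c" "AE x in lebesgue. (cmod (p x))\<^sup>2 = c * (cmod (hardy_generator x))\<^sup>2"
    using wandering_vector_modulus[OF p(1) _ Porth] P0 p(2) by blast
  define q where "q x = p x / (of_real (sqrt c) * hardy_generator x)" for x
  have qm: "q \<in> borel_measurable lebesgue"
    unfolding q_def[abs_def] using p(1) k unfolding square_integrable_def
    by (intro borel_measurable_divide borel_measurable_times) auto
  have q1: "AE x in lebesgue. cmod (q x) = 1"
    using c(2)
  proof eventually_elim
    case (elim x)
    then have "(cmod (p x))\<^sup>2 = (sqrt c * cmod (hardy_generator x))\<^sup>2"
      using c(1) by (simp add: power_mult_distrib)
    then have "cmod (p x) = sqrt c * cmod (hardy_generator x)"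
      using c(1) by (simp add: power2_eq_iff_nonneg)
    then show ?case
      using c(1) hardy_generator_nonzero[of x] by (simp add: q_def norm_divide norm_mult)
  qed
  have cq: "contractive q"
    using q1 qm by (auto simp: contractive_def elim!: eventually_mono)
  have PqK: "mult_l2 q ?K = scaleC (1 / of_real (sqrt c)) P"
  proof -
    have "scaleC (1 / of_real (sqrt c)) P = abs_l2 (\<lambda>x. 1 / of_real (sqrt c) * p x)"
      using p abs_l2_scaleC[where 'd = real_line, of p] by (simp add: l2_real_line)
    also have "(\<lambda>x. 1 / of_real (sqrt c) * p x) = (\<lambda>x. q x * hardy_generator x)"
      by (simp add: fun_eq_iff q_def hardy_generator_nonzero)
    finally show ?thesis
      by (simp add: line_mult cq k)
  qed
  let ?N' = "mult_l2 q -` N"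
  have blq: "bounded_linear (mult_l2 q :: real_line l2 \<Rightarrow> _)"
    by (rule bounded_linear_contractive[OF cq])
  \<comment> \<open>this is where \<open>P = sqrt c * q * k\<close> and the orthogonality of \<open>P\<close> to \<open>b N\<close> enter\<close>
  have "?N' = hardy"
  proof (rule eq_hardyI)
    show "closed ?N'"
      by (rule closed_vimage[OF N(1) linear_continuous_on[OF blq]])
    show "l2.subspace ?N'"
      using N(2) by (auto simp: l2.subspace_def linear_0[OF bounded_linear.linear[OF blq]]
          linear_add[OF bounded_linear.linear[OF blq]] contractive_scaleC cq)
    show "hardy_basis n \<in> ?N'" for n
    proof -
      have "mult_l2 q (hardy_basis n) = mult_l2 (\<lambda>x. cayley x ^ n) (mult_l2 q ?K)"
        by (rule contractive_commute[OF cq contractive_power[OF cb]])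
      also have "\<dots> = scaleC (1 / of_real (sqrt c)) (mult_l2 (\<lambda>x. cayley x ^ n) P)"
        unfolding PqK by (rule contractive_scaleC[OF contractive_power[OF cb]])
      also have "\<dots> \<in> N"
        by (rule l2.subspace_scale[OF N(2) pow[OF PN]])
      finally show ?thesis by simp
    qed
    fix G n assume G: "G \<in> ?N'"
    define H where "H = mult_l2 q G"
    have H: "H \<in> N" "G = mult_l2 (\<lambda>x. cnj (q x)) H"
      using G by (simp_all add: H_def unimodular_inverse[OF cq q1])
    have "cinner G (hardy_cobasis (Suc n)) = cinner H (mult_l2 q (hardy_cobasis (Suc n)))"
      unfolding H(2) by (simp add: cinner_mult_adjoint[OF contractive_cnj[OF cq]])
    also have "mult_l2 q (hardy_cobasis (Suc n)) = mult_l2 (\<lambda>x. cnj (cayley x) ^ Suc n) (mult_l2 q ?K)"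
      by (rule contractive_commute[OF cq contractive_power[OF cB]])
    also have "cinner H \<dots> = cinner (mult_l2 (\<lambda>x. cayley x ^ Suc n) H) (mult_l2 q ?K)"
      unfolding cinner_mult_adjoint[OF contractive_power[OF cb]] by (simp del: power_Suc)
    also have "\<dots> = cnj (1 / of_real (sqrt c)) * cinner (?b (mult_l2 (\<lambda>x. cayley x ^ n) H)) P"
      unfolding PqK cinner_scaleC_right pow_Suc ..
    also have "cinner (?b (mult_l2 (\<lambda>x. cayley x ^ n) H)) P = cnj (cinner P (?b (mult_l2 (\<lambda>x. cayley x ^ n) H)))"
      by (rule cinner_commute)
    also have "cinner P (?b (mult_l2 (\<lambda>x. cayley x ^ n) H)) = 0"
      by (rule orth[OF pow[OF H(1)]])
    finally show "cinner G (hardy_cobasis (Suc n)) = 0" by simp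
  qed
  have "N = mult_l2 q ` hardy"
  proof (intro equalityI subsetI)
    fix G assume "G \<in> N"
    then have "mult_l2 (\<lambda>x. cnj (q x)) G \<in> ?N'"
      by (simp add: unimodular_inverse[OF cq q1])
    then show "G \<in> mult_l2 q ` hardy"
      unfolding \<open>?N' = hardy\<close> using unimodular_inverse(1)[OF cq q1, of G] by (metis imageI)
  next
    fix G assume "G \<in> mult_l2 q ` hardy"
    then show "G \<in> N"
      using \<open>?N' = hardy\<close> by blast
  qed
  with qm q1 show ?thesis by blast
qed

section \<open>Invariant subspaces of the Cesaro operator\<close>

lemma fourier_Phi_cesaro:
  "fourier (Phi (cesaro F)) = fourier (Phi F) + mult_l2 cayley (fourier (Phi F))"
proof -
  obtain f where f: "f \<in> borel_measurable borel" "square_integrable (lebesgue_on {0<..<1}) f" "F = abs_l2 f"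
    by (rule unit_interval_borel_cases)
  then show ?thesis
    by (simp add: Phi_cesaro_eq_convol Phi_abs_l2 convol_cesaro_kernel_fourier square_integrable_Phi_fun)
qed

lemma closed_isometric_image:
  fixes T :: "'a :: {real_normed_vector, complete_space} \<Rightarrow> 'b :: real_normed_vector"
  assumes T: "bounded_linear T" "\<And>x. norm (T x) = norm x" and S: "closed S"
  shows "closed (T ` S)"
  unfolding closed_sequential_limits
proof (intro allI impI, elim conjE)
  fix X l assume X: "\<forall>n. X n \<in> T ` S" "X \<longlonglongrightarrow> l"
  then have "\<forall>n. \<exists>y\<in>S. X n = T y" by auto
  then obtain y where y: "\<And>n. y n \<in> S" "\<And>n. X n = T (y n)" by metis
  have "dist (X m) (X n) = dist (y m) (y n)" for m n
    by (simp add: y dist_norm T(2) flip: linear_diff[OF bounded_linear.linear[OF T(1)]])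
  then have "Cauchy y"
    using LIMSEQ_imp_Cauchy[OF X(2)] by (simp add: Cauchy_def)
  then obtain z where z: "y \<longlonglongrightarrow> z"
    using Cauchy_convergent_iff convergent_def by blast
  have "z \<in> S"
    by (rule closed_sequentially[OF S y(1) z])
  moreover have "X \<longlonglongrightarrow> T z"
    using bounded_linear.tendsto[OF T(1) z] unfolding y(2)[symmetric] .
  then have "l = T z" using X(2) LIMSEQ_unique by blast
  ultimately show "l \<in> T ` S" by simp
qed

theorem corollary6p10:
  fixes M :: "unit_interval l2 set"
  assumes "l2.subspace M" and "closed M"
  shows "cesaro ` M \<subseteq> M \<longleftrightarrow>
    (\<exists>A \<in> sets lebesgue. M = inv Phi ` inv fourier ` range (mult_l2 (indicator A))) \<or>
    (\<exists>q \<in> borel_measurable lebesgue. (AE x in lebesgue. cmod (q x) = 1) \<and>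
       M = inv Phi ` inv fourier ` mult_l2 q ` hardy)"
proof -
  define T where "T = (\<lambda>F. fourier (Phi F))"
  define N where "N = T ` M"
  have bl: "bounded_linear T"
    unfolding T_def by (rule bounded_linear_compose[OF bounded_linear_fourier bounded_linear_Phi])
  have nT: "norm (T F) = norm F" for F
    by (simp add: T_def norm_fourier norm_Phi)
  have "bij T"
    unfolding T_def using bij_comp[OF bij_Phi bij_fourier] by (simp add: o_def)
  have sc: "T (scaleC c F) = scaleC c (T F)" for c F
    by (simp add: T_def Phi_scaleC fourier_scaleC)
  have add: "T (F + G) = T F + T G" for F G
    by (rule linear_add[OF bounded_linear.linear[OF bl]])
  have eq: "M = inv Phi ` inv fourier ` X \<longleftrightarrow> N = X" for X
  proof
    assume "M = inv Phi ` inv fourier ` X"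
    then have "N = (\<lambda>G. fourier (Phi (inv Phi (inv fourier G)))) ` X"
      by (simp add: N_def T_def image_image)
    then show "N = X"
      by (simp add: surj_f_inv_f bij_is_surj bij_Phi bij_fourier)
  next
    assume "N = X"
    then show "M = inv Phi ` inv fourier ` X"
      by (simp add: N_def[symmetric] T_def image_image bij_is_inj bij_Phi bij_fourier flip: \<open>N = X\<close>)
         (simp add: N_def T_def image_image bij_is_inj bij_Phi bij_fourier)
  qed
  have subN: "l2.subspace N"
  proof (rule l2.subspaceI)
    show "0 \<in> N"
      using l2.subspace_0[OF assms(1)] linear_0[OF bounded_linear.linear[OF bl]] unfolding N_def by (metis imageI)
    show "F + G \<in> N" if "F \<in> N" "G \<in> N" for F G
      using that l2.subspace_add[OF assms(1)] by (auto simp: N_def add[symmetric])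
    show "scaleC c F \<in> N" if "F \<in> N" for c F
      using that l2.subspace_scale[OF assms(1)] by (auto simp: N_def sc[symmetric])
  qed
  have closedN: "closed N"
    unfolding N_def by (rule closed_isometric_image[OF bl nT assms(2)])
  have Tc: "T (cesaro F) = T F + mult_l2 cayley (T F)" for F
    by (simp add: T_def fourier_Phi_cesaro)
  have inv: "cesaro ` M \<subseteq> M \<longleftrightarrow> (\<forall>F\<in>N. mult_l2 cayley F \<in> N)"
  proof
    assume M: "cesaro ` M \<subseteq> M"
    show "\<forall>F\<in>N. mult_l2 cayley F \<in> N"
    proof
      fix F assume "F \<in> N"
      then obtain G where G: "G \<in> M" "F = T G" by (auto simp: N_def)
      have "T (cesaro G) \<in> N" using M G by (auto simp: N_def)
      from l2.subspace_diff[OF subN this \<open>F \<in> N\<close>] show "mult_l2 cayley F \<in> N"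
        by (simp add: Tc G(2))
    qed
  next
    assume N: "\<forall>F\<in>N. mult_l2 cayley F \<in> N"
    show "cesaro ` M \<subseteq> M"
    proof (intro image_subsetI)
      fix F assume "F \<in> M"
      then have "T F \<in> N" by (simp add: N_def)
      then have "T (cesaro F) \<in> N"
        unfolding Tc using N by (intro l2.subspace_add[OF subN]) auto
      then show "cesaro F \<in> M"
        using \<open>bij T\<close> by (auto simp: N_def dest: injD[OF bij_is_inj])
    qed
  qed
  show ?thesis
    unfolding eq inv
  proof
    assume N: "\<forall>F\<in>N. mult_l2 cayley F \<in> N"
    show "(\<exists>A\<in>sets lebesgue. N = range (mult_l2 (indicator A))) \<or>
      (\<exists>q\<in>borel_measurable lebesgue. (AE x in lebesgue. cmod (q x) = 1) \<and> N = mult_l2 q ` hardy)"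
    proof (cases "\<forall>F\<in>N. mult_l2 (\<lambda>x. cnj (cayley x)) F \<in> N")
      case True
      have "\<exists>A\<in>sets lebesgue. N = range (mult_l2 (indicator A))"
        by (rule reducing_subspace[OF closedN subN _ _ square_integrable_hardy_generator hardy_generator_nonzero])
           (use N True in auto)
      then show ?thesis ..
    next
      case False
      then obtain F where F: "F \<in> N" "mult_l2 (\<lambda>x. cnj (cayley x)) F \<notin> N" by blast
      have "\<exists>q\<in>borel_measurable lebesgue. (AE x in lebesgue. cmod (q x) = 1) \<and> N = mult_l2 q ` hardy"
        by (rule simply_invariant_subspace[OF closedN subN _ F]) (use N in auto)
      then show ?thesis ..
    qed
  next
    assume "(\<exists>A\<in>sets lebesgue. N = range (mult_l2 (indicator A))) \<or>
      (\<exists>q\<in>borel_measurable lebesgue. (AE x in lebesgue. cmod (q x) = 1) \<and> N = mult_l2 q ` hardy)"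
    then show "\<forall>F\<in>N. mult_l2 cayley F \<in> N"
    proof
      assume "\<exists>A\<in>sets lebesgue. N = range (mult_l2 (indicator A))"
      then obtain A where A: "A \<in> sets lebesgue" "N = range (mult_l2 (indicator A))" by blast
      then show ?thesis
        using contractive_commute[OF contractive_cayley contractive_indicator[OF A(1)]] by auto
    next
      assume "\<exists>q\<in>borel_measurable lebesgue. (AE x in lebesgue. cmod (q x) = 1) \<and> N = mult_l2 q ` hardy"
      then obtain q where q: "q \<in> borel_measurable lebesgue" "AE x in lebesgue. cmod (q x) = 1"
        "N = mult_l2 q ` hardy" by blast
      then have "contractive q"
        by (auto simp: contractive_def elim!: eventually_mono)
      then show ?thesis
        using contractive_commute[OF contractive_cayley, of q] mult_cayley_hardy by (auto simp: q(3))
    qed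
  qed
qed

end
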